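(* Let $R$ be a commutative unitary ring of finite Morley rank and assume that $R$ has positive characteristic and that every field in $\mathcal K(R)$ is infinite. Then $R$ is almost $\mathcal K(R)$-internal. In particular, if in addition $R$ is a local ring, then it is almost strongly minimal.
   Context: Rings are considered as structures in the language of rings. A commutative unitary ring $R$ of finite Morley rank has finitely many maximal ideals; these are definable, and $\mathcal K(R)$ denotes the finite family of its residue fields $R/\mathfrak m$, $\mathfrak m$ a maximal ideal. **Almost internality, almost strong minimality.** Work in a saturated model of a complete theory of finite Morley rank, with imaginaries, so "definable" means interpretable (with parameters). For a family $\mathcal P_0$ of definable sets, a partial type (or definable set) $\pi$ over $A$ is almost $\mathcal P_0$-internal if there is a set $B\supseteq A$ such that every realisation of $\pi$ is algebraic over $B$ together with finitely many elements of sets in $\mathcal P_0$ that are definable over $B$. A partial type (or definable set) is almost strongly minimal if it is almost internal to a strongly minimal set; a structure is almost strongly minimal if its universe is (in a saturated model of its theory). *)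

theory Defs
  imports "HOL-Algebra.QuotRing" "HOL-Library.Equipollence"
begin

section \<open>Rings as first-order structures\<close>

datatype rterm =
    TVar nat
  | TZero
  | TOne
  | TAdd rterm rterm
  | TMult rterm rterm
  | TNeg rterm

text \<open>Formulas use de Bruijn indices: under \<open>FEx\<close>, variable 0 is the quantified one.\<close>

datatype rform =
    FEq rterm rterm
  | FNot rform
  | FAnd rform rform
  | FEx rform

primrec tval :: "('a, 'm) ring_scheme \<Rightarrow> (nat \<Rightarrow> 'a) \<Rightarrow> rterm \<Rightarrow> 'a" where
  "tval M v (TVar i) = v i"
| "tval M v TZero = \<zero>\<^bsub>M\<^esub>"
| "tval M v TOne = \<one>\<^bsub>M\<^esub>"
| "tval M v (TAdd s t) = tval M v s \<oplus>\<^bsub>M\<^esub> tval M v t"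
| "tval M v (TMult s t) = tval M v s \<otimes>\<^bsub>M\<^esub> tval M v t"
| "tval M v (TNeg t) = \<ominus>\<^bsub>M\<^esub> tval M v t"

primrec sat :: "('a, 'm) ring_scheme \<Rightarrow> (nat \<Rightarrow> 'a) \<Rightarrow> rform \<Rightarrow> bool" where
  "sat M v (FEq s t) \<longleftrightarrow> tval M v s = tval M v t"
| "sat M v (FNot p) \<longleftrightarrow> \<not> sat M v p"
| "sat M v (FAnd p q) \<longleftrightarrow> sat M v p \<and> sat M v q"
| "sat M v (FEx p) \<longleftrightarrow> (\<exists>a\<in>carrier M. sat M (case_nat a v) p)"

text \<open>
  The assignment given by a tuple. Variables beyond the tuple are sent to \<open>\<zero>\<close>; this
  is harmless, since \<open>\<zero>\<close> is a constant of the language.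
\<close>

definition asg :: "('a, 'm) ring_scheme \<Rightarrow> 'a list \<Rightarrow> nat \<Rightarrow> 'a" where
  "asg M xs i = (if i < length xs then xs ! i else \<zero>\<^bsub>M\<^esub>)"

definition tuples :: "('a, 'm) ring_scheme \<Rightarrow> nat \<Rightarrow> 'a list set" where
  "tuples M n = {xs. length xs = n \<and> set xs \<subseteq> carrier M}"

text \<open>The set defined in \<open>M\<^sup>n\<close> by a formula with parameters \<open>ps\<close>.\<close>

definition def_set :: "('a, 'm) ring_scheme \<Rightarrow> nat \<Rightarrow> rform \<Rightarrow> 'a list \<Rightarrow> 'a list set" where
  "def_set M n \<phi> ps = {xs \<in> tuples M n. sat M (asg M (xs @ ps)) \<phi>}"

definition definable :: "('a, 'm) ring_scheme \<Rightarrow> 'a set \<Rightarrow> nat \<Rightarrow> 'a list set \<Rightarrow> bool" where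
  "definable M A n X \<longleftrightarrow> (\<exists>\<phi> ps. set ps \<subseteq> A \<and> X = def_set M n \<phi> ps)"

definition elementary_embedding ::
    "('a, 'm) ring_scheme \<Rightarrow> ('b, 'k) ring_scheme \<Rightarrow> ('a \<Rightarrow> 'b) \<Rightarrow> bool" where
  "elementary_embedding R M f \<longleftrightarrow>
     f \<in> carrier R \<rightarrow> carrier M \<and>
     (\<forall>\<phi> v. range v \<subseteq> carrier R \<longrightarrow> (sat R v \<phi> \<longleftrightarrow> sat M (f \<circ> v) \<phi>))"

text \<open>
  \<open>M\<close> is saturated: every set \<open>p\<close> of formulas in one variable with parameters in a set
  \<open>A\<close> with \<open>|A| < |M|\<close> is realised, provided it is finitely satisfiable. A formula with
  parameters is a pair of a formula and a parameter tuple.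
\<close>

definition saturated :: "('a, 'm) ring_scheme \<Rightarrow> bool" where
  "saturated M \<longleftrightarrow>
     (\<forall>A p. A \<subseteq> carrier M \<longrightarrow> A \<prec> carrier M \<longrightarrow> (\<forall>(\<phi>, ps)\<in>p. set ps \<subseteq> A) \<longrightarrow>
        (\<forall>q. finite q \<longrightarrow> q \<subseteq> p \<longrightarrow>
           (\<exists>x\<in>carrier M. \<forall>(\<phi>, ps)\<in>q. sat M (asg M (x # ps)) \<phi>)) \<longrightarrow>
        (\<exists>x\<in>carrier M. \<forall>(\<phi>, ps)\<in>p. sat M (asg M (x # ps)) \<phi>))"

section \<open>Morley rank\<close>

text \<open>
  \<open>morley_ge M n k X\<close>: the Morley rank of the definable set \<open>X \<subseteq> M\<^sup>n\<close> is at least \<open>k\<close>.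
  Since the rank is computed in \<open>M\<close> itself, this is the Morley rank only for sufficiently
  saturated \<open>M\<close>. Finite levels suffice to express that the rank is finite.
\<close>

primrec morley_ge :: "('a, 'm) ring_scheme \<Rightarrow> nat \<Rightarrow> nat \<Rightarrow> 'a list set \<Rightarrow> bool" where
  "morley_ge M n 0 X \<longleftrightarrow> X \<noteq> {}"
| "morley_ge M n (Suc k) X \<longleftrightarrow>
     (\<exists>Y :: nat \<Rightarrow> 'a list set.
        (\<forall>i. definable M (carrier M) n (Y i) \<and> Y i \<subseteq> X \<and> morley_ge M n k (Y i)) \<and>
        (\<forall>i j. i \<noteq> j \<longrightarrow> Y i \<inter> Y j = {}))"

definition finite_morley_rank :: "('a, 'm) ring_scheme \<Rightarrow> bool" where
  "finite_morley_rank M \<longleftrightarrow> (\<exists>k. \<not> morley_ge M 1 k (tuples M 1))"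

section \<open>Interpretable sets\<close>

text \<open>
  An interpretable set is a quotient \<open>X / E\<close> with \<open>X \<subseteq> M\<^sup>n\<close> and \<open>E\<close> an equivalence
  relation on \<open>X\<close>, both definable; its points, the imaginaries, are the \<open>E\<close>-classes.
\<close>

record 'a iset =
  arity :: nat
  base :: "'a list set"
  eqrel :: "('a list \<times> 'a list) set"

definition points :: "'a iset \<Rightarrow> 'a list set set" where
  "points P = base P // eqrel P"

definition graph :: "('a list \<times> 'a list) set \<Rightarrow> 'a list set" where
  "graph E = {xs @ ys | xs ys. (xs, ys) \<in> E}"

definition interpretable :: "('a, 'm) ring_scheme \<Rightarrow> 'a set \<Rightarrow> 'a iset \<Rightarrow> bool" where
  "interpretable M A P \<longleftrightarrow>
     definable M A (arity P) (base P) \<and>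
     equiv (base P) (eqrel P) \<and>
     definable M A (2 * arity P) (graph (eqrel P))"

definition universe :: "('a, 'm) ring_scheme \<Rightarrow> 'a iset" where
  "universe M = \<lparr>arity = 1, base = tuples M 1, eqrel = Id_on (tuples M 1)\<rparr>"

text \<open>
  A definable set of \<open>R\<close>, read in an elementary extension \<open>f : R \<rightarrow> M\<close>: the set defined in
  \<open>M\<close> by any formula over \<open>R\<close> that defines \<open>X\<close> in \<open>R\<close>. By elementarity the choice of
  formula does not matter.
\<close>

definition extend_set ::
    "('a, 'm) ring_scheme \<Rightarrow> ('b, 'k) ring_scheme \<Rightarrow> ('a \<Rightarrow> 'b) \<Rightarrow> nat \<Rightarrow> 'a list set \<Rightarrow> 'b list set"
where
  "extend_set R M f n X =
     \<Union> {def_set M n \<phi> (map f ps) | \<phi> ps. set ps \<subseteq> carrier R \<and> X = def_set R n \<phi> ps}"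

definition extend_iset ::
    "('a, 'm) ring_scheme \<Rightarrow> ('b, 'k) ring_scheme \<Rightarrow> ('a \<Rightarrow> 'b) \<Rightarrow> 'a iset \<Rightarrow> 'b iset" where
  "extend_iset R M f P =
     \<lparr>arity = arity P,
      base = extend_set R M f (arity P) (base P),
      eqrel = {(xs, ys). length xs = arity P \<and> length ys = arity P \<and>
                 xs @ ys \<in> extend_set R M f (2 * arity P) (graph (eqrel P))}\<rparr>"

section \<open>Almost internality and almost strong minimality\<close>

text \<open>
  \<open>algebraic_over M B S es c\<close>: the point \<open>c\<close> of \<open>S\<close> is algebraic over \<open>B\<close> together with
  the imaginaries \<open>es\<close>. For quotients whose equivalence relations are definable over \<open>B\<close>,
  the relations definable over \<open>B\<close> between their points are exactly the images of relations
  \<open>Z\<close> definable over \<open>B\<close> between representatives, whence the quantifiers over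
  representatives.
\<close>

definition rel_fibre :: "'a iset \<Rightarrow> 'a list set list \<Rightarrow> 'a list set \<Rightarrow> 'a list set set" where
  "rel_fibre S es Z = {c \<in> points S. \<exists>x\<in>c. \<exists>ys\<in>listset es. x @ concat ys \<in> Z}"

definition algebraic_over ::
    "('a, 'm) ring_scheme \<Rightarrow> 'a set \<Rightarrow> 'a iset \<Rightarrow> 'a list set list \<Rightarrow> 'a list set \<Rightarrow> bool" where
  "algebraic_over M B S es c \<longleftrightarrow>
     (\<exists>n Z. definable M B n Z \<and> finite (rel_fibre S es Z) \<and> c \<in> rel_fibre S es Z)"

text \<open>
  In a saturated model parameter sets are small, so \<open>B\<close> is required to satisfy
  \<open>|B| < |M|\<close>; with \<open>B = M\<close> the notion would be trivial. Taking \<open>B\<close> to consist of real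
  elements is no restriction, as every imaginary is definable over a real tuple.
\<close>

definition almost_internal ::
    "('a, 'm) ring_scheme \<Rightarrow> 'a set \<Rightarrow> 'a iset set \<Rightarrow> 'a iset \<Rightarrow> bool" where
  "almost_internal M A \<P> S \<longleftrightarrow>
     interpretable M A S \<and>
     (\<exists>B. A \<subseteq> B \<and> B \<subseteq> carrier M \<and> B \<prec> carrier M \<and>
        (\<forall>c\<in>points S. \<exists>es.
           (\<forall>e\<in>set es. \<exists>P\<in>\<P>. interpretable M B P \<and> e \<in> points P) \<and>
           algebraic_over M B S es c))"

text \<open>For saturated \<open>M\<close>; in general the condition only expresses minimality.\<close>

definition strongly_minimal :: "('a, 'm) ring_scheme \<Rightarrow> 'a iset \<Rightarrow> bool" where
  "strongly_minimal M D \<longleftrightarrow>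
     interpretable M (carrier M) D \<and> infinite (points D) \<and>
     (\<forall>Y\<subseteq>points D. definable M (carrier M) (arity D) (\<Union>Y) \<longrightarrow>
        finite Y \<or> finite (points D - Y))"

definition almost_strongly_minimal ::
    "('a, 'm) ring_scheme \<Rightarrow> 'a set \<Rightarrow> 'a iset \<Rightarrow> bool" where
  "almost_strongly_minimal M A S \<longleftrightarrow>
     (\<exists>D. strongly_minimal M D \<and> almost_internal M A {D} S)"

section \<open>Residue fields\<close>

text \<open>
  The carrier of \<open>R Quot \<mm>\<close> as a quotient in the above sense, with 1-tuples in place of
  elements. Definability of \<open>\<mm>\<close> is not built in.
\<close>

definition residue_iset :: "('a, 'm) ring_scheme \<Rightarrow> 'a set \<Rightarrow> 'a iset" where
  "residue_iset R \<mm> =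
     \<lparr>arity = 1,
      base = tuples R 1,
      eqrel = {([x], [y]) | x y. x \<in> carrier R \<and> y \<in> carrier R \<and> x \<ominus>\<^bsub>R\<^esub> y \<in> \<mm>}\<rparr>"

definition residue_family :: "('a, 'm) ring_scheme \<Rightarrow> 'a iset set" where
  "residue_family R = residue_iset R ` {\<mm>. maximalideal \<mm> R}"

definition local_cring :: "('a, 'm) ring_scheme \<Rightarrow> bool" where
  "local_cring R \<longleftrightarrow> cring R \<and> (\<exists>!\<mm>. maximalideal \<mm> R)"

definition positive_characteristic :: "('a, 'm) ring_scheme \<Rightarrow> bool" where
  "positive_characteristic R \<longleftrightarrow> (\<exists>n::nat. 0 < n \<and> [n] \<cdot>\<^bsub>R\<^esub> \<one>\<^bsub>R\<^esub> = \<zero>\<^bsub>R\<^esub>)"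

end

theory Submission
  imports Defs "HOL-Computational_Algebra.Primes"
begin

text \<open>
  A strict chain of ideals \<open>(g\<^sub>1, \<dots>, g\<^sub>i)\<close> of \<open>R\<close> has infinite index at each step, because all residue fields
  are infinite; so finite Morley rank bounds its length and \<open>R\<close> has a composition series with factors
  \<open>R / m\<^sub>i\<close>. In residue characteristic \<open>p\<close> a power \<open>x ^ q\<close> with \<open>q = p ^ s\<close> large depends, after multiplication by some
  \<open>e\<^sub>i \<notin> m\<^sub>i\<close>, only on \<open>x\<close> modulo \<open>m\<^sub>i\<close>, and \<open>x \<mapsto> x ^ q\<close> is onto \<open>R / m\<^sub>i\<close>, since \<open>R / m\<^sub>i\<close> is perfect. Descending
  the composition series, every element is a sum of terms \<open>h\<^sub>i r\<^sub>i ^ q\<^sub>i\<close> with fixed \<open>h\<^sub>i = g\<^sub>i e\<^sub>i\<close>, in which the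
  \<open>i\<close>-th term is a function of the residue class of \<open>r\<^sub>i\<close>. This is first-order and passes to \<open>M\<close>.

  If \<open>R\<close> is local with residue field \<open>K\<close>, let \<open>D\<close> be a minimal subset of a minimal ideal. Choose
  \<open>t\<^sub>1, \<dots>, t\<^sub>n\<close> with \<open>n\<close> maximal such that \<open>(d\<^sub>1, \<dots>, d\<^sub>n) \<mapsto> t\<^sub>1 d\<^sub>1 + \<dots> + t\<^sub>n d\<^sub>n\<close> is injective on
  \<open>D\<^sup>n\<close>; such \<open>n\<close> are bounded by the rank. Adding any \<open>r\<close> destroys injectivity, so the residue class of \<open>r\<close> is a quotient of
  differences of elements of \<open>D\<close> and of the image, and \<open>M\<close> is internal to \<open>D\<close>. No structure theory of
  fields of finite Morley rank is needed.
\<close>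

section \<open>Commutative rings and Frobenius maps\<close>

text \<open>A composition series alone does not make \<open>R\<close> internal to its residue
  fields: the class of \<open>a\<close> modulo \<open>m_i\<close> determines \<open>g_i a\<close>
  only modulo the next lower ideal, and no definable choice of representatives is at hand. In
  positive characteristic the assignment of \<open>e_i r ^ q_i\<close> to the class of
  \<open>r\<close> serves instead, much like a Teichmueller lift. It need only be onto the residue
  field modulo \<open>m_i\<close>, because the error falls into the lower ideal and is treated
  there.

  The data are split between two rings: residue fields and characteristic are given for
  \<open>R\<close>, while the rank is counted in \<open>M\<close>. Ideals, chains and coordinates
  are therefore built in \<open>R\<close> and named by finite tuples of generators, and infinite
  families of cosets are carried to \<open>M\<close> two members at a time.

  In the local case nothing says that the residue field, with the structure induced on it, is
  strongly minimal. The set \<open>D\<close> is obtained from the rank only. It is sought in a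
  minimal ideal, a copy of the residue field consisting of elements rather than classes, where
  differences of elements of \<open>D\<close> have a known annihilator.\<close>

context cring
begin

lemma minus_eq_zero_iff:
  assumes "x \<in> carrier R" "y \<in> carrier R"
  shows "x \<ominus> y = \<zero> \<longleftrightarrow> x = y"
  using assms by (metis a_minus_def add.inv_closed minus_equality minus_minus r_neg)

lemma binomial:
  assumes [simp]: "x \<in> carrier R" "y \<in> carrier R"
  shows "(x \<oplus> y) [^] (n::nat) = (\<Oplus>k\<in>{..n}. [(n choose k)] \<cdot> (x [^] k \<otimes> y [^] (n - k)))"
proof (induction n)
  case 0
  then show ?case by simp
next
  case (Suc n)
  let ?t = "\<lambda>n k. [(n choose k)] \<cdot> (x [^] k \<otimes> y [^] (n - k))"
  have cl[simp]: "?t n k \<in> carrier R" for n k by simp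
  have 1: "x \<otimes> (\<Oplus>k\<in>{..n}. ?t n k) = (\<Oplus>k\<in>{..n}. [(n choose k)] \<cdot> (x [^] Suc k \<otimes> y [^] (n - k)))"
    by (subst finsum_rdistr) (auto intro!: finsum_cong' simp: add_pow_rdistr m_ac nat_pow_Suc)
  have 2: "y \<otimes> (\<Oplus>k\<in>{..n}. ?t n k) = (\<Oplus>k\<in>{..n}. [(n choose k)] \<cdot> (x [^] k \<otimes> y [^] Suc (n - k)))"
    by (subst finsum_rdistr) (auto intro!: finsum_cong' simp: add_pow_rdistr m_ac nat_pow_Suc)
  have 3: "(\<Oplus>k\<in>{..n}. [(n choose k)] \<cdot> (x [^] k \<otimes> y [^] Suc (n - k)))
      = (\<Oplus>k\<in>{..Suc n}. [(n choose k)] \<cdot> (x [^] k \<otimes> y [^] (Suc n - k)))"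
    by (subst finsum_Suc) (auto intro!: finsum_cong' simp: Suc_diff_le binomial_eq_0)
  have 4: "(\<Oplus>k\<in>{..Suc n}. [(n choose k)] \<cdot> (x [^] k \<otimes> y [^] (Suc n - k)))
      = (\<Oplus>k\<in>{..n}. [(n choose Suc k)] \<cdot> (x [^] Suc k \<otimes> y [^] (n - k))) \<oplus> y [^] Suc n"
    by (subst finsum_Suc2) (auto simp: Pi_def simp del: nat_pow_Suc)
  have 5: "(\<Oplus>k\<in>{..Suc n}. ?t (Suc n) k)
      = (\<Oplus>k\<in>{..n}. [(n choose k)] \<cdot> (x [^] Suc k \<otimes> y [^] (n - k)) \<oplus> [(n choose Suc k)] \<cdot> (x [^] Suc k \<otimes> y [^] (n - k))) \<oplus> y [^] Suc n"
    by (subst finsum_Suc2) (auto simp: Pi_def add.nat_pow_mult simp del: nat_pow_Suc)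
  have "(x \<oplus> y) [^] Suc n = x \<otimes> (\<Oplus>k\<in>{..n}. ?t n k) \<oplus> y \<otimes> (\<Oplus>k\<in>{..n}. ?t n k)"
    using Suc.IH by (simp add: l_distr m_comm r_distr)
  also have "\<dots> = (\<Oplus>k\<in>{..Suc n}. ?t (Suc n) k)"
    unfolding 1 2 3 4 5
    by (subst finsum_addf) (auto simp: Pi_def a_assoc simp del: nat_pow_Suc)
  finally show ?case .
qed

lemma finsum_add_pow_dvd:
  assumes "finite A" "\<And>k. k \<in> A \<Longrightarrow> p dvd c k" "\<And>k. k \<in> A \<Longrightarrow> t k \<in> carrier R"
  shows "\<exists>z\<in>carrier R. (\<Oplus>k\<in>A. [(c k :: nat)] \<cdot> t k) = [(p :: nat)] \<cdot> z"
  using assms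
proof (induction A rule: finite_induct)
  case empty
  then show ?case by (intro bexI[of _ \<zero>]) auto
next
  case (insert a A)
  then obtain z where z: "z \<in> carrier R" "(\<Oplus>k\<in>A. [(c k)] \<cdot> t k) = [p] \<cdot> z" by auto
  obtain d where d: "c a = d * p" using insert.prems(1)[of a] by (metis dvd_def insertI1 mult.commute)
  have "(\<Oplus>k\<in>insert a A. [(c k)] \<cdot> t k) = [(c a)] \<cdot> t a \<oplus> [p] \<cdot> z"
    using insert z by (subst finsum_insert) auto
  also have "\<dots> = [p] \<cdot> ([d] \<cdot> t a \<oplus> z)"
    using insert z d by (simp add: add.nat_pow_pow add.nat_pow_distrib)
  finally show ?case using insert z by (intro bexI[of _ "[d] \<cdot> t a \<oplus> z"]) auto
qed

lemma freshmans_dream_modulo: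
  assumes p: "prime (p::nat)" and [simp]: "x \<in> carrier R" "y \<in> carrier R"
  shows "\<exists>z\<in>carrier R. (x \<oplus> y) [^] p = x [^] p \<oplus> y [^] p \<oplus> [p] \<cdot> z"
proof -
  \<comment> \<open>Two successors, so that the terms for \<open>k = 0\<close> and
    \<open>k = p\<close> can be split off at both ends of the sum.\<close>
  obtain n where n: "p = Suc (Suc n)"
    using le_Suc_ex[OF prime_ge_2_nat[OF p]] by auto
  let ?t = "\<lambda>k. x [^] k \<otimes> y [^] (p - k)"
  have "\<exists>z\<in>carrier R. (\<Oplus>k\<in>{..n}. [(p choose (Suc k))] \<cdot> ?t (Suc k)) = [p] \<cdot> z"
    by (rule finsum_add_pow_dvd) (use p in \<open>auto intro!: dvd_choose_prime simp: n simp del: nat_pow_Suc binomial_Suc_Suc\<close>)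
  then obtain z where z: "z \<in> carrier R" "(\<Oplus>k\<in>{..n}. [(p choose (Suc k))] \<cdot> ?t (Suc k)) = [p] \<cdot> z" by auto
  have "(x \<oplus> y) [^] p = (\<Oplus>k\<in>{..Suc (Suc n)}. [(p choose k)] \<cdot> ?t k)"
    using binomial[of x y p] n by simp
  also have "\<dots> = x [^] p \<oplus> ((\<Oplus>k\<in>{..n}. [(p choose (Suc k))] \<cdot> ?t (Suc k)) \<oplus> y [^] p)"
    apply (subst finsum_Suc) apply simp
    apply (subst finsum_Suc2) apply simp
    by (simp add: n del: nat_pow_Suc binomial_Suc_Suc)
  finally show ?thesis using z by (auto simp: a_ac)
qed

text \<open>The cofactor is the sum of the products \<open>x [^] i \<otimes> y [^] (n - i)\<close>,
  all of which become \<open>x [^] n\<close> once \<open>x\<close> and \<open>y\<close> agree modulo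
  \<open>I\<close>. Factorisation and congruence are proved in one induction because they speak of
  the same \<open>s\<close>. For \<open>Suc n = p\<close> the congruence puts the cofactor in every
  such ideal that contains \<open>[p] \<cdot> \<one>\<close>.\<close>

lemma diff_pow_factor:
  assumes "ideal I R" and xy: "x \<in> carrier R" "y \<in> carrier R"
  shows "\<exists>s\<in>carrier R. x [^] Suc n \<ominus> y [^] Suc n = (x \<ominus> y) \<otimes> s \<and>
           (x \<ominus> y \<in> I \<longrightarrow> s \<ominus> [(Suc n)] \<cdot> (x [^] n) \<in> I)"
proof (induction n)
  case 0
  interpret I: ideal I R by fact
  have "\<one> \<ominus> \<one> = \<zero>" by (simp_all add: minus_eq_zero_iff)
  then show ?case using xy by (intro bexI[of _ \<one>]) auto
next
  case (Suc n)
  interpret I: ideal I R by fact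
  obtain s where s: "s \<in> carrier R" and e: "x [^] Suc n \<ominus> y [^] Suc n = (x \<ominus> y) \<otimes> s"
    and c: "x \<ominus> y \<in> I \<longrightarrow> s \<ominus> [(Suc n)] \<cdot> (x [^] n) \<in> I" using Suc by auto
  let ?s = "x [^] Suc n \<oplus> y \<otimes> s"
  have cl: "x [^] Suc n \<in> carrier R" "y [^] Suc n \<in> carrier R" "[(Suc n)] \<cdot> (x [^] n) \<in> carrier R"
    using xy by simp_all
  have "x [^] Suc (Suc n) \<ominus> y [^] Suc (Suc n) = (x \<ominus> y) \<otimes> x [^] Suc n \<oplus> y \<otimes> (x [^] Suc n \<ominus> y [^] Suc n)"
    using xy cl unfolding nat_pow_Suc[of x "Suc n"] nat_pow_Suc[of y "Suc n"] by algebra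
  also have "\<dots> = (x \<ominus> y) \<otimes> ?s" unfolding e using xy cl s by algebra
  finally have 1: "x [^] Suc (Suc n) \<ominus> y [^] Suc (Suc n) = (x \<ominus> y) \<otimes> ?s" .
  moreover have "?s \<ominus> [(Suc (Suc n))] \<cdot> (x [^] Suc n) \<in> I" if d: "x \<ominus> y \<in> I"
  proof -
    have S: "[(Suc (Suc n))] \<cdot> (x [^] Suc n) = x \<otimes> [(Suc n)] \<cdot> (x [^] n) \<oplus> x [^] Suc n"
      using xy add_pow_rdistr[of x "x [^] n" "Suc n"] by (simp add: m_comm a_ac)
    have "?s \<ominus> [(Suc (Suc n))] \<cdot> (x [^] Suc n)
       = x \<otimes> (s \<ominus> [(Suc n)] \<cdot> (x [^] n)) \<oplus> (\<ominus> s) \<otimes> (x \<ominus> y)"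
      unfolding S using xy cl s by algebra
    moreover have "\<dots> \<in> I" using c d xy s
      by (intro I.a_closed I.I_l_closed) auto
    ultimately show ?thesis by simp
  qed
  ultimately show ?case using s xy by (intro bexI[of _ ?s]) auto
qed

text \<open>Zorn's lemma for the proper ideals above \<open>I\<close>; properness is tested by
  \<open>\<one>\<close> and so survives unions of chains.\<close>

lemma exists_maximalideal_above:
  assumes "ideal I R" "\<one> \<notin> I"
  shows "\<exists>m. maximalideal m R \<and> I \<subseteq> m"
proof -
  let ?S = "{J. ideal J R \<and> I \<subseteq> J \<and> \<one> \<notin> J}"
  have "\<exists>U\<in>?S. \<forall>X\<in>C. X \<subseteq> U" if C: "subset.chain ?S C" for C
  proof (cases "C = {}")
    case True
    then show ?thesis using assms by blast
  next
    case False
    have CS: "C \<subseteq> ?S" and ch: "\<And>X Y. X \<in> C \<Longrightarrow> Y \<in> C \<Longrightarrow> X \<subseteq> Y \<or> Y \<subseteq> X"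
      using C by (auto simp: subset_chain_def)
    have sub: "additive_subgroup X R" "X \<subseteq> carrier R" if "X \<in> C" for X
      using that CS by (auto simp: ideal_def additive_subgroup.a_subset dest!: subsetD)
        (meson additive_subgroup.a_Hcarr)
    have "ideal (\<Union>C) R"
    proof (rule idealI)
      show "ring R" by (rule ring_axioms)
      show "subgroup (\<Union>C) (add_monoid R)"
      proof
        show "\<Union>C \<subseteq> carrier (add_monoid R)" using sub by auto
        show "\<one>\<^bsub>add_monoid R\<^esub> \<in> \<Union>C" using False sub additive_subgroup.zero_closed by fastforce
        show "inv\<^bsub>add_monoid R\<^esub> x \<in> \<Union>C" if "x \<in> \<Union>C" for x
          using that sub additive_subgroup.a_inv_closed abelian_group_axioms
          unfolding a_inv_def[symmetric] by (metis Union_iff)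
        fix x y assume "x \<in> \<Union>C" "y \<in> \<Union>C"
        then obtain X Y where XY: "X \<in> C" "Y \<in> C" "x \<in> X" "y \<in> Y" by auto
        then obtain Z where "Z \<in> C" "x \<in> Z" "y \<in> Z" using ch[of X Y] by auto
        then show "x \<otimes>\<^bsub>add_monoid R\<^esub> y \<in> \<Union>C"
          using additive_subgroup.a_closed[OF sub(1)] by (auto intro!: bexI[of _ Z])
      qed
      show "x \<otimes> a \<in> \<Union>C" "a \<otimes> x \<in> \<Union>C" if "a \<in> \<Union>C" "x \<in> carrier R" for a x
        using that CS by (auto intro: ideal.I_l_closed ideal.I_r_closed)
    qed
    then show ?thesis using CS False by (intro bexI[of _ "\<Union>C"]) auto
  qed
  then have "\<exists>m\<in>?S. \<forall>X\<in>?S. m \<subseteq> X \<longrightarrow> X = m" by (rule subset_Zorn)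
  then obtain m where m: "m \<in> ?S" "\<And>X. X \<in> ?S \<Longrightarrow> m \<subseteq> X \<Longrightarrow> X = m" by (elim bexE) blast
  interpret m: ideal m R using m by simp
  have "maximalideal m R"
  proof (rule maximalidealI)
    show "ideal m R" by (rule m.is_ideal)
    show "carrier R \<noteq> m" using m by auto
    show "J = m \<or> J = carrier R" if "ideal J R" "m \<subseteq> J" "J \<subseteq> carrier R" for J
    proof (cases "\<one> \<in> J")
      case True
      then show ?thesis using ideal.one_imp_carrier[OF that(1)] by simp
    next
      case False
      then have "J \<in> ?S" using that m(1) by auto
      then show ?thesis using m(2) that(2) by simp
    qed
  qed
  then show ?thesis using m by auto
qed

end

section \<open>Frobenius maps of fields of prime characteristic\<close>

lemma (in field) frobenius_add:
  assumes p: "prime (p::nat)" "[p] \<cdot> \<one> = \<zero>" and [simp]: "x \<in> carrier R" "y \<in> carrier R"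
  shows "(x \<oplus> y) [^] (p ^ s) = x [^] (p ^ s) \<oplus> y [^] (p ^ s)"
proof (induction s)
  case 0
  then show ?case by simp
next
  case (Suc s)
  have "(x \<oplus> y) [^] (p ^ Suc s) = (x [^] (p ^ s) \<oplus> y [^] (p ^ s)) [^] p"
    using Suc by (simp add: mult.commute[of p] flip: nat_pow_pow)
  also obtain z where "z \<in> carrier R" "(x [^] (p ^ s) \<oplus> y [^] (p ^ s)) [^] p
      = (x [^] (p ^ s)) [^] p \<oplus> (y [^] (p ^ s)) [^] p \<oplus> [p] \<cdot> z"
    using freshmans_dream_modulo[OF p(1), of "x [^] (p ^ s)" "y [^] (p ^ s)"] by auto
  moreover from this have "[p] \<cdot> z = \<zero>" using add_pow_ldistr[of \<one> z p] p(2) by simp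
  ultimately show ?case by (simp add: nat_pow_pow mult.commute)
qed

lemma (in field) pow_eq_zero_iff:
  assumes [simp]: "x \<in> carrier R" and "x [^] (n::nat) = \<zero>" shows "x = \<zero>"
  using assms(2) by (induction n) (auto simp: integral_iff)

lemma (in field) frobenius_diff:
  assumes p: "prime (p::nat)" "[p] \<cdot> \<one> = \<zero>" and [simp]: "x \<in> carrier R" "y \<in> carrier R"
  shows "(x \<ominus> y) [^] (p ^ s) = x [^] (p ^ s) \<ominus> y [^] (p ^ s)"
proof -
  have "(x \<ominus> y) [^] (p ^ s) \<oplus> y [^] (p ^ s) = x [^] (p ^ s)"
    using frobenius_add[OF p, of "x \<ominus> y" y s] by (simp add: a_minus_def a_assoc l_neg)
  then have "x [^] (p ^ s) \<ominus> y [^] (p ^ s) = ((x \<ominus> y) [^] (p ^ s) \<oplus> y [^] (p ^ s)) \<ominus> y [^] (p ^ s)" by simp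
  also have "\<dots> = (x \<ominus> y) [^] (p ^ s)" by (simp add: a_minus_def a_assoc r_neg)
  finally show ?thesis by simp
qed

lemma (in field) frobenius_inj:
  assumes p: "prime (p::nat)" "[p] \<cdot> \<one> = \<zero>" and x[simp]: "x \<in> carrier R" "y \<in> carrier R"
    and e: "x [^] (p ^ s) = y [^] (p ^ s)"
  shows "x = y"
proof -
  have "(x \<ominus> y) [^] (p ^ s) = \<zero>" unfolding frobenius_diff[OF p x] e by (simp add: a_minus_def r_neg)
  then have "x \<ominus> y = \<zero>" using pow_eq_zero_iff[of "x \<ominus> y"] by simp
  then show ?thesis using x by (simp add: minus_eq_zero_iff)
qed

section \<open>Pairs of sets defined by the same formula\<close>

primrec tsub :: "(nat \<Rightarrow> rterm) \<Rightarrow> rterm \<Rightarrow> rterm" where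
  "tsub \<sigma> (TVar i) = \<sigma> i"
| "tsub \<sigma> TZero = TZero"
| "tsub \<sigma> TOne = TOne"
| "tsub \<sigma> (TAdd s t) = TAdd (tsub \<sigma> s) (tsub \<sigma> t)"
| "tsub \<sigma> (TMult s t) = TMult (tsub \<sigma> s) (tsub \<sigma> t)"
| "tsub \<sigma> (TNeg t) = TNeg (tsub \<sigma> t)"

primrec fsub :: "(nat \<Rightarrow> rterm) \<Rightarrow> rform \<Rightarrow> rform" where
  "fsub \<sigma> (FEq s t) = FEq (tsub \<sigma> s) (tsub \<sigma> t)"
| "fsub \<sigma> (FNot p) = FNot (fsub \<sigma> p)"
| "fsub \<sigma> (FAnd p q) = FAnd (fsub \<sigma> p) (fsub \<sigma> q)"
| "fsub \<sigma> (FEx p) = FEx (fsub (case_nat (TVar 0) (\<lambda>i. tsub (TVar \<circ> Suc) (\<sigma> i))) p)"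

lemma tval_tsub: "tval M v (tsub \<sigma> t) = tval M (\<lambda>i. tval M v (\<sigma> i)) t"
  by (induction t) auto

lemma sat_fsub: "sat M v (fsub \<sigma> p) = sat M (\<lambda>i. tval M v (\<sigma> i)) p"
proof (induction p arbitrary: v \<sigma>)
  case (FEx p)
  have "(\<lambda>i. tval M (case_nat a v) (case_nat (TVar 0) (\<lambda>i. tsub (TVar \<circ> Suc) (\<sigma> i)) i))
      = case_nat a (\<lambda>i. tval M v (\<sigma> i))" for a
    by (auto simp: fun_eq_iff tval_tsub split: nat.split)
  then show ?case using FEx by simp
qed (auto simp: tval_tsub)

primrec tbound :: "rterm \<Rightarrow> nat" where
  "tbound (TVar i) = Suc i"
| "tbound TZero = 0"
| "tbound TOne = 0"
| "tbound (TAdd s t) = max (tbound s) (tbound t)"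
| "tbound (TMult s t) = max (tbound s) (tbound t)"
| "tbound (TNeg t) = tbound t"

text \<open>The bound is not lowered under \<open>FEx\<close>, so it may exceed the number of free
  variables; an upper bound is enough for \<open>sat_bound\<close>.\<close>

primrec fbound :: "rform \<Rightarrow> nat" where
  "fbound (FEq s t) = max (tbound s) (tbound t)"
| "fbound (FNot p) = fbound p"
| "fbound (FAnd p q) = max (fbound p) (fbound q)"
| "fbound (FEx p) = fbound p"

lemma tval_bound: "(\<And>i. i < tbound t \<Longrightarrow> v i = w i) \<Longrightarrow> tval M v t = tval M w t"
  by (induction t) auto

lemma sat_bound: "(\<And>i. i < fbound p \<Longrightarrow> v i = w i) \<Longrightarrow> sat M v p = sat M w p"
proof (induction p arbitrary: v w)
  case (FEq s t)
  then show ?case using tval_bound[of s v w M] tval_bound[of t v w M] by simp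
next
  case (FEx p)
  have "sat M (case_nat a v) p = sat M (case_nat a w) p" for a
    by (rule FEx.IH) (use FEx.prems in \<open>auto split: nat.split\<close>)
  then show ?case by simp
next
  case (FAnd p q)
  then show ?case by (metis fbound.simps(3) less_max_iff_disj sat.simps(3))
next
  case (FNot p)
  show ?case using FNot.IH[of v w] FNot.prems by simp
qed

text \<open>Variables and parameters each get infinitely many positions. A predicate can then be
  combined with others without fixing in advance how many variables come before its
  parameters.\<close>

definition merge :: "(nat \<Rightarrow> 'a) \<Rightarrow> (nat \<Rightarrow> 'a) \<Rightarrow> nat \<Rightarrow> 'a" where
  "merge v w i = (if even i then v (i div 2) else w (i div 2))"

lemma merge_even [simp]: "merge v w (2 * i) = v i"
  by (simp add: merge_def)

text \<open>Renamings that read a formula with parameter tuple \<open>ps\<close>, respectively \<open>qs\<close>, as one with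
  parameter tuple \<open>ps @ qs\<close>, where \<open>m\<close> and \<open>k\<close> are the lengths of \<open>ps\<close> and \<open>qs\<close>.\<close>

definition low_params :: "nat \<Rightarrow> nat \<Rightarrow> nat \<Rightarrow> rterm" where
  "low_params m k i = TVar (if even i \<or> i div 2 < m then i else i + 2 * k)"

definition high_params :: "nat \<Rightarrow> nat \<Rightarrow> rterm" where
  "high_params m i = TVar (if even i then i else i + 2 * m)"

lemma merge_params:
  shows merge_low: "m = length ps \<Longrightarrow> k = length qs \<Longrightarrow>
      (\<lambda>i. tval N (merge v (asg N (ps @ qs))) (low_params m k i)) = merge v (asg N ps)"
    and merge_high: "m = length ps \<Longrightarrow>
      (\<lambda>i. tval N (merge v (asg N (ps @ qs))) (high_params m i)) = merge v (asg N qs)"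
  by (auto simp: fun_eq_iff merge_def asg_def nth_append low_params_def high_params_def)

lemma merge_subst:
  "(\<lambda>j. tval N (merge v w) (if j = 2 * i then t else TVar j)) = merge (v(i := tval N (merge v w) t)) w"
  by (auto simp: fun_eq_iff merge_def)

text \<open>Binds the named variable \<open>i\<close> by a de Bruijn quantifier: its position is
  sent to 0, every other position moves up by one, and the old value of \<open>i\<close> is no
  longer read.\<close>

lemma merge_bind:
  "(\<lambda>j. tval N (case_nat a (merge v w)) (TVar (if j = 2 * i then 0 else Suc j))) = merge (v(i := a)) w"
  by (auto simp: fun_eq_iff merge_def)

lemma range_fun_upd_subset: "range v \<subseteq> S \<Longrightarrow> a \<in> S \<Longrightarrow> range (v(i := a)) \<subseteq> S"
  by auto

lemma (in cring) tval_closed: "range v \<subseteq> carrier R \<Longrightarrow> tval R v t \<in> carrier R"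
  by (induction t) auto

lemma (in cring) merge_closed:
  "range v \<subseteq> carrier R \<Longrightarrow> set ps \<subseteq> carrier R \<Longrightarrow> range (merge v (asg R ps)) \<subseteq> carrier R"
  by (auto simp: merge_def asg_def subset_iff)

section \<open>Predicates defined by one formula in both structures\<close>

locale elementary_extension = R: cring R + M: cring M
  for R :: "('a, 'm) ring_scheme" (structure) and M :: "('b, 'k) ring_scheme" (structure) +
  fixes f :: "'a \<Rightarrow> 'b"
  assumes elem: "elementary_embedding R M f"
begin

lemma f_closed [simp, intro]: "x \<in> carrier R \<Longrightarrow> f x \<in> carrier M"
  using elem by (auto simp: elementary_embedding_def)

lemma f_sat: "range v \<subseteq> carrier R \<Longrightarrow> sat M (f \<circ> v) \<phi> = sat R v \<phi>"
  using elem by (auto simp: elementary_embedding_def)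

lemma f_eq_iff: "x \<in> carrier R \<Longrightarrow> y \<in> carrier R \<Longrightarrow> f x = f y \<longleftrightarrow> x = y"
  using f_sat[of "\<lambda>i. if i = 0 then x else y" "FEq (TVar 0) (TVar 1)"] by (auto split: if_splits)

lemma f_inj: "inj_on f (carrier R)"
  by (auto simp: inj_on_def f_eq_iff)

lemma f_zero [simp]: "f \<zero>\<^bsub>R\<^esub> = \<zero>\<^bsub>M\<^esub>"
  using f_sat[of "\<lambda>i. \<zero>\<^bsub>R\<^esub>" "FEq (TVar 0) TZero"] by (auto split: if_splits)

lemma f_asg: "set ps \<subseteq> carrier R \<Longrightarrow> f (asg R ps i) = asg M (map f ps) i"
  by (auto simp: asg_def)

lemma asg_range: "set ps \<subseteq> carrier R \<Longrightarrow> asg R ps i \<in> carrier R"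
  by (auto simp: asg_def subset_iff)

lemma asg_range': "set ps \<subseteq> carrier M \<Longrightarrow> asg M ps i \<in> carrier M"
  by (auto simp: asg_def subset_iff)

text \<open>Variables are named by numbers, so that no index shift is needed under quantifiers; in the underlying
  formula they have the even indices and the parameters the odd ones.\<close>

definition codef :: "'a set \<Rightarrow> ((nat \<Rightarrow> 'a) \<Rightarrow> bool) \<Rightarrow> ((nat \<Rightarrow> 'b) \<Rightarrow> bool) \<Rightarrow> bool" where
  "codef A P Q \<longleftrightarrow> (\<exists>\<phi> ps. set ps \<subseteq> A \<and>
     (\<forall>v. range v \<subseteq> carrier R \<longrightarrow> P v = sat R (merge v (asg R ps)) \<phi>) \<and>
     (\<forall>v. range v \<subseteq> carrier M \<longrightarrow> Q v = sat M (merge v (asg M (map f ps))) \<phi>))"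

definition coterm :: "'a set \<Rightarrow> ((nat \<Rightarrow> 'a) \<Rightarrow> 'a) \<Rightarrow> ((nat \<Rightarrow> 'b) \<Rightarrow> 'b) \<Rightarrow> bool" where
  "coterm A s t \<longleftrightarrow> (\<exists>u ps. set ps \<subseteq> A \<and>
     (\<forall>v. range v \<subseteq> carrier R \<longrightarrow> s v = tval R (merge v (asg R ps)) u) \<and>
     (\<forall>v. range v \<subseteq> carrier M \<longrightarrow> t v = tval M (merge v (asg M (map f ps))) u))"

definition codef_set :: "'a set \<Rightarrow> 'a set \<Rightarrow> 'b set \<Rightarrow> bool" where
  "codef_set A S T \<longleftrightarrow> S \<subseteq> carrier R \<and> T \<subseteq> carrier M \<and> codef A (\<lambda>v. v 0 \<in> S) (\<lambda>v. v 0 \<in> T)"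

lemma codef_cong:
  assumes "codef A P Q" "\<And>v. range v \<subseteq> carrier R \<Longrightarrow> P' v = P v" "\<And>v. range v \<subseteq> carrier M \<Longrightarrow> Q' v = Q v"
  shows "codef A P' Q'"
  using assms unfolding codef_def by auto

text \<open>Over the concatenated parameter tuple the two formulas can be joined by a
  connective.\<close>

lemma codef_common:
  assumes "codef A P Q" "codef A P' Q'"
  shows "\<exists>\<phi> \<psi> ps. set ps \<subseteq> A \<and>
     (\<forall>v. range v \<subseteq> carrier R \<longrightarrow> P v = sat R (merge v (asg R ps)) \<phi> \<and> P' v = sat R (merge v (asg R ps)) \<psi>) \<and>
     (\<forall>v. range v \<subseteq> carrier M \<longrightarrow> Q v = sat M (merge v (asg M (map f ps))) \<phi> \<and> Q' v = sat M (merge v (asg M (map f ps))) \<psi>)"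
proof -
  obtain \<phi> ps where 1: "set ps \<subseteq> A" "\<forall>v. range v \<subseteq> carrier R \<longrightarrow> P v = sat R (merge v (asg R ps)) \<phi>"
     "\<forall>v. range v \<subseteq> carrier M \<longrightarrow> Q v = sat M (merge v (asg M (map f ps))) \<phi>"
    using assms(1) unfolding codef_def by auto
  obtain \<psi> qs where 2: "set qs \<subseteq> A" "\<forall>v. range v \<subseteq> carrier R \<longrightarrow> P' v = sat R (merge v (asg R qs)) \<psi>"
     "\<forall>v. range v \<subseteq> carrier M \<longrightarrow> Q' v = sat M (merge v (asg M (map f qs))) \<psi>"
    using assms(2) unfolding codef_def by auto
  let ?\<phi> = "fsub (low_params (length ps) (length qs)) \<phi>"
  let ?\<psi> = "fsub (high_params (length ps)) \<psi>"
  show ?thesis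
    by (rule exI[of _ ?\<phi>], rule exI[of _ ?\<psi>], rule exI[of _ "ps @ qs"])
      (use 1 2 in \<open>simp add: sat_fsub merge_params\<close>)
qed

lemma coterm_common:
  assumes "coterm A P Q" "coterm A P' Q'"
  shows "\<exists>\<phi> \<psi> ps. set ps \<subseteq> A \<and>
     (\<forall>v. range v \<subseteq> carrier R \<longrightarrow> P v = tval R (merge v (asg R ps)) \<phi> \<and> P' v = tval R (merge v (asg R ps)) \<psi>) \<and>
     (\<forall>v. range v \<subseteq> carrier M \<longrightarrow> Q v = tval M (merge v (asg M (map f ps))) \<phi> \<and> Q' v = tval M (merge v (asg M (map f ps))) \<psi>)"
proof -
  obtain \<phi> ps where 1: "set ps \<subseteq> A" "\<forall>v. range v \<subseteq> carrier R \<longrightarrow> P v = tval R (merge v (asg R ps)) \<phi>"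
     "\<forall>v. range v \<subseteq> carrier M \<longrightarrow> Q v = tval M (merge v (asg M (map f ps))) \<phi>"
    using assms(1) unfolding coterm_def by auto
  obtain \<psi> qs where 2: "set qs \<subseteq> A" "\<forall>v. range v \<subseteq> carrier R \<longrightarrow> P' v = tval R (merge v (asg R qs)) \<psi>"
     "\<forall>v. range v \<subseteq> carrier M \<longrightarrow> Q' v = tval M (merge v (asg M (map f qs))) \<psi>"
    using assms(2) unfolding coterm_def by auto
  let ?\<phi> = "tsub (low_params (length ps) (length qs)) \<phi>"
  let ?\<psi> = "tsub (high_params (length ps)) \<psi>"
  show ?thesis
    by (rule exI[of _ ?\<phi>], rule exI[of _ ?\<psi>], rule exI[of _ "ps @ qs"])
      (use 1 2 in \<open>simp add: tval_tsub merge_params\<close>)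
qed

lemma coterm_var: "coterm A (\<lambda>v. v i) (\<lambda>v. v i)"
  unfolding coterm_def by (intro exI[of _ "TVar (2 * i)"] exI[of _ "[]"]) simp

lemma coterm_const: "a \<in> A \<Longrightarrow> coterm A (\<lambda>v. a) (\<lambda>v. f a)"
  unfolding coterm_def by (intro exI[of _ "TVar 1"] exI[of _ "[a]"]) (simp add: merge_def asg_def)

lemma coterm_zero: "coterm A (\<lambda>v. \<zero>\<^bsub>R\<^esub>) (\<lambda>v. \<zero>\<^bsub>M\<^esub>)"
  unfolding coterm_def by (intro exI[of _ "TZero"] exI[of _ "[]"]) simp

lemma coterm_one: "coterm A (\<lambda>v. \<one>\<^bsub>R\<^esub>) (\<lambda>v. \<one>\<^bsub>M\<^esub>)"
  unfolding coterm_def by (intro exI[of _ "TOne"] exI[of _ "[]"]) simp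

lemma coterm_neg: "coterm A s t \<Longrightarrow> coterm A (\<lambda>v. \<ominus>\<^bsub>R\<^esub> s v) (\<lambda>v. \<ominus>\<^bsub>M\<^esub> t v)"
  unfolding coterm_def by (elim exE, rule exI[of _ "TNeg _"], rule exI, auto)

lemma coterm_add:
  "coterm A s t \<Longrightarrow> coterm A s' t' \<Longrightarrow> coterm A (\<lambda>v. s v \<oplus>\<^bsub>R\<^esub> s' v) (\<lambda>v. t v \<oplus>\<^bsub>M\<^esub> t' v)"
  by (drule (1) coterm_common) (unfold coterm_def, metis tval.simps(4))

lemma coterm_mult:
  "coterm A s t \<Longrightarrow> coterm A s' t' \<Longrightarrow> coterm A (\<lambda>v. s v \<otimes>\<^bsub>R\<^esub> s' v) (\<lambda>v. t v \<otimes>\<^bsub>M\<^esub> t' v)"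
  by (drule (1) coterm_common) (unfold coterm_def, metis tval.simps(5))

lemma coterm_minus:
  "coterm A s t \<Longrightarrow> coterm A s' t' \<Longrightarrow> coterm A (\<lambda>v. s v \<ominus>\<^bsub>R\<^esub> s' v) (\<lambda>v. t v \<ominus>\<^bsub>M\<^esub> t' v)"
  unfolding a_minus_def by (intro coterm_add coterm_neg)

lemma coterm_pow:
  "coterm A s t \<Longrightarrow> coterm A (\<lambda>v. s v [^]\<^bsub>R\<^esub> (n::nat)) (\<lambda>v. t v [^]\<^bsub>M\<^esub> n)"
  by (induction n) (simp_all add: coterm_one coterm_mult)

lemmas coterm_intros = coterm_var coterm_const coterm_zero coterm_one coterm_neg coterm_add coterm_mult
  coterm_minus coterm_pow

lemma codef_eq: "coterm A s t \<Longrightarrow> coterm A s' t' \<Longrightarrow> codef A (\<lambda>v. s v = s' v) (\<lambda>v. t v = t' v)"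
  by (drule (1) coterm_common) (unfold codef_def, metis sat.simps(1))

lemma codef_and: "codef A P Q \<Longrightarrow> codef A P' Q' \<Longrightarrow> codef A (\<lambda>v. P v \<and> P' v) (\<lambda>v. Q v \<and> Q' v)"
  by (drule (1) codef_common) (unfold codef_def, metis sat.simps(3))

lemma codef_not: "codef A P Q \<Longrightarrow> codef A (\<lambda>v. \<not> P v) (\<lambda>v. \<not> Q v)"
  unfolding codef_def by (elim exE, rule exI[of _ "FNot _"], rule exI, auto)

lemma codef_imp: "codef A P Q \<Longrightarrow> codef A P' Q' \<Longrightarrow> codef A (\<lambda>v. P v \<longrightarrow> P' v) (\<lambda>v. Q v \<longrightarrow> Q' v)"
  using codef_not[OF codef_and[OF _ codef_not], of A P Q P' Q'] by simp

lemma codef_True: "codef A (\<lambda>v. True) (\<lambda>v. True)"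
  using codef_eq[OF coterm_zero coterm_zero] by simp

lemma codef_ex:
  assumes "codef A P Q"
  shows "codef A (\<lambda>v. \<exists>a\<in>carrier R. P (v(i := a))) (\<lambda>v. \<exists>a\<in>carrier M. Q (v(i := a)))"
proof -
  obtain \<phi> ps where 1: "set ps \<subseteq> A" "\<forall>v. range v \<subseteq> carrier R \<longrightarrow> P v = sat R (merge v (asg R ps)) \<phi>"
     "\<forall>v. range v \<subseteq> carrier M \<longrightarrow> Q v = sat M (merge v (asg M (map f ps))) \<phi>"
    using assms(1) unfolding codef_def by auto
  let ?s = "\<lambda>j. TVar (if j = 2 * i then 0 else Suc j)"
  have PQ: "range v \<subseteq> carrier R \<Longrightarrow> a \<in> carrier R \<Longrightarrow> P (v(i := a)) = sat R (merge (v(i := a)) (asg R ps)) \<phi>"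
    "range w \<subseteq> carrier M \<Longrightarrow> b \<in> carrier M \<Longrightarrow> Q (w(i := b)) = sat M (merge (w(i := b)) (asg M (map f ps))) \<phi>" for v a w b
    using 1(2,3)[rule_format, OF range_fun_upd_subset] by blast+
  show ?thesis
    unfolding codef_def
    by (rule exI[of _ "FEx (fsub ?s \<phi>)"], rule exI[of _ ps]) (use 1(1) PQ in \<open>simp add: sat_fsub merge_bind del: tval.simps\<close>)
qed

lemma codef_subst:
  assumes "codef A P Q" "coterm A s t" "A \<subseteq> carrier R"
  shows "codef A (\<lambda>v. P (v(i := s v))) (\<lambda>v. Q (v(i := t v)))"
proof -
  obtain \<phi> ps where 1: "set ps \<subseteq> A" "\<forall>v. range v \<subseteq> carrier R \<longrightarrow> P v = sat R (merge v (asg R ps)) \<phi>"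
     "\<forall>v. range v \<subseteq> carrier M \<longrightarrow> Q v = sat M (merge v (asg M (map f ps))) \<phi>"
    using assms(1) unfolding codef_def by auto
  obtain u qs where 2: "set qs \<subseteq> A" "\<forall>v. range v \<subseteq> carrier R \<longrightarrow> s v = tval R (merge v (asg R qs)) u"
     "\<forall>v. range v \<subseteq> carrier M \<longrightarrow> t v = tval M (merge v (asg M (map f qs))) u"
    using assms(2) unfolding coterm_def by auto
  \<comment> \<open>The value of the term must lie in the carrier, since \<open>P\<close> and
    \<open>Q\<close> are described by formulas only on assignments with values there.\<close>
  have cl: "range v \<subseteq> carrier R \<Longrightarrow> s v \<in> carrier R" "range w \<subseteq> carrier M \<Longrightarrow> t w \<in> carrier M" for v w
    using 2 assms(3) R.tval_closed[OF R.merge_closed, of v qs] M.tval_closed[OF M.merge_closed, of w "map f qs"]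
    by (simp_all add: image_subset_iff subset_iff) fastforce
  have PQ: "range v \<subseteq> carrier R \<Longrightarrow> P (v(i := s v)) = sat R (merge (v(i := s v)) (asg R ps)) \<phi>"
    "range w \<subseteq> carrier M \<Longrightarrow> Q (w(i := t w)) = sat M (merge (w(i := t w)) (asg M (map f ps))) \<phi>" for v w
    by (intro 1(2)[rule_format] 1(3)[rule_format] range_fun_upd_subset cl; assumption)+
  let ?u = "\<lambda>j. if j = 2 * i then tsub (high_params (length ps)) u else TVar j"
  let ?\<phi> = "fsub ?u (fsub (low_params (length ps) (length qs)) \<phi>)"
  show ?thesis
    unfolding codef_def
    by (rule exI[of _ ?\<phi>], rule exI[of _ "ps @ qs"])
      (use 1(1) 2 PQ in \<open>simp add: sat_fsub tval_tsub merge_subst merge_params\<close>)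
qed

lemma codef_mem:
  assumes "codef_set A S T" "coterm A s t" "A \<subseteq> carrier R"
  shows "codef A (\<lambda>v. s v \<in> S) (\<lambda>v. t v \<in> T)"
  using codef_subst[of A "\<lambda>v. v 0 \<in> S" "\<lambda>v. v 0 \<in> T" s t 0] assms by (simp add: codef_set_def)

lemma codef_all:
  assumes "codef A P Q"
  shows "codef A (\<lambda>v. \<forall>a\<in>carrier R. P (v(i := a))) (\<lambda>v. \<forall>a\<in>carrier M. Q (v(i := a)))"
  using codef_not[OF codef_ex[OF codef_not[OF assms], of i]] by simp

lemma codef_transfer:
  assumes "codef A P Q" "A \<subseteq> carrier R" "range v \<subseteq> carrier R"
  shows "Q (f \<circ> v) \<longleftrightarrow> P v"
proof -
  obtain \<phi> ps where 1: "set ps \<subseteq> A" "\<forall>v. range v \<subseteq> carrier R \<longrightarrow> P v = sat R (merge v (asg R ps)) \<phi>"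
     "\<forall>v. range v \<subseteq> carrier M \<longrightarrow> Q v = sat M (merge v (asg M (map f ps))) \<phi>"
    using assms(1) unfolding codef_def by auto
  have ps: "set ps \<subseteq> carrier R" using 1(1) assms(2) by auto
  have "merge (f \<circ> v) (asg M (map f ps)) = f \<circ> merge v (asg R ps)"
    using f_asg[OF ps] by (auto simp: fun_eq_iff merge_def)
  moreover have "range (f \<circ> v) \<subseteq> carrier M" using assms(3) by auto
  ultimately show ?thesis using 1 assms(3) f_sat[OF R.merge_closed[OF assms(3) ps]] by simp
qed

lemma codef_bounded:
  assumes "codef A P Q"
  shows "\<exists>n. \<forall>v w. range v \<subseteq> carrier M \<longrightarrow> range w \<subseteq> carrier M \<longrightarrow> (\<forall>i<n. v i = w i) \<longrightarrow> Q v = Q w"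
proof -
  obtain \<phi> ps where 1: "\<forall>v. range v \<subseteq> carrier M \<longrightarrow> Q v = sat M (merge v (asg M (map f ps))) \<phi>"
    using assms(1) unfolding codef_def by auto
  have "sat M (merge v (asg M (map f ps))) \<phi> = sat M (merge w (asg M (map f ps))) \<phi>"
    if "\<forall>i<fbound \<phi>. v i = w i" for v w
    by (rule sat_bound) (use that in \<open>auto simp: merge_def\<close>)
  then show ?thesis using 1 by (intro exI[of _ "fbound \<phi>"]) auto
qed

text \<open>Elementarity speaks directly only of values in the image of \<open>f\<close>. Since
  \<open>Q\<close> depends on finitely many variables, these can be quantified universally one after
  the other, and the resulting statement has no variable left that matters; it is transferred at the
  constant assignment \<open>\<zero>\<close>.\<close>

lemma codef_transfer_all:
  assumes "codef A P Q" "A \<subseteq> carrier R"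
    and P: "\<And>v. range v \<subseteq> carrier R \<Longrightarrow> P v" and v: "range v \<subseteq> carrier M"
  shows "Q v"
proof -
  obtain n where n: "\<forall>v w. range v \<subseteq> carrier M \<longrightarrow> range w \<subseteq> carrier M \<longrightarrow> (\<forall>i<n. v i = w i) \<longrightarrow> Q v = Q w"
    using codef_bounded[OF assms(1)] by auto
  let ?z = "\<lambda>i::nat. \<zero>\<^bsub>R\<^esub>"
  \<comment> \<open>Stage \<open>k\<close> has quantified the variables below \<open>k\<close>: in
    \<open>M\<close> its truth allows the values of \<open>v\<close> to be inserted there.\<close>
  have "\<exists>P' Q'. codef A P' Q' \<and> (\<forall>v. range v \<subseteq> carrier R \<longrightarrow> P' v) \<and>
      (\<forall>u. range u \<subseteq> carrier M \<longrightarrow> Q' u \<longrightarrow> Q (\<lambda>i. if i < k then v i else u i))" for k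
  proof (induction k)
    case 0
    then show ?case using assms(1) P by auto
  next
    case (Suc k)
    then obtain P' Q' where IH: "codef A P' Q'" "\<forall>v. range v \<subseteq> carrier R \<longrightarrow> P' v"
      "\<forall>u. range u \<subseteq> carrier M \<longrightarrow> Q' u \<longrightarrow> Q (\<lambda>i. if i < k then v i else u i)" by auto
    have "Q (\<lambda>i. if i < Suc k then v i else u i)"
      if "range u \<subseteq> carrier M" "\<forall>a\<in>carrier M. Q' (u(k := a))" for u
    proof -
      have "v k \<in> carrier M" using v by auto
      then have "Q' (u(k := v k))" "range (u(k := v k)) \<subseteq> carrier M"
        using that by (blast, intro range_fun_upd_subset)
      then have "Q (\<lambda>i. if i < k then v i else (u(k := v k)) i)" using IH(3) by blast
      also have "(\<lambda>i. if i < k then v i else (u(k := v k)) i) = (\<lambda>i. if i < Suc k then v i else u i)"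
        by (auto simp: fun_eq_iff less_Suc_eq)
      finally show ?thesis .
    qed
    moreover have "P' (w(k := a))" if "range w \<subseteq> carrier R" "a \<in> carrier R" for w a
      using IH(2)[rule_format, OF range_fun_upd_subset] that by blast
    ultimately show ?case
      using codef_all[OF IH(1), of k]
      by (intro exI[of _ "\<lambda>v. \<forall>a\<in>carrier R. P' (v(k := a))"] exI[of _ "\<lambda>v. \<forall>a\<in>carrier M. Q' (v(k := a))"]) auto
  qed
  then obtain P' Q' where "codef A P' Q'" "\<forall>v. range v \<subseteq> carrier R \<longrightarrow> P' v" and
      Q: "\<forall>u. range u \<subseteq> carrier M \<longrightarrow> Q' u \<longrightarrow> Q (\<lambda>i. if i < n then v i else u i)" by blast
  then have "Q' (f \<circ> ?z)" using codef_transfer[of A P' Q' ?z] assms(2) by auto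
  moreover have "range (f \<circ> ?z) \<subseteq> carrier M" by auto
  ultimately have "Q (\<lambda>i. if i < n then v i else (f \<circ> ?z) i)" using Q by blast
  moreover have "range (\<lambda>i. if i < n then v i else (f \<circ> ?z) i) \<subseteq> carrier M" using v by auto
  ultimately show ?thesis
    using n[rule_format, OF v, of "\<lambda>i. if i < n then v i else (f \<circ> ?z) i"] by simp
qed

lemma codef_def_set:
  assumes "codef A P Q" "A \<subseteq> carrier R"
  shows "\<exists>\<phi> ps. set ps \<subseteq> A \<and> def_set R n \<phi> ps = {xs\<in>tuples R n. P (asg R xs)} \<and>
           def_set M n \<phi> (map f ps) = {xs\<in>tuples M n. Q (asg M xs)}"
proof -
  obtain \<phi> ps where 1: "set ps \<subseteq> A" "\<forall>v. range v \<subseteq> carrier R \<longrightarrow> P v = sat R (merge v (asg R ps)) \<phi>"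
     "\<forall>v. range v \<subseteq> carrier M \<longrightarrow> Q v = sat M (merge v (asg M (map f ps))) \<phi>"
    using assms(1) unfolding codef_def by auto
  \<comment> \<open>Variables from \<open>n\<close> on are sent beyond the end of the list, where
    \<open>asg\<close> returns \<open>\<zero>\<close>, just as \<open>asg\<close> does for the tuple
    alone.\<close>
  let ?s = "\<lambda>i. TVar (if even i then if i div 2 < n then i div 2 else n + length ps + i else n + i div 2)"
  have m: "(\<lambda>i. tval N (asg N (xs @ qs)) (?s i)) = merge (asg N xs) (asg N qs)"
    if "xs \<in> tuples N n" "length qs = length ps" for xs qs and N :: "('c, 'd) ring_scheme"
    using that by (auto simp: fun_eq_iff merge_def tuples_def asg_def nth_append)
  have r: "range (asg R xs) \<subseteq> carrier R" if "xs \<in> tuples R n" for xs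
    using that asg_range by (auto simp: tuples_def)
  have r': "range (asg M xs) \<subseteq> carrier M" if "xs \<in> tuples M n" for xs
    using that asg_range' by (auto simp: tuples_def)
  show ?thesis
    by (rule exI[of _ "fsub ?s \<phi>"], rule exI[of _ ps])
      (use 1 in \<open>auto simp: def_set_def sat_fsub m r r' simp del: tval.simps\<close>)
qed

lemma codef_definable:
  assumes "codef A P Q" "A \<subseteq> carrier R"
  shows "definable M (f ` A) n {xs\<in>tuples M n. Q (asg M xs)}"
proof -
  obtain \<phi> ps where "set ps \<subseteq> A" "def_set M n \<phi> (map f ps) = {xs\<in>tuples M n. Q (asg M xs)}"
    using codef_def_set[OF assms] by blast
  then show ?thesis unfolding definable_def by (intro exI[of _ \<phi>] exI[of _ "map f ps"]) auto
qed

lemma codef_def_set_params: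
  fixes n :: nat
  assumes "set ps \<subseteq> A"
  shows "codef A (\<lambda>v. sat R (asg R (map v [0..<n] @ ps)) \<phi>) (\<lambda>v. sat M (asg M (map v [0..<n] @ map f ps)) \<phi>)"
proof -
  \<comment> \<open>Positions past the parameters must be read as \<open>\<zero>\<close>, as in
    \<open>asg\<close>, and not as further variables.\<close>
  let ?s = "\<lambda>i. if i < n then TVar (2 * i) else if i < n + length ps then TVar (2 * (i - n) + 1) else TZero"
  have "(\<lambda>i. tval N (merge v (asg N qs)) (?s i)) = asg N (map v [0..<n] @ qs)"
    if "length qs = length ps" for v :: "nat \<Rightarrow> 'c" and qs and N :: "('c, 'd) ring_scheme"
    using that by (auto simp: fun_eq_iff merge_def asg_def nth_append)
  note c = this
  note c[of ps R] c[of "map f ps" M]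
  then show ?thesis unfolding codef_def
    by (intro exI[of _ "fsub ?s \<phi>"] exI[of _ ps]) (use assms in \<open>simp add: sat_fsub del: tval.simps\<close>)
qed

lemma asg_tuple: "xs \<in> tuples N n \<Longrightarrow> map (asg N xs :: nat \<Rightarrow> 'c) [0..<n] = xs"
  by (auto simp: tuples_def asg_def list_eq_iff_nth_eq)

lemma map_in_tuples: "range (v :: nat \<Rightarrow> 'c) \<subseteq> carrier N \<Longrightarrow> map v [0..<n] \<in> tuples N n"
  by (auto simp: tuples_def)

text \<open>Formulas that define the same set in \<open>R\<close> define the same set in
  \<open>M\<close>, by transfer of the implications between them; so the union in
  \<open>extend_set\<close> collapses to one set.\<close>

lemma extend_set_codef:
  assumes "codef A P Q" "A \<subseteq> carrier R"
  shows "extend_set R M f n {xs\<in>tuples R n. P (asg R xs)} = {xs\<in>tuples M n. Q (asg M xs)}"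
proof -
  obtain \<phi> ps where 1: "set ps \<subseteq> A" "def_set R n \<phi> ps = {xs\<in>tuples R n. P (asg R xs)}"
     "def_set M n \<phi> (map f ps) = {xs\<in>tuples M n. Q (asg M xs)}"
    using codef_def_set[OF assms] by blast
  have ps: "set ps \<subseteq> carrier R" using 1 assms(2) by auto
  \<comment> \<open>One inclusion is enough, as the formula on the right is itself one of those in
    the union.\<close>
  have eq: "def_set M n \<psi> (map f qs) \<subseteq> def_set M n \<phi> (map f ps)"
    if q: "set qs \<subseteq> carrier R" "def_set R n \<phi> ps = def_set R n \<psi> qs" for \<psi> qs
  proof
    fix xs assume xs: "xs \<in> def_set M n \<psi> (map f qs)"
    have r: "range (asg M xs) \<subseteq> carrier M"
      using xs asg_range' by (auto simp: tuples_def def_set_def)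
    have "sat M (asg M (map (asg M xs) [0..<n] @ map f qs)) \<psi> \<longrightarrow> sat M (asg M (map (asg M xs) [0..<n] @ map f ps)) \<phi>"
    proof (rule codef_transfer_all[OF codef_imp[OF codef_def_set_params[OF q(1)] codef_def_set_params[OF ps]] _ _ r])
      fix v :: "nat \<Rightarrow> 'a" assume v: "range v \<subseteq> carrier R"
      show "sat R (asg R (map v [0..<n] @ qs)) \<psi> \<longrightarrow> sat R (asg R (map v [0..<n] @ ps)) \<phi>"
        using q(2) map_in_tuples[OF v, of n] unfolding def_set_def by blast
    qed simp
    then show "xs \<in> def_set M n \<phi> (map f ps)"
      using xs asg_tuple[of xs M n] by (simp add: def_set_def)
  qed
  then show ?thesis unfolding extend_set_def 1(2)[symmetric] 1(3)[symmetric] using ps by blast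
qed

end

section \<open>Morley rank\<close>

definition definable_subset :: "('a, 'm) ring_scheme \<Rightarrow> 'a set \<Rightarrow> bool" where
  "definable_subset M S \<longleftrightarrow> S \<subseteq> carrier M \<and> definable M (carrier M) 1 ((\<lambda>x. [x]) ` S)"

definition morley_ge_subset :: "('a, 'm) ring_scheme \<Rightarrow> nat \<Rightarrow> 'a set \<Rightarrow> bool" where
  "morley_ge_subset M k S \<longleftrightarrow> morley_ge M 1 k ((\<lambda>x. [x]) ` S)"

lemma tuples_1: "tuples M 1 = (\<lambda>x. [x]) ` carrier M"
  by (auto simp: tuples_def length_Suc_conv)

lemma definable_mono: "definable M A n X \<Longrightarrow> A \<subseteq> B \<Longrightarrow> definable M B n X"
  unfolding definable_def by blast

lemma morley_ge_subset_0 [simp]: "morley_ge_subset M 0 S \<longleftrightarrow> S \<noteq> {}"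
  by (simp add: morley_ge_subset_def)

lemma morley_ge_subset_Suc:
  "morley_ge_subset M (Suc k) S \<longleftrightarrow>
     (\<exists>Y :: nat \<Rightarrow> 'a set. (\<forall>i. definable_subset M (Y i) \<and> Y i \<subseteq> S \<and> morley_ge_subset M k (Y i)) \<and>
        (\<forall>i j. i \<noteq> j \<longrightarrow> Y i \<inter> Y j = {}))" (is "?L \<longleftrightarrow> ?R")
  for M :: "('a, 'm) ring_scheme"
proof
  let ?s = "\<lambda>x::'a. [x]"
  assume ?L
  then obtain Y :: "nat \<Rightarrow> _" where Y: "(\<forall>i. definable M (carrier M) 1 (Y i) \<and> Y i \<subseteq> ?s ` S \<and> morley_ge M 1 k (Y i)) \<and>
    (\<forall>i j. i \<noteq> j \<longrightarrow> Y i \<inter> Y j = {})"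
    unfolding morley_ge_subset_def morley_ge.simps by blast
  note Y = Y[THEN conjunct1, rule_format] Y[THEN conjunct2, rule_format]
  have e: "?s ` {x. [x] \<in> Y i} = Y i" for i using Y(1)[of i] by auto
  have "{x. [x] \<in> Y i} \<subseteq> carrier M" for i
    using Y(1)[of i] unfolding definable_def def_set_def tuples_def by auto
  then have sub: "\<And>i. {x. [x] \<in> Y i} \<subseteq> carrier M" .
  show ?R
  proof (intro exI[of _ "\<lambda>i. {x. [x] \<in> Y i}"] conjI allI impI)
    show "definable_subset M {x. [x] \<in> Y i}" "morley_ge_subset M k {x. [x] \<in> Y i}" for i
      using Y(1)[of i] sub[of i] unfolding definable_subset_def morley_ge_subset_def e by auto
    show "{x. [x] \<in> Y i} \<subseteq> S" for i using Y(1)[of i] by auto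
    show "{x. [x] \<in> Y i} \<inter> {x. [x] \<in> Y j} = {}" if "i \<noteq> j" for i j using Y(2)[OF that] by auto
  qed
next
  let ?s = "\<lambda>x::'a. [x]"
  assume ?R
  then obtain Y :: "nat \<Rightarrow> _" where Y: "(\<forall>i. definable_subset M (Y i) \<and> Y i \<subseteq> S \<and> morley_ge_subset M k (Y i)) \<and>
    (\<forall>i j. i \<noteq> j \<longrightarrow> Y i \<inter> Y j = {})" by blast
  note Y = Y[THEN conjunct1] Y[THEN conjunct2]
  show ?L unfolding morley_ge_subset_def morley_ge.simps
  proof (intro exI[of _ "\<lambda>i. ?s ` Y i"] conjI allI impI)
    show "?s ` Y i \<inter> ?s ` Y j = {}" if "i \<noteq> j" for i j using Y(2)[rule_format, OF that] by auto
  qed (use Y(1) in \<open>auto simp: definable_subset_def morley_ge_subset_def image_mono\<close>)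
qed

lemma morley_ge_subset_mono: "morley_ge_subset M k S \<Longrightarrow> S \<subseteq> T \<Longrightarrow> morley_ge_subset M k T"
proof (cases k)
  case (Suc l)
  assume "morley_ge_subset M k S" "S \<subseteq> T"
  then show ?thesis unfolding Suc morley_ge_subset_Suc by (meson order_trans)
qed auto

lemma morley_ge_subset_SucD: "morley_ge_subset M (Suc k) S \<Longrightarrow> morley_ge_subset M k S"
  unfolding morley_ge_subset_Suc by (meson morley_ge_subset_mono)

lemma morley_ge_subset_infinite: "morley_ge_subset M (Suc k) S \<Longrightarrow> infinite S"
proof (induction k)
  case 0
  obtain Y :: "nat \<Rightarrow> 'a set" where Y: "\<forall>i. Y i \<subseteq> S \<and> Y i \<noteq> {}" "\<forall>i j. i \<noteq> j \<longrightarrow> Y i \<inter> Y j = {}"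
    using 0 unfolding morley_ge_subset_Suc by auto
  have "\<forall>i. \<exists>x. x \<in> Y i" using Y(1) by blast
  then obtain y where y: "\<And>i. y i \<in> Y i" by metis
  have "inj y" using y Y(2) by (metis disjoint_iff injI)
  moreover have "range y \<subseteq> S" using y Y(1) by auto
  ultimately show ?case using infinite_iff_countable_subset by blast
next
  case (Suc k)
  then show ?case using morley_ge_subset_SucD by blast
qed

lemma finite_morley_rankD:
  assumes "finite_morley_rank M"
  obtains k where "\<And>S. S \<subseteq> carrier M \<Longrightarrow> \<not> morley_ge_subset M k S"
  using assms morley_ge_subset_mono unfolding finite_morley_rank_def morley_ge_subset_def tuples_1
  by (metis morley_ge_subset_def)

text \<open>With the identity, the calculus for two structures becomes a calculus of definability
  inside one ring.\<close>

lemma (in cring) elementary_extension_id: "elementary_extension R R id"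
  by unfold_locales (auto simp: elementary_embedding_def)

context elementary_extension
begin

lemma codef_mono: "codef A P Q \<Longrightarrow> A \<subseteq> B \<Longrightarrow> codef B P Q"
  unfolding codef_def by (meson order_trans)

lemma codef_set_mono: "codef_set A S T \<Longrightarrow> A \<subseteq> B \<Longrightarrow> codef_set B S T"
  unfolding codef_set_def using codef_mono by blast

lemma codef_set_definable:
  assumes "codef_set A S T" "A \<subseteq> carrier R"
  shows "definable M (f ` A) 1 ((\<lambda>x. [x]) ` T)"
proof -
  have "definable M (f ` A) 1 {xs\<in>tuples M 1. asg M xs 0 \<in> T}"
    using assms codef_definable[of A "\<lambda>v. v 0 \<in> S" "\<lambda>v. v 0 \<in> T" 1] by (simp add: codef_set_def)
  also have "{xs\<in>tuples M 1. asg M xs 0 \<in> T} = (\<lambda>x. [x]) ` T"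
    using assms(1) by (auto simp: tuples_1 asg_def codef_set_def simp del: One_nat_def)
  finally show ?thesis .
qed

lemma codef_set_definable_subset:
  assumes "codef_set A S T" "A \<subseteq> carrier R"
  shows "definable_subset M T"
  using definable_mono[OF codef_set_definable[OF assms], of "carrier M"] assms
  by (auto simp: definable_subset_def codef_set_def)

lemma codef_setI:
  "S \<subseteq> carrier R \<Longrightarrow> T \<subseteq> carrier M \<Longrightarrow> codef A P Q \<Longrightarrow> (\<And>v. range v \<subseteq> carrier R \<Longrightarrow> v 0 \<in> S \<longleftrightarrow> P v) \<Longrightarrow>
   (\<And>v. range v \<subseteq> carrier M \<Longrightarrow> v 0 \<in> T \<longleftrightarrow> Q v) \<Longrightarrow> codef_set A S T"
  unfolding codef_set_def by (auto intro: codef_cong)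

end

section \<open>Definable subsets of a single ring and their rank\<close>

context cring
begin

interpretation self: elementary_extension R R id
  by (rule elementary_extension_id)

text \<open>A formula uses finitely many parameters. This finiteness later makes the parameter set
  of the strongly minimal set small.\<close>

lemma definable_subset_codef:
  assumes "definable_subset R S"
  shows "\<exists>A. finite A \<and> A \<subseteq> carrier R \<and> self.codef_set A S S"
proof -
  obtain \<phi> ps where ps: "set ps \<subseteq> carrier R" "(\<lambda>x. [x]) ` S = def_set R 1 \<phi> ps"
    using assms by (auto simp: definable_subset_def definable_def)
  have c: "self.codef (set ps) (\<lambda>v. sat R (asg R (v 0 # ps)) \<phi>) (\<lambda>v. sat R (asg R (v 0 # ps)) \<phi>)"
    using self.codef_def_set_params[of ps "set ps" 1 \<phi>] by simp
  have e: "v 0 \<in> S \<longleftrightarrow> sat R (asg R (v 0 # ps)) \<phi>" if "range v \<subseteq> carrier R" for v :: "nat \<Rightarrow> 'a"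
  proof -
    have "v 0 \<in> S \<longleftrightarrow> [v 0] \<in> (\<lambda>x. [x]) ` S" by auto
    also have "\<dots> \<longleftrightarrow> sat R (asg R (v 0 # ps)) \<phi>"
      using that unfolding ps(2) by (auto simp: def_set_def tuples_def)
    finally show ?thesis .
  qed
  have "self.codef_set (set ps) S S"
    by (rule self.codef_setI[OF _ _ c]) (use assms e in \<open>auto simp: definable_subset_def\<close>)
  then show ?thesis using ps(1) by blast
qed

lemma definable_subset_iff_codef: "definable_subset R S \<longleftrightarrow> self.codef_set (carrier R) S S"
  using definable_subset_codef self.codef_set_mono self.codef_set_definable_subset by blast

lemma definable_subset_diff:
  assumes "definable_subset R S" "definable_subset R T"
  shows "definable_subset R (S - T)"
  using assms self.codef_and[OF _ self.codef_not]
  by (auto simp: definable_subset_iff_codef self.codef_set_def)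

lemma definable_subset_translate:
  assumes "definable_subset R S" "c \<in> carrier R"
  shows "definable_subset R ((\<oplus>) c ` S)"
proof -
  have S: "self.codef_set (carrier R) S S" and sub: "S \<subseteq> carrier R"
    using assms by (auto simp: definable_subset_iff_codef self.codef_set_def)
  have e: "x \<in> (\<oplus>) c ` S \<longleftrightarrow> x \<ominus> c \<in> S" if "x \<in> carrier R" for x
  proof -
    have 1: "x = c \<oplus> (x \<ominus> c)" using that assms(2) by algebra
    have 2: "(c \<oplus> y) \<ominus> c = y" if "y \<in> carrier R" for y using that assms(2) by algebra
    show ?thesis
    proof
      assume "x \<in> (\<oplus>) c ` S"
      then show "x \<ominus> c \<in> S" using 2 sub by auto
    next
      assume "x \<ominus> c \<in> S"
      then show "x \<in> (\<oplus>) c ` S" using 1 by (rule_tac image_eqI) auto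
    qed
  qed
  have "self.codef (carrier R) (\<lambda>v. v 0 \<ominus> c \<in> S) (\<lambda>v. v 0 \<ominus> id c \<in> S)"
    by (intro self.codef_mem[OF S] self.coterm_intros assms(2)) simp
  then show ?thesis unfolding definable_subset_iff_codef
    by (rule self.codef_setI[rotated 2]) (use sub assms(2) e in \<open>auto\<close>)
qed

text \<open>Translation is injective and preserves definability, so the families of disjoint sets
  that witness the rank move along with \<open>S\<close>.\<close>

lemma morley_ge_subset_translate:
  assumes "c \<in> carrier R" "S \<subseteq> carrier R" "morley_ge_subset R k S"
  shows "morley_ge_subset R k ((\<oplus>) c ` S)"
  using assms(2,3)
proof (induction k arbitrary: S)
  case (Suc k)
  obtain Y :: "nat \<Rightarrow> _" where Y0: "(\<forall>i. definable_subset R (Y i) \<and> Y i \<subseteq> S \<and> morley_ge_subset R k (Y i)) \<and>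
    (\<forall>i j. i \<noteq> j \<longrightarrow> Y i \<inter> Y j = {})" using Suc.prems(2) unfolding morley_ge_subset_Suc by blast
  then have Y: "\<And>i. definable_subset R (Y i)" "\<And>i. Y i \<subseteq> S" "\<And>i. morley_ge_subset R k (Y i)"
    "\<And>i j. i \<noteq> j \<Longrightarrow> Y i \<inter> Y j = {}" by auto
  have sub: "Y i \<subseteq> carrier R" for i using Y(2) Suc.prems(1) by blast
  have "(\<oplus>) c ` Y i \<inter> (\<oplus>) c ` Y j = {}" if "i \<noteq> j" for i j
    using Y(4)[OF that] sub[of i] sub[of j] assms(1) by (auto simp: subset_iff)
  then show ?case unfolding morley_ge_subset_Suc
    using Suc.IH[OF sub Y(3)] definable_subset_translate[OF Y(1) assms(1)] Y(2)
    by (intro exI[of _ "\<lambda>i. (\<oplus>) c ` Y i"]) (simp add: image_mono)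
qed auto

text \<open>If every infinite definable subset of \<open>X\<close> could be split into two infinite
  definable parts, repeated splitting would produce infinitely many disjoint subsets of the same
  kind inside each of them, and the rank would exceed every \<open>k\<close>.\<close>

lemma exists_minimal_definable_subset:
  assumes fin: "finite_morley_rank R" and X: "definable_subset R X" "infinite X"
  shows "\<exists>D\<subseteq>X. definable_subset R D \<and> infinite D \<and>
           (\<forall>Y\<subseteq>D. definable_subset R Y \<longrightarrow> finite Y \<or> finite (D - Y))"
proof (rule ccontr)
  assume neg: "\<not> ?thesis"
  let ?good = "\<lambda>D. D \<subseteq> X \<and> definable_subset R D \<and> infinite D"
  have "\<forall>D. \<exists>Y. ?good D \<longrightarrow> Y \<subseteq> D \<and> ?good Y \<and> ?good (D - Y)"
  proof
    fix D
    have "\<exists>Y\<subseteq>D. definable_subset R Y \<and> infinite Y \<and> infinite (D - Y)" if "?good D"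
      using neg that by blast
    then show "\<exists>Y. ?good D \<longrightarrow> Y \<subseteq> D \<and> ?good Y \<and> ?good (D - Y)"
      using definable_subset_diff by blast
  qed
  then obtain g where g: "\<And>D. ?good D \<Longrightarrow> g D \<subseteq> D \<and> ?good (g D) \<and> ?good (D - g D)" by metis
  have rank: "morley_ge_subset R k D" if "?good D" for k D
    using that
  proof (induction k arbitrary: D)
    case 0
    then show ?case by auto
  next
    case (Suc k)
    have good: "?good ((g ^^ n) D)" for n
      by (induction n) (use Suc.prems g in auto)
    have dec: "(g ^^ (n + m)) D \<subseteq> (g ^^ n) D" for n m
    proof (induction m)
      case (Suc m)
      then show ?case using g[OF good[of "n + m"]] by auto
    qed auto
    \<comment> \<open>The parts cut off at the successive splittings; they are disjoint and can be
      split again, which feeds the induction on \<open>k\<close>.\<close>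
    let ?W = "\<lambda>n. (g ^^ n) D - (g ^^ Suc n) D"
    have W: "?good (?W n)" for n using g[OF good[of n]] by auto
    have disj: "?W i \<inter> ?W j = {}" if "i < j" for i j
      using dec[of "Suc i" "j - Suc i"] that by auto
    show ?case unfolding morley_ge_subset_Suc
    proof (intro exI[of _ ?W] conjI allI impI)
      show "?W i \<inter> ?W j = {}" if "i \<noteq> j" for i j
        using disj[of i j] disj[of j i] that by (cases "i < j") auto
      show "?W n \<subseteq> D" for n using dec[of 0 n] by auto
      show "definable_subset R (?W n)" "morley_ge_subset R k (?W n)" for n
        using W[of n] Suc.IH[OF W[of n]] by auto
    qed
  qed
  obtain k where "\<And>S. S \<subseteq> carrier R \<Longrightarrow> \<not> morley_ge_subset R k S"
    using finite_morley_rankD[OF fin] by blast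
  then show False using rank[of X k] X by (auto simp: definable_subset_def)
qed

end

text \<open>The translates of \<open>T\<close> by the elements \<open>f (c i)\<close> are disjoint,
  lie in \<open>T'\<close> and have the rank of \<open>T\<close>. The representatives
  \<open>c i\<close> are found in \<open>R\<close>; containment concerns one of them and
  disjointness two, so each instance is first-order and transfers by itself.\<close>

lemma (in elementary_extension) morley_ge_subset_chain:
  assumes S: "codef_set A S T" and S': "codef_set A S' T'" and A: "A \<subseteq> carrier R"
    and c: "\<And>i::nat. c i \<in> carrier R" "\<And>i x. x \<in> S \<Longrightarrow> c i \<oplus>\<^bsub>R\<^esub> x \<in> S'"
    and disj: "\<And>i j x y. i \<noteq> j \<Longrightarrow> x \<in> S \<Longrightarrow> y \<in> S \<Longrightarrow> c i \<oplus>\<^bsub>R\<^esub> x \<noteq> c j \<oplus>\<^bsub>R\<^esub> y"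
    and rank: "morley_ge_subset M k T"
  shows "morley_ge_subset M (Suc k) T'"
proof -
  let ?Y = "\<lambda>i. (\<oplus>\<^bsub>M\<^esub>) (f (c i)) ` T"
  note S = codef_set_mono[OF S A] and S' = codef_set_mono[OF S' A]
  have sub: "T \<subseteq> carrier M" using S by (simp add: codef_set_def)
  have T': "f (c i) \<oplus>\<^bsub>M\<^esub> x \<in> T'" if "x \<in> T" for i x
  proof -
    have "codef (carrier R) (\<lambda>v. v 0 \<in> S \<longrightarrow> c i \<oplus>\<^bsub>R\<^esub> v 0 \<in> S') (\<lambda>v. v 0 \<in> T \<longrightarrow> f (c i) \<oplus>\<^bsub>M\<^esub> v 0 \<in> T')"
      by (intro codef_imp codef_mem[OF S] codef_mem[OF S'] coterm_intros c order_refl)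
    from codef_transfer_all[OF this, of "\<lambda>_. x"] have "x \<in> T \<longrightarrow> f (c i) \<oplus>\<^bsub>M\<^esub> x \<in> T'"
      using c sub that by auto
    then show ?thesis using that by simp
  qed
  have disj': "f (c i) \<oplus>\<^bsub>M\<^esub> x \<noteq> f (c j) \<oplus>\<^bsub>M\<^esub> y" if "i \<noteq> j" "x \<in> T" "y \<in> T" for i j x y
  proof -
    let ?v = "\<lambda>n::nat. if n = 0 then x else y"
    have "codef (carrier R) (\<lambda>v. v 0 \<in> S \<longrightarrow> v 1 \<in> S \<longrightarrow> \<not> c i \<oplus>\<^bsub>R\<^esub> v 0 = c j \<oplus>\<^bsub>R\<^esub> v 1)
        (\<lambda>v. v 0 \<in> T \<longrightarrow> v 1 \<in> T \<longrightarrow> \<not> f (c i) \<oplus>\<^bsub>M\<^esub> v 0 = f (c j) \<oplus>\<^bsub>M\<^esub> v 1)"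
      by (intro codef_imp codef_mem[OF S] codef_not codef_eq coterm_intros c order_refl)
    from codef_transfer_all[OF this, of ?v] have "?v 0 \<in> T \<longrightarrow> ?v 1 \<in> T \<longrightarrow> f (c i) \<oplus>\<^bsub>M\<^esub> ?v 0 \<noteq> f (c j) \<oplus>\<^bsub>M\<^esub> ?v 1"
      using disj[OF \<open>i \<noteq> j\<close>] sub that by (auto split: if_splits)
    then show ?thesis using that by simp
  qed
  show ?thesis unfolding morley_ge_subset_Suc
  proof (intro exI[of _ ?Y] conjI allI impI)
    show "definable_subset M (?Y i)" for i
      using M.definable_subset_translate[OF codef_set_definable_subset[OF S order_refl]] c by simp
    show "morley_ge_subset M k (?Y i)" for i
      using M.morley_ge_subset_translate[OF _ sub rank] c by simp
    show "?Y i \<subseteq> T'" for i using T' by auto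
    show "?Y i \<inter> ?Y j = {}" if "i \<noteq> j" for i j using disj'[OF that] by auto
  qed
qed

section \<open>Composition series\<close>

text \<open>Ideals are kept as lists of generators, the newest at the head, so that suffixes are the
  lower terms of a chain and \<open>map f\<close> names the corresponding ideal of
  \<open>M\<close>.\<close>

primrec gen_ideal :: "('a, 'm) ring_scheme \<Rightarrow> 'a list \<Rightarrow> 'a set" where
  "gen_ideal R [] = {\<zero>\<^bsub>R\<^esub>}"
| "gen_ideal R (g # gs) = {g \<otimes>\<^bsub>R\<^esub> r \<oplus>\<^bsub>R\<^esub> y | r y. r \<in> carrier R \<and> y \<in> gen_ideal R gs}"

text \<open>The factor \<open>gen_ideal R (g # gs) / gen_ideal R gs\<close> is isomorphic to
  \<open>R / colon R gs g\<close>; through this \<open>composition_series\<close> expresses that its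
  factors are simple.\<close>

definition colon :: "('a, 'm) ring_scheme \<Rightarrow> 'a list \<Rightarrow> 'a \<Rightarrow> 'a set" where
  "colon R gs g = {r \<in> carrier R. g \<otimes>\<^bsub>R\<^esub> r \<in> gen_ideal R gs}"

primrec strict_chain :: "('a, 'm) ring_scheme \<Rightarrow> 'a list \<Rightarrow> bool" where
  "strict_chain R [] \<longleftrightarrow> True"
| "strict_chain R (g # gs) \<longleftrightarrow> g \<in> carrier R \<and> g \<notin> gen_ideal R gs \<and> strict_chain R gs"

primrec composition_series :: "('a, 'm) ring_scheme \<Rightarrow> 'a list \<Rightarrow> bool" where
  "composition_series R [] \<longleftrightarrow> True"
| "composition_series R (g # gs) \<longleftrightarrow>
     g \<in> carrier R \<and> maximalideal (colon R gs g) R \<and> composition_series R gs"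

lemma gen_ideal_ConsI:
  "r \<in> carrier R \<Longrightarrow> y \<in> gen_ideal R gs \<Longrightarrow> g \<otimes>\<^bsub>R\<^esub> r \<oplus>\<^bsub>R\<^esub> y \<in> gen_ideal R (g # gs)"
  by auto

lemma (in ideal) rcos_eq_iff:
  assumes "x \<in> carrier R" "y \<in> carrier R"
  shows "I +> x = I +> y \<longleftrightarrow> x \<ominus> y \<in> I"
  using a_rcos_module_minus[OF ring_axioms assms(2,1)] a_rcos_self[OF assms(1)]
    a_repr_independence'[OF _ assms(2)] by auto

context cring
begin

lemma ideal_gen_ideal:
  assumes "set gs \<subseteq> carrier R"
  shows "ideal (gen_ideal R gs) R"
  using assms
proof (induction gs)
  case Nil
  then show ?case using zeroideal by simp
next
  case (Cons g gs)
  then interpret I: ideal "gen_ideal R gs" R by simp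
  have g: "g \<in> carrier R" using Cons.prems by simp
  show ?case
  proof (rule idealI)
    show "ring R" by (rule ring_axioms)
    show "subgroup (gen_ideal R (g # gs)) (add_monoid R)"
    proof (rule add.subgroupI)
      show "gen_ideal R (g # gs) \<subseteq> carrier R" using g I.a_subset by auto
      show "gen_ideal R (g # gs) \<noteq> {}" using gen_ideal_ConsI[OF zero_closed I.zero_closed] by blast
      show "\<ominus> a \<in> gen_ideal R (g # gs)" if a: "a \<in> gen_ideal R (g # gs)" for a
      proof -
        obtain r y where r: "r \<in> carrier R" "y \<in> gen_ideal R gs" "a = g \<otimes> r \<oplus> y" using a by auto
        moreover have y: "y \<in> carrier R" using r I.a_Hcarr by simp
        ultimately have "\<ominus> a = g \<otimes> (\<ominus> r) \<oplus> (\<ominus> y)" using g by algebra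
        then show ?thesis using r I.a_inv_closed by auto
      qed
      show "a \<oplus> b \<in> gen_ideal R (g # gs)" if a: "a \<in> gen_ideal R (g # gs)" and b: "b \<in> gen_ideal R (g # gs)" for a b
      proof -
        obtain r y where r: "r \<in> carrier R" "y \<in> gen_ideal R gs" "a = g \<otimes> r \<oplus> y" using a by auto
        obtain s z where s: "s \<in> carrier R" "z \<in> gen_ideal R gs" "b = g \<otimes> s \<oplus> z" using b by auto
        have "y \<in> carrier R" "z \<in> carrier R" using r s I.a_Hcarr by simp_all
        then have "a \<oplus> b = g \<otimes> (r \<oplus> s) \<oplus> (y \<oplus> z)" using g r(1,3) s(1,3) by algebra
        then show ?thesis using r s I.a_closed by auto
      qed
    qed
    show l: "x \<otimes> a \<in> gen_ideal R (g # gs)" if a: "a \<in> gen_ideal R (g # gs)" and x: "x \<in> carrier R" for a x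
    proof -
      obtain r y where r: "r \<in> carrier R" "y \<in> gen_ideal R gs" "a = g \<otimes> r \<oplus> y" using a by auto
      have "y \<in> carrier R" using r I.a_Hcarr by simp
      then have "x \<otimes> a = g \<otimes> (x \<otimes> r) \<oplus> x \<otimes> y" using g r(1,3) x by algebra
      then show ?thesis using r x I.I_l_closed by auto
    qed
    show "a \<otimes> x \<in> gen_ideal R (g # gs)" if "a \<in> gen_ideal R (g # gs)" "x \<in> carrier R" for a x
    proof -
      have "a \<in> carrier R" using that(1) g I.a_Hcarr by auto
      then show ?thesis using l[OF that] m_comm[of a x] that(2) by simp
    qed
  qed
qed

lemma gen_ideal_subset: "set gs \<subseteq> carrier R \<Longrightarrow> gen_ideal R gs \<subseteq> carrier R"
  using ideal_gen_ideal additive_subgroup.a_subset ideal.axioms(1) by blast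

lemma gen_ideal_Cons_mono:
  assumes "set gs \<subseteq> carrier R" "g \<in> carrier R"
  shows "gen_ideal R gs \<subseteq> gen_ideal R (g # gs)"
proof
  fix y assume "y \<in> gen_ideal R gs"
  moreover from this have "y = g \<otimes> \<zero> \<oplus> y" using gen_ideal_subset[OF assms(1)] assms(2) by auto
  ultimately show "y \<in> gen_ideal R (g # gs)" by auto
qed

lemma gen_ideal_head:
  assumes "set gs \<subseteq> carrier R" "g \<in> carrier R" "r \<in> carrier R"
  shows "g \<otimes> r \<in> gen_ideal R (g # gs)"
proof -
  interpret I: ideal "gen_ideal R gs" R by (rule ideal_gen_ideal[OF assms(1)])
  show ?thesis
    using gen_ideal_ConsI[OF assms(3) I.zero_closed, of g] assms by (simp del: gen_ideal.simps)
qed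

lemma gen_ideal_least:
  assumes "ideal I R" "set gs \<subseteq> I"
  shows "gen_ideal R gs \<subseteq> I"
proof -
  interpret I: ideal I R by fact
  show ?thesis using assms(2)
    by (induction gs) (auto intro!: I.a_closed I.I_r_closed)
qed

lemma ideal_colon:
  assumes "set gs \<subseteq> carrier R" "g \<in> carrier R"
  shows "ideal (colon R gs g) R"
  using ideal.helper_max_prime[OF ideal_gen_ideal[OF assms(1)] is_cring assms(2)] by (simp add: colon_def)

lemma strict_chain_carrier: "strict_chain R gs \<Longrightarrow> set gs \<subseteq> carrier R"
  by (induction gs) auto

lemma composition_series_carrier: "composition_series R gs \<Longrightarrow> set gs \<subseteq> carrier R"
  by (induction gs) auto

lemma gen_ideal_append_cong:
  "gen_ideal R xs = gen_ideal R ys \<Longrightarrow> gen_ideal R (us @ xs) = gen_ideal R (us @ ys)"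
  by (induction us) auto

lemma strict_chain_append_cong:
  "gen_ideal R xs = gen_ideal R ys \<Longrightarrow> strict_chain R (us @ xs) \<Longrightarrow> strict_chain R ys \<Longrightarrow> strict_chain R (us @ ys)"
  by (induction us) (auto simp: gen_ideal_append_cong[of xs ys])

lemma strict_chain_appendD: "strict_chain R (us @ xs) \<Longrightarrow> strict_chain R xs"
  by (induction us) auto

text \<open>The assumption \<open>simple\<close> says that the factor generated by \<open>g\<close>
  is simple: every nonzero multiple of \<open>g\<close> in it gives \<open>g\<close> back. Writing
  \<open>g = g r u + v\<close> puts \<open>\<one> \<ominus> r \<otimes> u\<close> in the colon
  ideal, so an ideal above it that contains \<open>r\<close> also contains
  \<open>\<one>\<close>.\<close>

lemma maximalideal_colonI:
  assumes gs: "set gs \<subseteq> carrier R" "g \<in> carrier R" "g \<notin> gen_ideal R gs"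
    and simple: "\<And>r. r \<in> carrier R \<Longrightarrow> r \<notin> colon R gs g \<Longrightarrow> g \<in> gen_ideal R (g \<otimes> r # gs)"
  shows "maximalideal (colon R gs g) R"
proof (rule maximalidealI)
  interpret I: ideal "gen_ideal R gs" R by (rule ideal_gen_ideal[OF gs(1)])
  show id: "ideal (colon R gs g) R" by (rule ideal_colon[OF gs(1,2)])
  have "\<one> \<notin> colon R gs g" using gs by (simp add: colon_def)
  then show "carrier R \<noteq> colon R gs g" using one_closed by blast
  show "J = colon R gs g \<or> J = carrier R" if J: "ideal J R" "colon R gs g \<subseteq> J" "J \<subseteq> carrier R" for J
  proof (cases "J = colon R gs g")
    case False
    interpret J: ideal J R by fact
    obtain r where r: "r \<in> J" "r \<notin> colon R gs g" using False J by auto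
    then have rc: "r \<in> carrier R" using J by auto
    obtain u v where u: "u \<in> carrier R" "v \<in> gen_ideal R gs" "g = (g \<otimes> r) \<otimes> u \<oplus> v"
      using simple[OF rc r(2)] by auto
    have vc: "v \<in> carrier R" using u I.a_Hcarr by simp
    have "g \<otimes> (\<one> \<ominus> r \<otimes> u) = g \<ominus> (g \<otimes> r) \<otimes> u" using gs(2) rc u(1) by algebra
    also have "\<dots> = ((g \<otimes> r) \<otimes> u \<oplus> v) \<ominus> (g \<otimes> r) \<otimes> u" using u(3) by simp
    also have "\<dots> = v" using gs(2) rc u(1) vc by algebra
    finally have "\<one> \<ominus> r \<otimes> u \<in> colon R gs g" using u rc by (simp add: colon_def)
    then have "\<one> \<ominus> r \<otimes> u \<in> J" using J by auto
    then have "(\<one> \<ominus> r \<otimes> u) \<oplus> r \<otimes> u \<in> J" using J.I_r_closed[OF r(1) u(1)] by (rule J.a_closed)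
    moreover have "(\<one> \<ominus> r \<otimes> u) \<oplus> r \<otimes> u = \<one>" using rc u(1) one_closed by algebra
    ultimately show ?thesis using J.one_imp_carrier by simp
  qed simp
qed

text \<open>A strict chain of greatest length cannot be refined, so its factors are simple, and
  cannot be prolonged, so it exhausts \<open>R\<close>.\<close>

lemma exists_composition_series:
  assumes bound: "\<And>gs. strict_chain R gs \<Longrightarrow> length gs < n"
  shows "\<exists>gs. composition_series R gs \<and> gen_ideal R gs = carrier R"
proof -
  have "strict_chain R []" by simp
  from ex_has_greatest_nat[of "strict_chain R" "[]" length n, OF this]
  obtain gs where gs: "strict_chain R gs" and max: "\<And>xs. strict_chain R xs \<Longrightarrow> length xs \<le> length gs"
    using bound less_imp_le by blast
  have "composition_series R vs" if "gs = us @ vs" for us vs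
    using that
  proof (induction vs arbitrary: us)
    case (Cons g vs)
    have st: "strict_chain R (g # vs)" using gs strict_chain_appendD unfolding Cons.prems by blast
    then have vs: "set vs \<subseteq> carrier R" "g \<in> carrier R" "g \<notin> gen_ideal R vs" "strict_chain R vs"
      using strict_chain_carrier by auto
    interpret I: ideal "gen_ideal R vs" R by (rule ideal_gen_ideal[OF vs(1)])
    have "maximalideal (colon R vs g) R"
    proof (rule maximalideal_colonI[OF vs(1-3)], rule ccontr)
      fix r assume r: "r \<in> carrier R" "r \<notin> colon R vs g" "g \<notin> gen_ideal R (g \<otimes> r # vs)"
      \<comment> \<open>The refinement: \<open>?a\<close> and \<open>vs\<close> generate an ideal
        strictly between those of \<open>vs\<close> and of \<open>g # vs\<close>.\<close>
      let ?a = "g \<otimes> r"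
      have a: "?a \<in> carrier R" "?a \<notin> gen_ideal R vs" using r vs by (auto simp: colon_def)
      have st': "strict_chain R (g # ?a # vs)" using r(3) a vs by simp
      have "gen_ideal R (g # ?a # vs) = gen_ideal R (g # vs)"
      proof
        have id: "ideal (gen_ideal R (g # vs)) R" by (rule ideal_gen_ideal) (use vs in simp)
        have "?a \<in> gen_ideal R (g # vs)" "g \<in> gen_ideal R (g # vs)"
          using gen_ideal_head[OF vs(1,2)] r(1) vs(2) r_one[of g] one_closed by metis+
        moreover have "set vs \<subseteq> gen_ideal R (g # vs)"
        proof -
          have "set ws \<subseteq> gen_ideal R ws" if "set ws \<subseteq> carrier R" for ws using that
          proof (induction ws)
            case (Cons w ws)
            then show ?case
              using gen_ideal_Cons_mono[of ws w] gen_ideal_head[of ws w \<one>] by (auto simp del: gen_ideal.simps)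
          qed simp
          then show ?thesis using gen_ideal_Cons_mono[OF vs(1,2)] vs(1) by blast
        qed
        ultimately show "gen_ideal R (g # ?a # vs) \<subseteq> gen_ideal R (g # vs)"
          by (intro gen_ideal_least[OF id]) (simp del: gen_ideal.simps)
        have "gen_ideal R vs \<subseteq> gen_ideal R (?a # vs)" by (rule gen_ideal_Cons_mono[OF vs(1) a(1)])
        then show "gen_ideal R (g # vs) \<subseteq> gen_ideal R (g # ?a # vs)"
          by (subst (1 2) gen_ideal.simps(2)) blast
      qed
      \<comment> \<open>Strictness of the part \<open>us\<close> depends only on the ideal generated
        below it, which the insertion leaves the same.\<close>
      then have "strict_chain R (us @ g # ?a # vs)"
        using strict_chain_append_cong[OF _ _ st', of "g # vs" us] gs Cons.prems by simp
      then show False using max[of "us @ g # ?a # vs"] Cons.prems by simp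
    qed
    then show ?case using vs Cons.IH[of "us @ [g]"] Cons.prems by simp
  qed simp
  then have "composition_series R gs" by simp
  moreover have "a \<in> gen_ideal R gs" if "a \<in> carrier R" for a
    using max[of "a # gs"] gs that by auto
  ultimately show ?thesis using gen_ideal_subset[OF strict_chain_carrier[OF gs]] by blast
qed

end

context elementary_extension
begin

lemma codef_set_gen_ideal:
  assumes "set gs \<subseteq> A" "A \<subseteq> carrier R"
  shows "codef_set A (gen_ideal R gs) (gen_ideal M (map f gs))"
  using assms(1)
proof (induction gs)
  case Nil
  have "codef A (\<lambda>v. v 0 = \<zero>\<^bsub>R\<^esub>) (\<lambda>v. v 0 = \<zero>\<^bsub>M\<^esub>)" by (intro codef_eq coterm_intros)
  then show ?case by (simp add: codef_set_def)
next
  case (Cons g gs)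
  let ?I = "gen_ideal R gs" and ?J = "gen_ideal M (map f gs)"
  have IH: "codef_set A ?I ?J" and g: "g \<in> A" "g \<in> carrier R" using Cons assms(2) by auto
  have c: "codef A (\<lambda>v. \<exists>r\<in>carrier R. \<exists>y\<in>carrier R. y \<in> ?I \<and> v 0 = g \<otimes>\<^bsub>R\<^esub> r \<oplus>\<^bsub>R\<^esub> y)
     (\<lambda>v. \<exists>r\<in>carrier M. \<exists>y\<in>carrier M. y \<in> ?J \<and> v 0 = f g \<otimes>\<^bsub>M\<^esub> r \<oplus>\<^bsub>M\<^esub> y)"
  proof -
    have "codef A (\<lambda>v. v 2 \<in> ?I \<and> v 0 = g \<otimes>\<^bsub>R\<^esub> v 1 \<oplus>\<^bsub>R\<^esub> v 2) (\<lambda>v. v 2 \<in> ?J \<and> v 0 = f g \<otimes>\<^bsub>M\<^esub> v 1 \<oplus>\<^bsub>M\<^esub> v 2)"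
      by (intro codef_and codef_eq codef_mem[OF IH] coterm_intros assms(2) g)
    from codef_ex[OF codef_ex[OF this, of 2], of 1] show ?thesis by simp
  qed
  have sub: "?I \<subseteq> carrier R" "?J \<subseteq> carrier M" using IH by (auto simp: codef_set_def)
  show ?case
    by (rule codef_setI[OF _ _ c]) (use sub g in \<open>auto; blast\<close>)+
qed

lemma codef_set_colon:
  assumes "set gs \<subseteq> A" "g \<in> A" "A \<subseteq> carrier R"
  shows "codef_set A (colon R gs g) (colon M (map f gs) (f g))"
proof -
  have c: "codef A (\<lambda>v. g \<otimes>\<^bsub>R\<^esub> v 0 \<in> gen_ideal R gs) (\<lambda>v. f g \<otimes>\<^bsub>M\<^esub> v 0 \<in> gen_ideal M (map f gs))"
    by (intro codef_mem[OF codef_set_gen_ideal] coterm_intros assms)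
  show ?thesis by (rule codef_setI[OF _ _ c]) (auto simp: colon_def)
qed

end

text \<open>A proper ideal lies in a maximal ideal, whose residue field is infinite.\<close>

lemma (in cring) infinite_index:
  assumes inf: "\<And>m. maximalideal m R \<Longrightarrow> infinite (carrier (R Quot m))"
    and J: "ideal J R" "\<one> \<notin> J"
  shows "\<exists>r :: nat \<Rightarrow> 'a. (\<forall>i. r i \<in> carrier R) \<and> (\<forall>i j. i \<noteq> j \<longrightarrow> r i \<ominus> r j \<notin> J)"
proof -
  obtain m where m: "maximalideal m R" "J \<subseteq> m" using exists_maximalideal_above[OF J] by auto
  interpret m: maximalideal m R by fact
  obtain c :: "nat \<Rightarrow> 'a set" where c: "inj c" "range c \<subseteq> carrier (R Quot m)"
    using infinite_countable_subset[OF inf[OF m(1)]] by blast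
  have "\<exists>x\<in>carrier R. c i = m +> x" for i
    using c(2) by (auto simp: FactRing_simps image_subset_iff)
  then obtain r where r: "\<And>i. r i \<in> carrier R" "\<And>i. c i = m +> r i" by metis
  have "r i \<ominus> r j \<notin> J" if "i \<noteq> j" for i j
    using m.rcos_eq_iff[OF r(1) r(1), of i j] m(2) injD[OF c(1), of i j] that r(2) by auto
  then show ?thesis using r(1) by blast
qed

text \<open>Cosets of \<open>gen_ideal R gs\<close> in the next ideal correspond to cosets of the
  colon ideal in \<open>R\<close>. That ideal is proper by strictness, hence of infinite index, and
  each generator raises the rank by one.\<close>

lemma (in elementary_extension) morley_ge_strict_chain:
  assumes inf: "\<And>m. maximalideal m R \<Longrightarrow> infinite (carrier (R Quot m))"
    and "strict_chain R gs"
  shows "morley_ge_subset M (length gs) (gen_ideal M (map f gs))"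
  using assms(2)
proof (induction gs)
  case (Cons g gs)
  then have g: "g \<in> carrier R" "g \<notin> gen_ideal R gs" "set gs \<subseteq> carrier R" and
    IH: "morley_ge_subset M (length gs) (gen_ideal M (map f gs))"
    using R.strict_chain_carrier by auto
  interpret I: ideal "gen_ideal R gs" R by (rule R.ideal_gen_ideal[OF g(3)])
  have "\<one>\<^bsub>R\<^esub> \<notin> colon R gs g" using g by (simp add: colon_def)
  from R.infinite_index[OF inf R.ideal_colon[OF g(3,1)] this]
  obtain r :: "nat \<Rightarrow> 'a" where r: "\<And>i. r i \<in> carrier R" "\<And>i j. i \<noteq> j \<Longrightarrow> r i \<ominus>\<^bsub>R\<^esub> r j \<notin> colon R gs g" by blast
  show ?case unfolding length_Cons
  proof (rule morley_ge_subset_chain)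
    show "codef_set (carrier R) (gen_ideal R gs) (gen_ideal M (map f gs))"
      "codef_set (carrier R) (gen_ideal R (g # gs)) (gen_ideal M (map f (g # gs)))"
      using g by (intro codef_set_gen_ideal; simp)+
    show "g \<otimes>\<^bsub>R\<^esub> r i \<in> carrier R" for i using g r by simp
    show "g \<otimes>\<^bsub>R\<^esub> r i \<oplus>\<^bsub>R\<^esub> x \<in> gen_ideal R (g # gs)" if "x \<in> gen_ideal R gs" for i x using r that by auto
    show "g \<otimes>\<^bsub>R\<^esub> r i \<oplus>\<^bsub>R\<^esub> x \<noteq> g \<otimes>\<^bsub>R\<^esub> r j \<oplus>\<^bsub>R\<^esub> y"
      if "i \<noteq> j" "x \<in> gen_ideal R gs" "y \<in> gen_ideal R gs" for i j x y
    proof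
      assume e: "g \<otimes>\<^bsub>R\<^esub> r i \<oplus>\<^bsub>R\<^esub> x = g \<otimes>\<^bsub>R\<^esub> r j \<oplus>\<^bsub>R\<^esub> y"
      have xy: "x \<in> carrier R" "y \<in> carrier R" using that I.a_Hcarr by auto
      have rc: "r i \<in> carrier R" "r j \<in> carrier R" using r by auto
      have "g \<otimes>\<^bsub>R\<^esub> (r i \<ominus>\<^bsub>R\<^esub> r j) = (g \<otimes>\<^bsub>R\<^esub> r i \<oplus>\<^bsub>R\<^esub> x) \<ominus>\<^bsub>R\<^esub> x \<ominus>\<^bsub>R\<^esub> g \<otimes>\<^bsub>R\<^esub> r j"
        using xy rc g(1) by algebra
      also have "\<dots> = y \<ominus>\<^bsub>R\<^esub> x" unfolding e using xy rc g(1) by algebra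
      also have "\<dots> \<in> gen_ideal R gs" using that(2,3) by (simp add: a_minus_def)
      finally show False using r(2)[OF that(1)] rc by (simp add: colon_def)
    qed
  qed (use IH in auto)
qed simp

section \<open>Coordinates in residue fields\<close>

text \<open>The least positive \<open>n\<close> with \<open>[n] \<cdot> \<one> \<in> m\<close> is
  the characteristic of \<open>R / m\<close>, prime because \<open>m\<close> is. Different maximal
  ideals may give different primes, as \<open>N\<close> need not be a prime power.\<close>

lemma (in cring) exists_prime_in_maximalideal:
  assumes "maximalideal m R" "0 < N" "[(N::nat)] \<cdot> \<one> = \<zero>"
  shows "\<exists>p::nat. prime p \<and> [p] \<cdot> \<one> \<in> m"
proof -
  interpret m: maximalideal m R by fact
  interpret m: primeideal m R by (rule maximalideal_prime[OF assms(1)])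
  define p where "p = (LEAST n::nat. 0 < n \<and> [n] \<cdot> \<one> \<in> m)"
  have "0 < N \<and> [N] \<cdot> \<one> \<in> m" using assms by simp
  then have p: "0 < p \<and> [p] \<cdot> \<one> \<in> m" unfolding p_def by (rule LeastI)
  have least: "p \<le> n" if "0 < n" "[n] \<cdot> \<one> \<in> m" for n
    unfolding p_def by (rule Least_le) (use that in simp)
  have "p \<noteq> 1"
  proof
    assume "p = 1"
    then have "\<one> \<in> m" using p by simp
    then show False using m.one_imp_carrier m.I_notcarr by simp
  qed
  have split: "a = 1 \<or> b = 1" if ab: "p = a * b" for a b
  proof -
    have "[p] \<cdot> \<one> = ([a] \<cdot> \<one>) \<otimes> ([b] \<cdot> \<one>)"
      using add_pow_ldistr[of \<one> "[b] \<cdot> \<one>" a] by (simp add: ab add.nat_pow_pow mult.commute)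
    then have "[a] \<cdot> \<one> \<in> m \<or> [b] \<cdot> \<one> \<in> m" using p m.I_prime by simp
    then have "p \<le> a \<or> p \<le> b" using least p ab by (metis nat_0_less_mult_iff)
    moreover have "0 < a" "0 < b" using p ab by auto
    ultimately show ?thesis using ab by auto
  qed
  have "prime p" unfolding prime_nat_iff
  proof (intro conjI allI impI)
    show "1 < p" using p \<open>p \<noteq> 1\<close> by simp
    fix a assume "a dvd p"
    then obtain b where "p = a * b" by (auto simp: dvd_def)
    then show "a = 1 \<or> a = p" using split[of a b] by auto
  qed
  then show ?thesis using p by blast
qed

lemma (in ideal) carrier_quotientD: "w \<in> carrier (R Quot I) \<Longrightarrow> \<exists>x\<in>carrier R. w = I +> x"
  by (auto simp: FactRing_simps)

lemma (in maximalideal) unit_modulo: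
  assumes "cring R" "e \<in> carrier R" "e \<notin> I"
  shows "\<exists>u\<in>carrier R. \<one> \<ominus> e \<otimes> u \<in> I"
proof -
  interpret F: field "R Quot I" by (rule quotient_is_field[OF assms(1)])
  interpret h: ring_hom_ring R "R Quot I" "\<lambda>x. I +> x" by (rule rcos_ring_hom_ring)
  have "e \<ominus> \<zero> \<notin> I" using assms(2,3) by (simp add: a_minus_def)
  then have "I +> e \<noteq> \<zero>\<^bsub>R Quot I\<^esub>" using rcos_eq_iff[OF assms(2) zero_closed] h.hom_zero by simp
  then have "I +> e \<in> Units (R Quot I)" using h.hom_closed[OF assms(2)] F.field_Units by simp
  then obtain w where w: "w \<in> carrier (R Quot I)" "(I +> e) \<otimes>\<^bsub>R Quot I\<^esub> w = \<one>\<^bsub>R Quot I\<^esub>"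
    using F.Units_r_inv_ex by metis
  obtain u where u: "u \<in> carrier R" "w = I +> u" using carrier_quotientD[OF w(1)] by metis
  have "I +> \<one> = I +> e \<otimes> u" using w(2) h.hom_mult[OF assms(2) u(1)] h.hom_one u(2) by metis
  then show ?thesis using rcos_eq_iff[of "\<one>" "e \<otimes> u"] u(1) assms(2) by (intro bexI[of _ u]) auto
qed

lemma (in ideal) pow_diff_closed:
  assumes "cring R" "x \<in> carrier R" "y \<in> carrier R" "x \<ominus> y \<in> I"
  shows "x [^] (n::nat) \<ominus> y [^] n \<in> I"
proof (cases n)
  case 0
  then show ?thesis using zero_closed by (simp add: a_minus_def r_neg)
next
  case (Suc k)
  interpret cring R by fact
  show ?thesis
    using diff_pow_factor[OF is_ideal assms(2,3), of k] I_r_closed[OF assms(4)] unfolding Suc by auto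
qed

text \<open>If \<open>X \<equiv> Y\<close> modulo \<open>m\<close>, then multiplication by the cofactor of \<open>X - Y\<close> in \<open>X ^ p - Y ^ p\<close>, which lies in \<open>m\<close>,
  descends the composition series at every factor isomorphic to \<open>R / m\<close>; the other factors are killed by
  an element outside \<open>m\<close>.\<close>

lemma (in cring) pow_diff_annihilated:
  assumes m: "maximalideal m R" and p: "0 < p" "[(p::nat)] \<cdot> \<one> \<in> m"
    and "composition_series R gs"
  shows "\<exists>e\<in>carrier R. e \<notin> m \<and> (\<exists>s. \<forall>x\<in>carrier R. \<forall>y\<in>carrier R. x \<ominus> y \<in> m \<longrightarrow>
           (\<forall>z\<in>gen_ideal R gs. (e \<otimes> (x [^] (p ^ s) \<ominus> y [^] (p ^ s))) \<otimes> z = \<zero>))"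
  using assms(4)
proof (induction gs)
  case Nil
  interpret m: maximalideal m R by fact
  have "\<one> \<notin> m" using m.one_imp_carrier m.I_notcarr by blast
  then show ?case by (intro bexI[of _ \<one>]) auto
next
  case (Cons g gs)
  interpret m: maximalideal m R by fact
  interpret m: primeideal m R by (rule maximalideal_prime[OF m])
  have g: "g \<in> carrier R" "set gs \<subseteq> carrier R" "maximalideal (colon R gs g) R"
    using Cons.prems composition_series_carrier by auto
  interpret I: ideal "gen_ideal R gs" R by (rule ideal_gen_ideal[OF g(2)])
  obtain e and s :: nat where e: "e \<in> carrier R" "e \<notin> m" and "\<forall>x\<in>carrier R. \<forall>y\<in>carrier R. x \<ominus> y \<in> m \<longrightarrow>
      (\<forall>z\<in>gen_ideal R gs. (e \<otimes> (x [^] (p ^ s) \<ominus> y [^] (p ^ s))) \<otimes> z = \<zero>)"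
    using Cons.IH Cons.prems by auto
  note es = this(3)[rule_format]
  show ?case
  proof (cases "colon R gs g = m")
    case True
    \<comment> \<open>A factor isomorphic to \<open>R / m\<close> costs one more \<open>p\<close>-th
      power and keeps \<open>e\<close>.\<close>
    have "(e \<otimes> (x [^] (p ^ Suc s) \<ominus> y [^] (p ^ Suc s))) \<otimes> z = \<zero>"
      if xy: "x \<in> carrier R" "y \<in> carrier R" "x \<ominus> y \<in> m" and z: "z \<in> gen_ideal R (g # gs)" for x y z
    proof -
      obtain n where n: "p = Suc n" using p(1) by (cases p) auto
      let ?X = "x [^] (p ^ s)" and ?Y = "y [^] (p ^ s)"
      have X: "?X \<in> carrier R" "?Y \<in> carrier R" using xy by auto
      have XY: "?X \<ominus> ?Y \<in> m" by (rule m.pow_diff_closed[OF is_cring xy])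
      obtain t where t: "t \<in> carrier R" "?X [^] p \<ominus> ?Y [^] p = (?X \<ominus> ?Y) \<otimes> t" "t \<ominus> [p] \<cdot> (?X [^] n) \<in> m"
        using diff_pow_factor[OF m.is_ideal X, of n] XY unfolding n by blast
      have "[p] \<cdot> (?X [^] n) = ([p] \<cdot> \<one>) \<otimes> ?X [^] n" using add_pow_ldistr[of \<one> "?X [^] n" p] X by simp
      then have k: "[p] \<cdot> (?X [^] n) \<in> m" using m.I_r_closed[OF p(2)] X by simp
      have c: "[p] \<cdot> (?X [^] n) \<in> carrier R" using X by simp
      have "(t \<ominus> [p] \<cdot> (?X [^] n)) \<oplus> [p] \<cdot> (?X [^] n) \<in> m" by (rule m.a_closed[OF t(3) k])
      moreover have "(t \<ominus> [p] \<cdot> (?X [^] n)) \<oplus> [p] \<cdot> (?X [^] n) = t" using t(1) c by algebra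
      ultimately have gt: "g \<otimes> t \<in> gen_ideal R gs" using True by (auto simp: colon_def)
      obtain r v where r: "r \<in> carrier R" "v \<in> gen_ideal R gs" "z = g \<otimes> r \<oplus> v" using z by auto
      have v: "v \<in> carrier R" using r I.a_Hcarr by simp
      have pow: "x [^] (p ^ Suc s) = ?X [^] p" "y [^] (p ^ Suc s) = ?Y [^] p"
        using xy by (simp_all add: nat_pow_pow mult.commute)
      \<comment> \<open>Each product contains \<open>e \<otimes> (?X \<ominus> ?Y)\<close> together
        with an element of \<open>gen_ideal R gs\<close>, namely \<open>g \<otimes> t\<close> or
        \<open>v\<close>, and so vanishes by induction.\<close>
      have "(e \<otimes> (x [^] (p ^ Suc s) \<ominus> y [^] (p ^ Suc s))) \<otimes> z
          = ((e \<otimes> (?X \<ominus> ?Y)) \<otimes> (g \<otimes> t)) \<otimes> r \<oplus> ((e \<otimes> (?X \<ominus> ?Y)) \<otimes> v) \<otimes> t"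
        unfolding pow t(2) r(3) using X e(1) t(1) r(1) v g(1) by algebra
      also have "\<dots> = \<zero>" using es[OF xy gt] es[OF xy r(2)] r(1) t(1) by simp
      finally show ?thesis .
    qed
    then show ?thesis using e by (intro bexI[of _ e] conjI exI[of _ "Suc s"]) auto
  next
    case False
    have "\<not> colon R gs g \<subseteq> m"
    proof
      assume "colon R gs g \<subseteq> m"
      then have "m = carrier R" using maximalideal.I_maximal[OF g(3) m.is_ideal] False m.a_subset by auto
      then show False using m.I_notcarr by simp
    qed
    \<comment> \<open>Since \<open>u\<close> sends \<open>g\<close> into
      \<open>gen_ideal R gs\<close>, multiplying \<open>e\<close> by it disposes of this factor
      without a further power.\<close>
    then obtain u where u: "u \<in> carrier R" "g \<otimes> u \<in> gen_ideal R gs" "u \<notin> m" by (auto simp: colon_def)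
    have "((e \<otimes> u) \<otimes> (x [^] (p ^ s) \<ominus> y [^] (p ^ s))) \<otimes> z = \<zero>"
      if xy: "x \<in> carrier R" "y \<in> carrier R" "x \<ominus> y \<in> m" and z: "z \<in> gen_ideal R (g # gs)" for x y z
    proof -
      let ?X = "x [^] (p ^ s)" and ?Y = "y [^] (p ^ s)"
      have X: "?X \<in> carrier R" "?Y \<in> carrier R" using xy by auto
      obtain r v where r: "r \<in> carrier R" "v \<in> gen_ideal R gs" "z = g \<otimes> r \<oplus> v" using z by auto
      have v: "v \<in> carrier R" using r I.a_Hcarr by simp
      have "((e \<otimes> u) \<otimes> (?X \<ominus> ?Y)) \<otimes> z
          = ((e \<otimes> (?X \<ominus> ?Y)) \<otimes> (g \<otimes> u)) \<otimes> r \<oplus> ((e \<otimes> (?X \<ominus> ?Y)) \<otimes> v) \<otimes> u"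
        unfolding r(3) using X e(1) u(1) r(1) v g(1) by algebra
      also have "\<dots> = \<zero>" using es[OF xy u(2)] es[OF xy r(2)] r(1) u(1) by simp
      finally show ?thesis .
    qed
    moreover have "e \<otimes> u \<notin> m" using e u m.I_prime by blast
    ultimately show ?thesis using e u by (intro bexI[of _ "e \<otimes> u"] conjI exI[of _ s]) auto
  qed
qed

text \<open>Injectivity of Frobenius removes the outer power \<open>p ^ j\<close>, and additivity
  turns the rest into \<open>a \<otimes> (u \<ominus> v) [^] p = (z \<ominus> y) [^] p\<close>, so
  the quotient of \<open>z \<ominus> y\<close> by \<open>u \<ominus> v\<close> is a root. This makes
  cosets disjoint when \<open>a\<close> has no root.\<close>

lemma (in field) frobenius_collision_root:
  assumes p: "prime (p::nat)" "[p] \<cdot> \<one> = \<zero>"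
    and c: "a \<in> carrier R" "u \<in> carrier R" "v \<in> carrier R" "y \<in> carrier R" "z \<in> carrier R" and "u \<noteq> v"
    and e: "(a \<otimes> u [^] p) [^] (p ^ j) \<oplus> (y [^] p) [^] (p ^ j) = (a \<otimes> v [^] p) [^] (p ^ j) \<oplus> (z [^] p) [^] (p ^ j)"
  shows "\<exists>w\<in>carrier R. a = w [^] p"
proof -
  have cl: "u [^] p \<in> carrier R" "v [^] p \<in> carrier R" "y [^] p \<in> carrier R" "z [^] p \<in> carrier R" using c by auto
  have "(a \<otimes> u [^] p \<oplus> y [^] p) [^] (p ^ j) = (a \<otimes> v [^] p \<oplus> z [^] p) [^] (p ^ j)"
    using e frobenius_add[OF p, of "a \<otimes> u [^] p" "y [^] p" j] frobenius_add[OF p, of "a \<otimes> v [^] p" "z [^] p" j] c by simp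
  then have 1: "a \<otimes> u [^] p \<oplus> y [^] p = a \<otimes> v [^] p \<oplus> z [^] p"
    using frobenius_inj[OF p, of "a \<otimes> u [^] p \<oplus> y [^] p"] c by simp
  have "a \<otimes> (u [^] p \<ominus> v [^] p) = (a \<otimes> u [^] p \<oplus> y [^] p) \<ominus> y [^] p \<ominus> a \<otimes> v [^] p"
    using c(1) cl by algebra
  also have "\<dots> = z [^] p \<ominus> y [^] p" unfolding 1 using c(1) cl by algebra
  finally have 2: "a \<otimes> (u \<ominus> v) [^] p = (z \<ominus> y) [^] p"
    using frobenius_diff[OF p c(2,3), of 1] frobenius_diff[OF p c(5,4), of 1] by simp
  have uv: "u \<ominus> v \<in> Units R" using c(2,3) \<open>u \<noteq> v\<close> minus_eq_zero_iff[OF c(2,3)] by (simp add: field_Units)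
  let ?i = "inv (u \<ominus> v)"
  have i: "?i \<in> carrier R" "(u \<ominus> v) \<otimes> ?i = \<one>" using uv by auto
  have "((z \<ominus> y) \<otimes> ?i) [^] p = (z \<ominus> y) [^] p \<otimes> ?i [^] p" using c i by (simp add: nat_pow_distrib)
  also have "\<dots> = a \<otimes> ((u \<ominus> v) [^] p \<otimes> ?i [^] p)" unfolding 2[symmetric] using c i by (simp add: m_assoc)
  also have "(u \<ominus> v) [^] p \<otimes> ?i [^] p = \<one>" using c i nat_pow_distrib[of "u \<ominus> v" ?i p] by simp
  finally show ?thesis using c i by (intro bexI[of _ "(z \<ominus> y) \<otimes> ?i"]) auto
qed

text \<open>If \<open>a\<close> were not a \<open>p\<close>-th power modulo \<open>m\<close>, the preimages \<open>G j\<close> of the subfields of \<open>p ^ j\<close>-th powers of the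
  residue field would form a chain of subgroups each of infinite index in the one before.\<close>

lemma (in elementary_extension) residue_field_perfect:
  assumes inf: "\<And>m. maximalideal m R \<Longrightarrow> infinite (carrier (R Quot m))"
    and fin: "finite_morley_rank M"
    and vs: "set vs \<subseteq> carrier R" "g \<in> carrier R" and m: "maximalideal (colon R vs g) R"
    and p: "prime (p::nat)" "[p] \<cdot>\<^bsub>R\<^esub> \<one>\<^bsub>R\<^esub> \<in> colon R vs g" and a: "a \<in> carrier R"
  shows "\<exists>y\<in>carrier R. a \<ominus>\<^bsub>R\<^esub> y [^]\<^bsub>R\<^esub> p \<in> colon R vs g"
proof (rule ccontr)
  assume neg: "\<not> ?thesis"
  define m' where "m' = colon R vs g"
  interpret m: maximalideal m' R using m by (simp add: m'_def)
  define F where "F = R Quot m'"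
  interpret F: field F unfolding F_def by (rule m.quotient_is_field[OF R.is_cring])
  define h where "h = (\<lambda>x. m' +>\<^bsub>R\<^esub> x)"
  interpret h: ring_hom_ring R F h unfolding F_def h_def by (rule m.rcos_ring_hom_ring)
  have h_eq: "x \<ominus>\<^bsub>R\<^esub> y \<in> m' \<longleftrightarrow> h x = h y" if "x \<in> carrier R" "y \<in> carrier R" for x y
    using m.rcos_eq_iff[OF that] by (simp add: h_def)
  have h_surj: "\<exists>x\<in>carrier R. h x = w" if "w \<in> carrier F" for w
    using m.carrier_quotientD[of w] that by (auto simp: F_def h_def)
  have h_pow: "h (x [^]\<^bsub>R\<^esub> (n::nat)) = h x [^]\<^bsub>F\<^esub> n" if "x \<in> carrier R" for x n
    using h.hom_nat_pow[OF that] .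
  have h_mult: "h ([n] \<cdot>\<^bsub>R\<^esub> \<one>\<^bsub>R\<^esub>) = [n] \<cdot>\<^bsub>F\<^esub> \<one>\<^bsub>F\<^esub>" for n :: nat by (induction n) auto
  have "[p] \<cdot>\<^bsub>R\<^esub> \<one>\<^bsub>R\<^esub> \<ominus>\<^bsub>R\<^esub> \<zero>\<^bsub>R\<^esub> \<in> m'" using p(2) by (simp add: m'_def a_minus_def)
  then have pF: "[p] \<cdot>\<^bsub>F\<^esub> \<one>\<^bsub>F\<^esub> = \<zero>\<^bsub>F\<^esub>" using h_eq[of "[p] \<cdot>\<^bsub>R\<^esub> \<one>\<^bsub>R\<^esub>" "\<zero>\<^bsub>R\<^esub>"] h_mult by simp
  have noroot: "h a \<noteq> w [^]\<^bsub>F\<^esub> p" if "w \<in> carrier F" for w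
    using neg h_surj[OF that] h_eq[OF a] h_pow by (fastforce simp: m'_def)
  define G where "G = (\<lambda>j. {x\<in>carrier R. \<exists>y\<in>carrier R. x \<ominus>\<^bsub>R\<^esub> y [^]\<^bsub>R\<^esub> (p ^ j) \<in> colon R vs g})"
  define GM where "GM = (\<lambda>j. {x\<in>carrier M. \<exists>y\<in>carrier M. x \<ominus>\<^bsub>M\<^esub> y [^]\<^bsub>M\<^esub> (p ^ j) \<in> colon M (map f vs) (f g)})"
  have G_iff: "x \<in> G j \<longleftrightarrow> x \<in> carrier R \<and> (\<exists>y\<in>carrier R. h x = h y [^]\<^bsub>F\<^esub> (p ^ j))" for x j
    by (auto simp: G_def h_pow h_eq m'_def[symmetric])
  have G: "codef_set (carrier R) (G j) (GM j)" for j
  proof -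
    have "codef (carrier R) (\<lambda>v. v 0 \<ominus>\<^bsub>R\<^esub> v 1 [^]\<^bsub>R\<^esub> (p ^ j) \<in> colon R vs g) (\<lambda>v. v 0 \<ominus>\<^bsub>M\<^esub> v 1 [^]\<^bsub>M\<^esub> (p ^ j) \<in> colon M (map f vs) (f g))"
      by (intro codef_mem[OF codef_set_colon] coterm_intros vs order_refl)
    from codef_ex[OF this, of 1]
    have "codef (carrier R) (\<lambda>v. \<exists>y\<in>carrier R. v 0 \<ominus>\<^bsub>R\<^esub> y [^]\<^bsub>R\<^esub> (p ^ j) \<in> colon R vs g)
      (\<lambda>v. \<exists>y\<in>carrier M. v 0 \<ominus>\<^bsub>M\<^esub> y [^]\<^bsub>M\<^esub> (p ^ j) \<in> colon M (map f vs) (f g))" by simp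
    then show ?thesis by (rule codef_setI[rotated 2]) (auto simp: G_def GM_def)
  qed
  have "\<one>\<^bsub>R\<^esub> \<notin> m'" using m.one_imp_carrier m.I_notcarr by blast
  from R.infinite_index[OF inf m.is_ideal this]
  obtain r :: "nat \<Rightarrow> 'a" where r: "\<And>i. r i \<in> carrier R" "\<And>i k. i \<noteq> k \<Longrightarrow> r i \<ominus>\<^bsub>R\<^esub> r k \<notin> m'" by blast
  \<comment> \<open>For all \<open>j\<close> at once, because the rank of \<open>GM j\<close> is
    bounded from below through that of \<open>GM (Suc j)\<close>.\<close>
  have rank: "morley_ge_subset M n (GM j)" for n j
  proof (induction n arbitrary: j)
    case 0
    have "\<zero>\<^bsub>R\<^esub> \<in> G j"
      unfolding G_iff using prime_gt_0_nat[OF p(1)] by (auto intro!: bexI[of _ "\<zero>\<^bsub>R\<^esub>"] simp: F.nat_pow_zero)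
    then have "f \<zero>\<^bsub>R\<^esub> \<in> GM j"
      using codef_transfer[of "carrier R" "\<lambda>v. v 0 \<in> G j" "\<lambda>v. v 0 \<in> GM j" "\<lambda>_. \<zero>\<^bsub>R\<^esub>"] G[of j]
      by (auto simp: codef_set_def)
    then show ?case by auto
  next
    case (Suc n)
    \<comment> \<open>The residue of \<open>?c i\<close> is a \<open>p ^ j\<close>-th power. If two
      of these residues differed by a \<open>p ^ Suc j\<close>-th power, \<open>h a\<close> would
      have a \<open>p\<close>-th root.\<close>
    let ?c = "\<lambda>i. (a \<otimes>\<^bsub>R\<^esub> r i [^]\<^bsub>R\<^esub> p) [^]\<^bsub>R\<^esub> (p ^ j)"
    have hc: "h (?c i) = (h a \<otimes>\<^bsub>F\<^esub> h (r i) [^]\<^bsub>F\<^esub> p) [^]\<^bsub>F\<^esub> (p ^ j)" for i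
      using r(1) a by (simp add: h_pow)
    have pw: "w [^]\<^bsub>F\<^esub> (p ^ Suc j) = (w [^]\<^bsub>F\<^esub> p) [^]\<^bsub>F\<^esub> (p ^ j)" if "w \<in> carrier F" for w
      using that by (simp add: F.nat_pow_pow)
    show ?case
    proof (rule morley_ge_subset_chain[OF G G order_refl _ _ _ Suc.IH[of "Suc j"]])
      show "?c i \<in> carrier R" for i using r a by simp
      show "?c i \<oplus>\<^bsub>R\<^esub> x \<in> G j" if x: "x \<in> G (Suc j)" for i x
      proof -
        obtain y where y: "y \<in> carrier R" "x \<in> carrier R" "h x = h y [^]\<^bsub>F\<^esub> (p ^ Suc j)" using x G_iff by blast
        have "h (?c i \<oplus>\<^bsub>R\<^esub> x) = (h a \<otimes>\<^bsub>F\<^esub> h (r i) [^]\<^bsub>F\<^esub> p) [^]\<^bsub>F\<^esub> (p ^ j) \<oplus>\<^bsub>F\<^esub> (h y [^]\<^bsub>F\<^esub> p) [^]\<^bsub>F\<^esub> (p ^ j)"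
          using r(1)[of i] a y pw[of "h y"] hc[of i] by simp
        also have "\<dots> = (h a \<otimes>\<^bsub>F\<^esub> h (r i) [^]\<^bsub>F\<^esub> p \<oplus>\<^bsub>F\<^esub> h y [^]\<^bsub>F\<^esub> p) [^]\<^bsub>F\<^esub> (p ^ j)"
          using F.frobenius_add[OF p(1) pF, of "h a \<otimes>\<^bsub>F\<^esub> h (r i) [^]\<^bsub>F\<^esub> p" "h y [^]\<^bsub>F\<^esub> p" j] r(1)[of i] a y by simp
        also have "\<dots> = h (a \<otimes>\<^bsub>R\<^esub> r i [^]\<^bsub>R\<^esub> p \<oplus>\<^bsub>R\<^esub> y [^]\<^bsub>R\<^esub> p) [^]\<^bsub>F\<^esub> (p ^ j)"
          using r(1)[of i] a y by (simp add: h_pow)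
        finally show ?thesis unfolding G_iff
          using r(1)[of i] a y by (intro conjI bexI[of _ "a \<otimes>\<^bsub>R\<^esub> r i [^]\<^bsub>R\<^esub> p \<oplus>\<^bsub>R\<^esub> y [^]\<^bsub>R\<^esub> p"]) auto
      qed
      show "?c i \<oplus>\<^bsub>R\<^esub> x \<noteq> ?c k \<oplus>\<^bsub>R\<^esub> x'" if ik: "i \<noteq> k" and x: "x \<in> G (Suc j)" "x' \<in> G (Suc j)" for i k x x'
      proof
        assume e: "?c i \<oplus>\<^bsub>R\<^esub> x = ?c k \<oplus>\<^bsub>R\<^esub> x'"
        obtain y where y: "y \<in> carrier R" "x \<in> carrier R" "h x = h y [^]\<^bsub>F\<^esub> (p ^ Suc j)" using x(1) G_iff by blast
        obtain y' where y': "y' \<in> carrier R" "x' \<in> carrier R" "h x' = h y' [^]\<^bsub>F\<^esub> (p ^ Suc j)" using x(2) G_iff by blast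
        have "h (?c i) \<oplus>\<^bsub>F\<^esub> h x = h (?c k) \<oplus>\<^bsub>F\<^esub> h x'"
          using arg_cong[OF e, of h] r(1) a y y' by simp
        then have "(h a \<otimes>\<^bsub>F\<^esub> h (r i) [^]\<^bsub>F\<^esub> p) [^]\<^bsub>F\<^esub> (p ^ j) \<oplus>\<^bsub>F\<^esub> (h y [^]\<^bsub>F\<^esub> p) [^]\<^bsub>F\<^esub> (p ^ j)
          = (h a \<otimes>\<^bsub>F\<^esub> h (r k) [^]\<^bsub>F\<^esub> p) [^]\<^bsub>F\<^esub> (p ^ j) \<oplus>\<^bsub>F\<^esub> (h y' [^]\<^bsub>F\<^esub> p) [^]\<^bsub>F\<^esub> (p ^ j)"
          unfolding hc y(3) y'(3) using pw[of "h y"] pw[of "h y'"] y y' by simp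
        moreover have "h (r i) \<noteq> h (r k)" using r(2)[OF ik] h_eq[OF r(1) r(1)] by simp
        ultimately show False
          using F.frobenius_collision_root[OF p(1) pF, of "h a" "h (r i)" "h (r k)" "h y" "h y'" j]
            r(1) a y(1) y'(1) noroot by auto
      qed
    qed
  qed
  obtain n where "\<And>S. S \<subseteq> carrier M \<Longrightarrow> \<not> morley_ge_subset M n S" using finite_morley_rankD[OF fin] by blast
  then show False using rank[of n 0] by (auto simp: GM_def)
qed

section \<open>Lifting residue classes by powers\<close>

primrec lin_comb :: "('a, 'm) ring_scheme \<Rightarrow> ('a \<times> nat) list \<Rightarrow> 'a list \<Rightarrow> 'a" where
  "lin_comb R [] rs = \<zero>\<^bsub>R\<^esub>"
| "lin_comb R (h # hs) rs = fst h \<otimes>\<^bsub>R\<^esub> hd rs [^]\<^bsub>R\<^esub> snd h \<oplus>\<^bsub>R\<^esub> lin_comb R hs (tl rs)"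

text \<open>The pair \<open>h\<close> holds a coefficient and an exponent whose term in
  \<open>lin_comb\<close> is a function of the residue class. The maximal ideal is recorded by
  generators \<open>w\<close> rather than as a set, so that \<open>f\<close> can be applied to
  it.\<close>

definition lifts_residues :: "('a, 'm) ring_scheme \<Rightarrow> 'a \<times> nat \<Rightarrow> 'a list \<times> 'a \<Rightarrow> bool" where
  "lifts_residues R h w \<longleftrightarrow> fst h \<in> carrier R \<and> set (fst w) \<subseteq> carrier R \<and> snd w \<in> carrier R \<and>
     maximalideal (colon R (fst w) (snd w)) R \<and>
     (\<forall>x\<in>carrier R. \<forall>y\<in>carrier R. x \<ominus>\<^bsub>R\<^esub> y \<in> colon R (fst w) (snd w) \<longrightarrow>
        fst h \<otimes>\<^bsub>R\<^esub> x [^]\<^bsub>R\<^esub> snd h = fst h \<otimes>\<^bsub>R\<^esub> y [^]\<^bsub>R\<^esub> snd h)"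

context elementary_extension
begin

text \<open>Perfectness iterated: a root of a root, where \<open>pow_diff_closed\<close> preserves
  the second congruence under the outer power.\<close>

lemma residue_root:
  assumes inf: "\<And>m. maximalideal m R \<Longrightarrow> infinite (carrier (R Quot m))"
    and fin: "finite_morley_rank M"
    and vs: "set vs \<subseteq> carrier R" "g \<in> carrier R" and m: "maximalideal (colon R vs g) R"
    and p: "prime (p::nat)" "[p] \<cdot>\<^bsub>R\<^esub> \<one>\<^bsub>R\<^esub> \<in> colon R vs g" and a: "a \<in> carrier R"
  shows "\<exists>y\<in>carrier R. a \<ominus>\<^bsub>R\<^esub> y [^]\<^bsub>R\<^esub> (p ^ s) \<in> colon R vs g"
proof (induction s)
  case 0
  interpret m: maximalideal "colon R vs g" R by fact
  show ?case using a m.zero_closed by (intro bexI[of _ a]) (auto simp: a_minus_def R.r_neg)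
next
  case (Suc s)
  interpret m: maximalideal "colon R vs g" R by fact
  obtain y where y: "y \<in> carrier R" "a \<ominus>\<^bsub>R\<^esub> y [^]\<^bsub>R\<^esub> (p ^ s) \<in> colon R vs g" using Suc by auto
  obtain z where z: "z \<in> carrier R" "y \<ominus>\<^bsub>R\<^esub> z [^]\<^bsub>R\<^esub> p \<in> colon R vs g"
    using residue_field_perfect[OF inf fin vs m p y(1)] by auto
  let ?Y = "y [^]\<^bsub>R\<^esub> (p ^ s)" and ?Z = "(z [^]\<^bsub>R\<^esub> p) [^]\<^bsub>R\<^esub> (p ^ s)"
  have c: "?Y \<in> carrier R" "?Z \<in> carrier R" using y z by auto
  have "?Y \<ominus>\<^bsub>R\<^esub> ?Z \<in> colon R vs g"
    by (rule m.pow_diff_closed[OF R.is_cring _ _ z(2)]) (use y z in auto)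
  then have "(a \<ominus>\<^bsub>R\<^esub> ?Y) \<oplus>\<^bsub>R\<^esub> (?Y \<ominus>\<^bsub>R\<^esub> ?Z) \<in> colon R vs g" using y by (intro m.a_closed)
  also have "(a \<ominus>\<^bsub>R\<^esub> ?Y) \<oplus>\<^bsub>R\<^esub> (?Y \<ominus>\<^bsub>R\<^esub> ?Z) = a \<ominus>\<^bsub>R\<^esub> ?Z" using a c by algebra
  finally show ?case using z by (intro bexI[of _ z]) (auto simp: R.nat_pow_pow)
qed

text \<open>Factor and exponent of each coordinate are chosen against the whole ring, so that its
  term is constant on residue classes in \<open>R\<close> itself and not only modulo a lower ideal.
  The series \<open>gs\<close> is returned as well, because its last entry generates the minimal
  ideal used in the local case.\<close>

theorem exists_coordinates:
  assumes inf: "\<And>m. maximalideal m R \<Longrightarrow> infinite (carrier (R Quot m))"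
    and fin: "finite_morley_rank M" and pos: "positive_characteristic R"
  shows "\<exists>gs hs ws. composition_series R gs \<and> gen_ideal R gs = carrier R \<and> list_all2 (lifts_residues R) hs ws \<and>
     (\<forall>x\<in>carrier R. \<exists>rs. length rs = length hs \<and> set rs \<subseteq> carrier R \<and> x = lin_comb R hs rs)"
proof -
  obtain N where N: "0 < N" "[(N::nat)] \<cdot>\<^bsub>R\<^esub> \<one>\<^bsub>R\<^esub> = \<zero>\<^bsub>R\<^esub>" using pos by (auto simp: positive_characteristic_def)
  obtain n where n: "\<And>S. S \<subseteq> carrier M \<Longrightarrow> \<not> morley_ge_subset M n S" using finite_morley_rankD[OF fin] by blast
  have bound: "length gs < n" if gs: "strict_chain R gs" for gs
  proof (rule ccontr)
    assume "\<not> length gs < n"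
    \<comment> \<open>A suffix of length exactly \<open>n\<close>, the one rank that is known to be
      excluded.\<close>
    let ?gs = "drop (length gs - n) gs"
    have "strict_chain R ?gs" using gs R.strict_chain_appendD[of "take (length gs - n) gs" ?gs] by simp
    then have "morley_ge_subset M n (gen_ideal M (map f ?gs))"
      using morley_ge_strict_chain[OF inf, of ?gs] \<open>\<not> length gs < n\<close> by simp
    moreover have "gen_ideal M (map f ?gs) \<subseteq> carrier M"
      using R.strict_chain_carrier[OF \<open>strict_chain R ?gs\<close>] by (intro M.gen_ideal_subset) auto
    ultimately show False using n by blast
  qed
  obtain gs where gs: "composition_series R gs" "gen_ideal R gs = carrier R"
    using R.exists_composition_series[OF bound] by blast
  have lift: "\<exists>e\<in>carrier R. \<exists>q::nat. e \<notin> colon R vs g \<and>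
      (\<forall>x\<in>carrier R. \<forall>y\<in>carrier R. x \<ominus>\<^bsub>R\<^esub> y \<in> colon R vs g \<longrightarrow> e \<otimes>\<^bsub>R\<^esub> x [^]\<^bsub>R\<^esub> q = e \<otimes>\<^bsub>R\<^esub> y [^]\<^bsub>R\<^esub> q) \<and>
      (\<forall>a\<in>carrier R. \<exists>y\<in>carrier R. a \<ominus>\<^bsub>R\<^esub> y [^]\<^bsub>R\<^esub> q \<in> colon R vs g)"
    if vs: "set vs \<subseteq> carrier R" "g \<in> carrier R" and m: "maximalideal (colon R vs g) R" for vs g
  proof -
    obtain p :: nat where p: "prime p" "[p] \<cdot>\<^bsub>R\<^esub> \<one>\<^bsub>R\<^esub> \<in> colon R vs g"
      using R.exists_prime_in_maximalideal[OF m N] by auto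
    obtain e and s :: nat where e: "e \<in> carrier R" "e \<notin> colon R vs g" and
      "\<forall>x\<in>carrier R. \<forall>y\<in>carrier R. x \<ominus>\<^bsub>R\<^esub> y \<in> colon R vs g \<longrightarrow> (\<forall>z\<in>carrier R.
        (e \<otimes>\<^bsub>R\<^esub> (x [^]\<^bsub>R\<^esub> (p ^ s) \<ominus>\<^bsub>R\<^esub> y [^]\<^bsub>R\<^esub> (p ^ s))) \<otimes>\<^bsub>R\<^esub> z = \<zero>\<^bsub>R\<^esub>)"
      using R.pow_diff_annihilated[OF m prime_gt_0_nat[OF p(1)] p(2) gs(1)] gs(2) by auto
    note es = this(3)[rule_format]
    \<comment> \<open>The difference of the two sides annihilates all of \<open>R\<close>, in
      particular \<open>\<one>\<close>, and is therefore zero.\<close>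
    have "e \<otimes>\<^bsub>R\<^esub> x [^]\<^bsub>R\<^esub> (p ^ s) = e \<otimes>\<^bsub>R\<^esub> y [^]\<^bsub>R\<^esub> (p ^ s)"
      if xy: "x \<in> carrier R" "y \<in> carrier R" "x \<ominus>\<^bsub>R\<^esub> y \<in> colon R vs g" for x y
    proof -
      let ?X = "x [^]\<^bsub>R\<^esub> (p ^ s)" and ?Y = "y [^]\<^bsub>R\<^esub> (p ^ s)"
      have c: "?X \<in> carrier R" "?Y \<in> carrier R" using xy by auto
      have "e \<otimes>\<^bsub>R\<^esub> ?X \<ominus>\<^bsub>R\<^esub> e \<otimes>\<^bsub>R\<^esub> ?Y = (e \<otimes>\<^bsub>R\<^esub> (?X \<ominus>\<^bsub>R\<^esub> ?Y)) \<otimes>\<^bsub>R\<^esub> \<one>\<^bsub>R\<^esub>"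
        using c e(1) R.one_closed by algebra
      also have "\<dots> = \<zero>\<^bsub>R\<^esub>" using es[OF xy R.one_closed] .
      finally show ?thesis using R.minus_eq_zero_iff c e(1) by simp
    qed
    then show ?thesis using e residue_root[OF inf fin vs m p]
      by (intro bexI[of _ e] exI[of _ "p ^ s"]) auto
  qed
  have "\<exists>hs ws. list_all2 (lifts_residues R) hs ws \<and>
     (\<forall>x\<in>gen_ideal R vs. \<exists>rs. length rs = length hs \<and> set rs \<subseteq> carrier R \<and> x = lin_comb R hs rs)"
    if "composition_series R vs" for vs
    using that
  proof (induction vs)
    case Nil
    then show ?case by (intro exI[of _ "[]"]) auto
  next
    case (Cons g vs)
    obtain hs ws where IH: "list_all2 (lifts_residues R) hs ws"
     "\<And>x. x\<in>gen_ideal R vs \<Longrightarrow> \<exists>rs. length rs = length hs \<and> set rs \<subseteq> carrier R \<and> x = lin_comb R hs rs"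
      using Cons by auto
    have vs: "set vs \<subseteq> carrier R" "g \<in> carrier R" and m: "maximalideal (colon R vs g) R"
      using Cons.prems R.composition_series_carrier by auto
    interpret m: maximalideal "colon R vs g" R by fact
    interpret I: ideal "gen_ideal R vs" R by (rule R.ideal_gen_ideal[OF vs(1)])
    obtain e and q :: nat where "e \<in> carrier R" "e \<notin> colon R vs g"
      "\<forall>x\<in>carrier R. \<forall>y\<in>carrier R. x \<ominus>\<^bsub>R\<^esub> y \<in> colon R vs g \<longrightarrow> e \<otimes>\<^bsub>R\<^esub> x [^]\<^bsub>R\<^esub> q = e \<otimes>\<^bsub>R\<^esub> y [^]\<^bsub>R\<^esub> q"
      "\<forall>a\<in>carrier R. \<exists>y\<in>carrier R. a \<ominus>\<^bsub>R\<^esub> y [^]\<^bsub>R\<^esub> q \<in> colon R vs g"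
      using lift[OF vs m] by auto
    note e = this(1,2) this(3,4)[rule_format]
    have unit: "\<exists>u\<in>carrier R. \<one>\<^bsub>R\<^esub> \<ominus>\<^bsub>R\<^esub> e \<otimes>\<^bsub>R\<^esub> u \<in> colon R vs g"
      by (rule m.unit_modulo[OF R.is_cring e(1,2)])
    \<comment> \<open>The factor \<open>e\<close> is a unit modulo the maximal ideal, so the root is
      taken of \<open>a \<otimes> u\<close>, with \<open>u\<close> inverse to \<open>e\<close>
      there.\<close>
    have surj: "\<exists>y\<in>carrier R. a \<ominus>\<^bsub>R\<^esub> e \<otimes>\<^bsub>R\<^esub> y [^]\<^bsub>R\<^esub> q \<in> colon R vs g" if a: "a \<in> carrier R" for a
    proof -
      obtain u where u: "u \<in> carrier R" "\<one>\<^bsub>R\<^esub> \<ominus>\<^bsub>R\<^esub> e \<otimes>\<^bsub>R\<^esub> u \<in> colon R vs g" using unit by auto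
      obtain y where y: "y \<in> carrier R" "a \<otimes>\<^bsub>R\<^esub> u \<ominus>\<^bsub>R\<^esub> y [^]\<^bsub>R\<^esub> q \<in> colon R vs g" using e(4)[of "a \<otimes>\<^bsub>R\<^esub> u"] a u by auto
      have Y: "y [^]\<^bsub>R\<^esub> q \<in> carrier R" using y by simp
      have "a \<ominus>\<^bsub>R\<^esub> e \<otimes>\<^bsub>R\<^esub> y [^]\<^bsub>R\<^esub> q = a \<otimes>\<^bsub>R\<^esub> (\<one>\<^bsub>R\<^esub> \<ominus>\<^bsub>R\<^esub> e \<otimes>\<^bsub>R\<^esub> u) \<oplus>\<^bsub>R\<^esub> e \<otimes>\<^bsub>R\<^esub> (a \<otimes>\<^bsub>R\<^esub> u \<ominus>\<^bsub>R\<^esub> y [^]\<^bsub>R\<^esub> q)"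
        using a u(1) Y e(1) R.one_closed by algebra
      also have "\<dots> \<in> colon R vs g" using a u y e(1) by (intro m.a_closed m.I_l_closed) auto
      finally show ?thesis using y by auto
    qed
    let ?h = "(g \<otimes>\<^bsub>R\<^esub> e, q)"
    have "lifts_residues R ?h (vs, g)"
      using vs m e by (auto simp: lifts_residues_def R.m_assoc)
    moreover have "\<exists>rs. length rs = length (?h # hs) \<and> set rs \<subseteq> carrier R \<and> x = lin_comb R (?h # hs) rs"
      if x: "x \<in> gen_ideal R (g # vs)" for x
    proof -
      obtain a v where a: "a \<in> carrier R" "v \<in> gen_ideal R vs" "x = g \<otimes>\<^bsub>R\<^esub> a \<oplus>\<^bsub>R\<^esub> v" using x by auto
      have v: "v \<in> carrier R" using a I.a_Hcarr by simp
      obtain y where y: "y \<in> carrier R" "a \<ominus>\<^bsub>R\<^esub> e \<otimes>\<^bsub>R\<^esub> y [^]\<^bsub>R\<^esub> q \<in> colon R vs g" using surj[OF a(1)] by auto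
      let ?Y = "y [^]\<^bsub>R\<^esub> q"
      have Y: "?Y \<in> carrier R" using y by simp
      have "g \<otimes>\<^bsub>R\<^esub> (a \<ominus>\<^bsub>R\<^esub> e \<otimes>\<^bsub>R\<^esub> ?Y) \<in> gen_ideal R vs" using y(2) unfolding colon_def by blast
      then have "g \<otimes>\<^bsub>R\<^esub> (a \<ominus>\<^bsub>R\<^esub> e \<otimes>\<^bsub>R\<^esub> ?Y) \<oplus>\<^bsub>R\<^esub> v \<in> gen_ideal R vs" by (rule I.a_closed[OF _ a(2)])
      from IH(2)[OF this] obtain rs where rs: "length rs = length hs" "set rs \<subseteq> carrier R"
        "g \<otimes>\<^bsub>R\<^esub> (a \<ominus>\<^bsub>R\<^esub> e \<otimes>\<^bsub>R\<^esub> ?Y) \<oplus>\<^bsub>R\<^esub> v = lin_comb R hs rs" by metis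
      \<comment> \<open>Multiplication by \<open>g\<close> moves the error in approximating
        \<open>a\<close> into the lower ideal, where the remaining coordinates absorb it.\<close>
      have "x = (g \<otimes>\<^bsub>R\<^esub> e) \<otimes>\<^bsub>R\<^esub> ?Y \<oplus>\<^bsub>R\<^esub> (g \<otimes>\<^bsub>R\<^esub> (a \<ominus>\<^bsub>R\<^esub> e \<otimes>\<^bsub>R\<^esub> ?Y) \<oplus>\<^bsub>R\<^esub> v)"
        unfolding a(3) using a(1) v Y vs(2) e(1) by algebra
      then have "x = lin_comb R (?h # hs) (y # rs)" unfolding rs(3) by simp
      then show ?thesis using rs(1,2) y(1) by (intro exI[of _ "y # rs"]) simp
    qed
    ultimately have "list_all2 (lifts_residues R) (?h # hs) ((vs, g) # ws) \<and>
      (\<forall>x\<in>gen_ideal R (g # vs). \<exists>rs. length rs = length (?h # hs) \<and> set rs \<subseteq> carrier R \<and> x = lin_comb R (?h # hs) rs)"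
      using IH(1) unfolding list_all2_Cons by blast
    then show ?case by (rule_tac exI, rule_tac exI)
  qed
  then show ?thesis using gs by metis
qed

end

section \<open>Interpretable sets\<close>

definition lin_span :: "('a, 'm) ring_scheme \<Rightarrow> ('a \<times> nat) list \<Rightarrow> 'a set" where
  "lin_span R hs = {lin_comb R hs rs | rs. length rs = length hs \<and> set rs \<subseteq> carrier R}"

lemma lin_span_Nil [simp]: "lin_span R [] = {\<zero>\<^bsub>R\<^esub>}"
  by (auto simp: lin_span_def)

lemma lin_span_Cons:
  "lin_span R (h # hs) = {fst h \<otimes>\<^bsub>R\<^esub> r [^]\<^bsub>R\<^esub> snd h \<oplus>\<^bsub>R\<^esub> y | r y. r \<in> carrier R \<and> y \<in> lin_span R hs}"
proof (intro equalityI subsetI)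
  fix x assume "x \<in> lin_span R (h # hs)"
  then obtain rs where "length rs = Suc (length hs)" "set rs \<subseteq> carrier R" "x = lin_comb R (h # hs) rs"
    by (auto simp: lin_span_def)
  then show "x \<in> {fst h \<otimes>\<^bsub>R\<^esub> r [^]\<^bsub>R\<^esub> snd h \<oplus>\<^bsub>R\<^esub> y | r y. r \<in> carrier R \<and> y \<in> lin_span R hs}"
    by (cases rs) (auto simp: lin_span_def)
next
  fix x assume "x \<in> {fst h \<otimes>\<^bsub>R\<^esub> r [^]\<^bsub>R\<^esub> snd h \<oplus>\<^bsub>R\<^esub> y | r y. r \<in> carrier R \<and> y \<in> lin_span R hs}"
  then obtain r rs where r: "r \<in> carrier R" "length rs = length hs" "set rs \<subseteq> carrier R"
    "x = fst h \<otimes>\<^bsub>R\<^esub> r [^]\<^bsub>R\<^esub> snd h \<oplus>\<^bsub>R\<^esub> lin_comb R hs rs" by (auto simp: lin_span_def)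
  then have "x = lin_comb R (h # hs) (r # rs)" by simp
  then show "x \<in> lin_span R (h # hs)" unfolding lin_span_def using r(1-3) by (intro CollectI exI[of _ "r # rs"]) auto
qed

lemma (in cring) lin_comb_closed:
  "fst ` set hs \<subseteq> carrier R \<Longrightarrow> length rs = length hs \<Longrightarrow> set rs \<subseteq> carrier R \<Longrightarrow> lin_comb R hs rs \<in> carrier R"
proof (induction hs arbitrary: rs)
  case (Cons h hs)
  then show ?case by (cases rs) auto
qed simp

lemma (in cring) lin_span_subset: "fst ` set hs \<subseteq> carrier R \<Longrightarrow> lin_span R hs \<subseteq> carrier R"
  using lin_comb_closed by (auto simp: lin_span_def)

definition map_coeffs :: "('a \<Rightarrow> 'b) \<Rightarrow> ('a \<times> nat) list \<Rightarrow> ('b \<times> nat) list" where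
  "map_coeffs f hs = map (\<lambda>h. (f (fst h), snd h)) hs"

lemma map_coeffs_simps [simp]:
  "map_coeffs f [] = []" "map_coeffs f (h # hs) = (f (fst h), snd h) # map_coeffs f hs"
  "length (map_coeffs f hs) = length hs" "fst ` set (map_coeffs f hs) = f ` fst ` set hs"
  by (simp_all add: map_coeffs_def image_image)

lemma map_coeffs_id [simp]: "map_coeffs id hs = hs"
  by (simp add: map_coeffs_def)

definition subset_iset :: "'a set \<Rightarrow> 'a iset" where
  "subset_iset D = \<lparr>arity = 1, base = (\<lambda>x. [x]) ` D, eqrel = Id_on ((\<lambda>x. [x]) ` D)\<rparr>"

lemma universe_eq: "universe M = subset_iset (carrier M)"
  unfolding universe_def subset_iset_def tuples_1 ..

lemma points_subset_iset: "points (subset_iset D) = (\<lambda>x. {[x]}) ` D"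
  by (auto simp: points_def subset_iset_def quotient_def)

lemma graph_pairs: "graph {([x], [y]) | x y. P x y} = {[x, y] | x y. P x y}"
proof
  show "{[x, y] | x y. P x y} \<subseteq> graph {([x], [y]) | x y. P x y}"
  proof
    fix zs assume "zs \<in> {[x, y] | x y. P x y}"
    then obtain x y where xy: "zs = [x] @ [y]" "P x y" by auto
    then have "([x], [y]) \<in> {([x], [y]) | x y. P x y}" by blast
    then show "zs \<in> graph {([x], [y]) | x y. P x y}" unfolding graph_def xy(1) by blast
  qed
qed (auto simp: graph_def)

lemma Id_on_singletons: "Id_on ((\<lambda>x. [x]) ` T) = {([x], [y]) | x y. x = y \<and> x \<in> T}"
  by auto

lemma tuples_2: "tuples M 2 = {[x, y] | x y. x \<in> carrier M \<and> y \<in> carrier M}"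
  by (auto simp: tuples_def numeral_2_eq_2 length_Suc_conv)

lemma listset_iff: "ys \<in> listset es \<longleftrightarrow> list_all2 (\<in>) ys es"
  by (induction es arbitrary: ys) (auto simp: set_Cons_def list_all2_Cons2)

context elementary_extension
begin

lemma codef_set_lin_span:
  assumes "fst ` set hs \<subseteq> A" "A \<subseteq> carrier R"
  shows "codef_set A (lin_span R hs) (lin_span M (map_coeffs f hs))"
  using assms(1)
proof (induction hs)
  case Nil
  have "codef A (\<lambda>v. v 0 = \<zero>\<^bsub>R\<^esub>) (\<lambda>v. v 0 = \<zero>\<^bsub>M\<^esub>)" by (intro codef_eq coterm_intros)
  then show ?case by (simp add: codef_set_def)
next
  case (Cons h hs)
  let ?I = "lin_span R hs" and ?J = "lin_span M (map_coeffs f hs)"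
  have IH: "codef_set A ?I ?J" by (rule Cons.IH) (use Cons.prems in auto)
  have h: "fst h \<in> A" using Cons.prems by auto
  have c: "codef A (\<lambda>v. \<exists>r\<in>carrier R. \<exists>y\<in>carrier R. y \<in> ?I \<and> v 0 = fst h \<otimes>\<^bsub>R\<^esub> r [^]\<^bsub>R\<^esub> snd h \<oplus>\<^bsub>R\<^esub> y)
     (\<lambda>v. \<exists>r\<in>carrier M. \<exists>y\<in>carrier M. y \<in> ?J \<and> v 0 = f (fst h) \<otimes>\<^bsub>M\<^esub> r [^]\<^bsub>M\<^esub> snd h \<oplus>\<^bsub>M\<^esub> y)"
  proof -
    have "codef A (\<lambda>v. v 2 \<in> ?I \<and> v 0 = fst h \<otimes>\<^bsub>R\<^esub> v 1 [^]\<^bsub>R\<^esub> snd h \<oplus>\<^bsub>R\<^esub> v 2)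
        (\<lambda>v. v 2 \<in> ?J \<and> v 0 = f (fst h) \<otimes>\<^bsub>M\<^esub> v 1 [^]\<^bsub>M\<^esub> snd h \<oplus>\<^bsub>M\<^esub> v 2)"
      by (intro codef_and codef_eq codef_mem[OF IH] coterm_intros assms(2) h)
    from codef_ex[OF codef_ex[OF this, of 2], of 1] show ?thesis by simp
  qed
  have sub: "?I \<subseteq> carrier R" "?J \<subseteq> carrier M" using IH by (auto simp: codef_set_def)
  have hs: "fst ` set (h # hs) \<subseteq> carrier R" using Cons.prems assms(2) by (rule order_trans)
  then have "fst ` set (map_coeffs f (h # hs)) \<subseteq> carrier M" unfolding map_coeffs_simps(4) using f_closed by blast
  then have cl: "lin_span R (h # hs) \<subseteq> carrier R" "lin_span M (map_coeffs f (h # hs)) \<subseteq> carrier M"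
    using R.lin_span_subset[OF hs] M.lin_span_subset by blast+
  show ?case
  proof (rule codef_setI[OF cl c])
    show "v 0 \<in> lin_span R (h # hs) \<longleftrightarrow> (\<exists>r\<in>carrier R. \<exists>y\<in>carrier R. y \<in> ?I \<and> v 0 = fst h \<otimes>\<^bsub>R\<^esub> r [^]\<^bsub>R\<^esub> snd h \<oplus>\<^bsub>R\<^esub> y)"
      for v unfolding lin_span_Cons using sub(1) by blast
    show "v 0 \<in> lin_span M (map_coeffs f (h # hs)) \<longleftrightarrow>
        (\<exists>r\<in>carrier M. \<exists>y\<in>carrier M. y \<in> ?J \<and> v 0 = f (fst h) \<otimes>\<^bsub>M\<^esub> r [^]\<^bsub>M\<^esub> snd h \<oplus>\<^bsub>M\<^esub> y)"
      for v unfolding map_coeffs_simps lin_span_Cons fst_conv snd_conv using sub(2) by blast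
  qed
qed

lemma coterm_lin_comb:
  "fst ` set hs \<subseteq> A \<Longrightarrow> length js = length hs \<Longrightarrow>
   coterm A (\<lambda>v. lin_comb R hs (map v js)) (\<lambda>v. lin_comb M (map_coeffs f hs) (map v js))"
proof (induction hs arbitrary: js)
  case Nil
  then show ?case by (simp add: coterm_zero)
next
  case (Cons h hs)
  then obtain j js' where js: "js = j # js'" "length js' = length hs" by (cases js) auto
  show ?case using Cons js by (auto intro!: coterm_intros)
qed

lemma codef_interpretable_subset_iset:
  assumes "codef_set A S T" "A \<subseteq> carrier R"
  shows "interpretable M (f ` A) (subset_iset T)"
proof -
  have T: "T \<subseteq> carrier M" using assms by (auto simp: codef_set_def)
  have c: "codef A (\<lambda>v. v 0 = v 1 \<and> v 0 \<in> S) (\<lambda>v. v 0 = v 1 \<and> v 0 \<in> T)"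
    by (intro codef_and codef_eq coterm_intros codef_mem[OF assms(1)] assms(2))
  have "{xs\<in>tuples M 2. asg M xs 0 = asg M xs 1 \<and> asg M xs 0 \<in> T} = graph (Id_on ((\<lambda>x. [x]) ` T))"
    using T unfolding Id_on_singletons graph_pairs by (auto simp: tuples_2 asg_def)
  then have "definable M (f ` A) 2 (graph (Id_on ((\<lambda>x. [x]) ` T)))"
    using codef_definable[OF c assms(2), of 2] by simp
  then show ?thesis using codef_set_definable[OF assms]
    by (auto simp: interpretable_def subset_iset_def numeral_2_eq_2 equiv_def refl_on_def sym_def trans_def Id_on_def)
qed

text \<open>\<open>residue_iset\<close> depends on its ideal only through the congruence
  \<open>x \<ominus> y \<in> m\<close>, so a formula common to \<open>m\<close> and
  \<open>m'\<close> carries the whole quotient over. For the second part, an ideal \<open>m'\<close>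
  makes the congruence in \<open>M\<close> an equivalence relation.\<close>

lemma extend_residue_iset:
  assumes "codef_set A m m'" "A \<subseteq> carrier R"
  shows "extend_iset R M f (residue_iset R m) = residue_iset M m'"
    and "ideal m' M \<Longrightarrow> interpretable M (f ` A) (residue_iset M m')"
proof -
  have c: "codef A (\<lambda>v. v 0 \<ominus>\<^bsub>R\<^esub> v 1 \<in> m) (\<lambda>v. v 0 \<ominus>\<^bsub>M\<^esub> v 1 \<in> m')"
    by (intro codef_mem[OF assms(1)] coterm_intros assms(2))
  have g: "graph {([x], [y]) | x y. x \<in> carrier N \<and> y \<in> carrier N \<and> x \<ominus>\<^bsub>N\<^esub> y \<in> k}
      = {xs\<in>tuples N 2. asg N xs 0 \<ominus>\<^bsub>N\<^esub> asg N xs 1 \<in> k}" for k and N :: "('c, 'd) ring_scheme"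
    unfolding graph_pairs by (auto simp: tuples_2 asg_def)
  have b: "extend_set R M f 1 (tuples R 1) = tuples M 1"
    using extend_set_codef[OF codef_True, of A 1] assms(2) by simp
  have e: "extend_set R M f 2 (graph {([x], [y]) | x y. x \<in> carrier R \<and> y \<in> carrier R \<and> x \<ominus>\<^bsub>R\<^esub> y \<in> m})
     = graph {([x], [y]) | x y. x \<in> carrier M \<and> y \<in> carrier M \<and> x \<ominus>\<^bsub>M\<^esub> y \<in> m'}"
    unfolding g by (rule extend_set_codef[OF c assms(2)])
  have l: "{(xs, ys). length xs = 1 \<and> length ys = 1 \<and> xs @ ys \<in> graph {([x], [y]) | x y. x \<in> carrier M \<and> y \<in> carrier M \<and> x \<ominus>\<^bsub>M\<^esub> y \<in> m'}}
     = {([x], [y]) | x y. x \<in> carrier M \<and> y \<in> carrier M \<and> x \<ominus>\<^bsub>M\<^esub> y \<in> m'}"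
    unfolding graph_pairs by (auto simp: length_Suc_conv)
  show "extend_iset R M f (residue_iset R m) = residue_iset M m'"
    using b e l by (simp add: extend_iset_def residue_iset_def)
  show "interpretable M (f ` A) (residue_iset M m')" if "ideal m' M"
  proof -
    interpret m': ideal m' M by fact
    have "definable M (f ` A) 1 (tuples M 1)" using codef_definable[OF codef_True assms(2), of 1] by simp
    moreover have "definable M (f ` A) 2 (graph {([x], [y]) | x y. x \<in> carrier M \<and> y \<in> carrier M \<and> x \<ominus>\<^bsub>M\<^esub> y \<in> m'})"
      using codef_definable[OF c assms(2), of 2] unfolding g .
    moreover have "equiv (tuples M 1) {([x], [y]) | x y. x \<in> carrier M \<and> y \<in> carrier M \<and> x \<ominus>\<^bsub>M\<^esub> y \<in> m'}"
    proof (rule equivI)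
      show "{([x], [y]) | x y. x \<in> carrier M \<and> y \<in> carrier M \<and> x \<ominus>\<^bsub>M\<^esub> y \<in> m'} \<subseteq> tuples M 1 \<times> tuples M 1"
        unfolding tuples_1 by auto
      show "refl_on (tuples M 1) {([x], [y]) | x y. x \<in> carrier M \<and> y \<in> carrier M \<and> x \<ominus>\<^bsub>M\<^esub> y \<in> m'}"
        unfolding tuples_1 by (auto intro!: refl_onI simp: a_minus_def M.r_neg)
      show "sym {([x], [y]) | x y. x \<in> carrier M \<and> y \<in> carrier M \<and> x \<ominus>\<^bsub>M\<^esub> y \<in> m'}"
      proof (rule symI)
        fix xs ys assume "(xs, ys) \<in> {([x], [y]) | x y. x \<in> carrier M \<and> y \<in> carrier M \<and> x \<ominus>\<^bsub>M\<^esub> y \<in> m'}"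
        then obtain x y where xy: "xs = [x]" "ys = [y]" "x \<in> carrier M" "y \<in> carrier M" "x \<ominus>\<^bsub>M\<^esub> y \<in> m'" by auto
        have "y \<ominus>\<^bsub>M\<^esub> x = \<ominus>\<^bsub>M\<^esub> (x \<ominus>\<^bsub>M\<^esub> y)" using xy(3,4) by algebra
        then have "y \<ominus>\<^bsub>M\<^esub> x \<in> m'" using m'.a_inv_closed[OF xy(5)] by simp
        then show "(ys, xs) \<in> {([x], [y]) | x y. x \<in> carrier M \<and> y \<in> carrier M \<and> x \<ominus>\<^bsub>M\<^esub> y \<in> m'}" using xy by auto
      qed
      show "trans {([x], [y]) | x y. x \<in> carrier M \<and> y \<in> carrier M \<and> x \<ominus>\<^bsub>M\<^esub> y \<in> m'}"
      proof (rule transI)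
        fix xs ys zs assume "(xs, ys) \<in> {([x], [y]) | x y. x \<in> carrier M \<and> y \<in> carrier M \<and> x \<ominus>\<^bsub>M\<^esub> y \<in> m'}"
          "(ys, zs) \<in> {([x], [y]) | x y. x \<in> carrier M \<and> y \<in> carrier M \<and> x \<ominus>\<^bsub>M\<^esub> y \<in> m'}"
        then obtain x y z where xy: "xs = [x]" "zs = [z]" "x \<in> carrier M" "y \<in> carrier M" "z \<in> carrier M"
          "x \<ominus>\<^bsub>M\<^esub> y \<in> m'" "y \<ominus>\<^bsub>M\<^esub> z \<in> m'" by auto
        have "x \<ominus>\<^bsub>M\<^esub> z = (x \<ominus>\<^bsub>M\<^esub> y) \<oplus>\<^bsub>M\<^esub> (y \<ominus>\<^bsub>M\<^esub> z)" using xy(3-5) by algebra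
        then have "x \<ominus>\<^bsub>M\<^esub> z \<in> m'" using m'.a_closed[OF xy(6,7)] by simp
        then show "(xs, zs) \<in> {([x], [y]) | x y. x \<in> carrier M \<and> y \<in> carrier M \<and> x \<ominus>\<^bsub>M\<^esub> y \<in> m'}" using xy by auto
      qed
    qed
    ultimately show ?thesis by (simp add: interpretable_def residue_iset_def)
  qed
qed

text \<open>The two conditions on \<open>es\<close> and \<open>Q\<close> say that every choice of
  representatives of \<open>es\<close> admits at most \<open>x\<close> and that some choice admits
  it, so the fibre is the single point \<open>{[x]}\<close>.\<close>

lemma algebraic_over_universeI:
  assumes c: "codef A (\<lambda>v. P (v 0) (map v [1..<Suc n])) (\<lambda>v. Q (v 0) (map v [1..<Suc n]))" and A: "A \<subseteq> carrier R"
    and x: "x \<in> carrier M"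
    and es: "length es = n" "\<And>ys. ys \<in> listset es \<Longrightarrow> \<exists>rs. ys = map (\<lambda>r. [r]) rs \<and> set rs \<subseteq> carrier M \<and> (\<forall>y\<in>carrier M. Q y rs \<longrightarrow> y = x)"
      "\<exists>rs. map (\<lambda>r. [r]) rs \<in> listset es \<and> Q x rs"
  shows "algebraic_over M (f ` A) (universe M) es {[x]}"
proof -
  \<comment> \<open>Entry 0 is the element of the universe, and entries 1 to \<open>n\<close> are
    representatives of the points in \<open>es\<close>.\<close>
  let ?Z = "{xs\<in>tuples M (Suc n). Q (asg M xs 0) (map (asg M xs) [1..<Suc n])}"
  have def: "definable M (f ` A) (Suc n) ?Z" by (rule codef_definable[OF c A])
  have m: "map (asg M (y # rs)) [1..<Suc n] = rs" if "length rs = n" for y rs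
    using that by (auto simp: list_eq_iff_nth_eq asg_def simp del: upt_Suc)
  have len: "length ys = n" if "ys \<in> listset es" for ys
    using that es(1) list_all2_lengthD unfolding listset_iff by metis
  have cc: "concat (map (\<lambda>r. [r]) rs) = rs" for rs :: "'b list" by (induction rs) auto
  have Z: "[y] @ concat ys \<in> ?Z \<longleftrightarrow> y \<in> carrier M \<and> Q y rs"
    if "ys \<in> listset es" "ys = map (\<lambda>r. [r]) rs" "set rs \<subseteq> carrier M" for y ys rs
    using that m[of rs y] len[OF that(1)] by (auto simp: cc tuples_def asg_def simp del: upt_Suc)
  have "rel_fibre (universe M) es ?Z \<subseteq> {{[x]}}"
  proof
    fix c assume "c \<in> rel_fibre (universe M) es ?Z"
    then obtain y ys where y: "y \<in> carrier M" "c = {[y]}" "ys \<in> listset es" "[y] @ concat ys \<in> ?Z"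
      by (auto simp: rel_fibre_def universe_eq points_subset_iset)
    obtain rs where rs: "ys = map (\<lambda>r. [r]) rs" "set rs \<subseteq> carrier M" "\<forall>y\<in>carrier M. Q y rs \<longrightarrow> y = x"
      using es(2)[OF y(3)] by blast
    then show "c \<in> {{[x]}}" using Z[OF y(3) rs(1,2), of y] y by simp
  qed
  moreover have "{[x]} \<in> rel_fibre (universe M) es ?Z"
  proof -
    obtain rs where rs: "map (\<lambda>r. [r]) rs \<in> listset es" "Q x rs" using es(3) by blast
    have "set rs \<subseteq> carrier M"
    proof -
      obtain rs' where "map (\<lambda>r. [r]) rs = map (\<lambda>r. [r]) rs'" "set rs' \<subseteq> carrier M" using es(2)[OF rs(1)] by blast
      moreover from this(1) have "rs = rs'" using cc by metis
      ultimately show ?thesis by simp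
    qed
    then have "[x] @ concat (map (\<lambda>r. [r]) rs) \<in> ?Z" using Z[OF rs(1) refl] x rs(2) by simp
    then show ?thesis using rs(1) x unfolding rel_fibre_def universe_eq points_subset_iset by blast
  qed
  ultimately show ?thesis unfolding algebraic_over_def using def finite_subset by blast
qed

end

section \<open>Coding by a strongly minimal set\<close>

primrec lin_image :: "('a, 'm) ring_scheme \<Rightarrow> 'a set \<Rightarrow> 'a list \<Rightarrow> 'a set" where
  "lin_image M D [] = {\<zero>\<^bsub>M\<^esub>}"
| "lin_image M D (t # ts) = {t \<otimes>\<^bsub>M\<^esub> d \<oplus>\<^bsub>M\<^esub> s | d s. d \<in> D \<and> s \<in> lin_image M D ts}"

text \<open>Injectivity of the linear map on tuples from \<open>D\<close>, one coordinate at a time: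
  once \<open>d = d'\<close>, cancellation gives \<open>s = s'\<close> and the clause for
  \<open>ts\<close> takes over.\<close>

primrec independent_over :: "('a, 'm) ring_scheme \<Rightarrow> 'a set \<Rightarrow> 'a list \<Rightarrow> bool" where
  "independent_over M D [] \<longleftrightarrow> True"
| "independent_over M D (t # ts) \<longleftrightarrow> t \<in> carrier M \<and> independent_over M D ts \<and>
     (\<forall>d\<in>D. \<forall>d'\<in>D. \<forall>s\<in>lin_image M D ts. \<forall>s'\<in>lin_image M D ts.
        t \<otimes>\<^bsub>M\<^esub> d \<oplus>\<^bsub>M\<^esub> s = t \<otimes>\<^bsub>M\<^esub> d' \<oplus>\<^bsub>M\<^esub> s' \<longrightarrow> d = d')"

text \<open>\<open>ds\<close> consists of \<open>d, d'\<close> and two tuples of the length of \<open>ts\<close>; the equation determines \<open>r\<close>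
  modulo the annihilator of \<open>d - d'\<close>.\<close>

definition codes :: "('a, 'm) ring_scheme \<Rightarrow> 'a list \<Rightarrow> 'a \<Rightarrow> 'a list \<Rightarrow> bool" where
  "codes M ts r ds \<longleftrightarrow> ds ! 0 \<noteq> ds ! 1 \<and>
     r \<otimes>\<^bsub>M\<^esub> ds ! 0 \<oplus>\<^bsub>M\<^esub> lin_comb M (map (\<lambda>t. (t, 1)) ts) (take (length ts) (drop 2 ds)) =
     r \<otimes>\<^bsub>M\<^esub> ds ! 1 \<oplus>\<^bsub>M\<^esub> lin_comb M (map (\<lambda>t. (t, 1)) ts) (take (length ts) (drop (2 + length ts) ds))"

text \<open>Each coefficient uses up one block of \<open>2 + 2 * length ts\<close> entries. A block
  fixes \<open>r\<close> only modulo an annihilator, so \<open>r\<close> is quantified away and just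
  its term is to be recovered.\<close>

primrec codes_comb :: "('a, 'm) ring_scheme \<Rightarrow> 'a list \<Rightarrow> ('a \<times> nat) list \<Rightarrow> 'a \<Rightarrow> 'a list \<Rightarrow> bool" where
  "codes_comb M ts [] x ds \<longleftrightarrow> x = \<zero>\<^bsub>M\<^esub>"
| "codes_comb M ts (h # hs) x ds \<longleftrightarrow> (\<exists>r\<in>carrier M. \<exists>y\<in>carrier M. x = fst h \<otimes>\<^bsub>M\<^esub> r [^]\<^bsub>M\<^esub> snd h \<oplus>\<^bsub>M\<^esub> y \<and>
     codes M ts r ds \<and> codes_comb M ts hs y (drop (2 + 2 * length ts) ds))"

lemma (in ideal) ideal_eq_residue_class:
  assumes "x \<in> carrier R"
  shows "eqrel (residue_iset R I) `` {[x]} = {[y] | y. y \<in> carrier R \<and> x \<ominus> y \<in> I}"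
  using assms by (auto simp: residue_iset_def)

context cring
begin

interpretation self: elementary_extension R R id
  by (rule elementary_extension_id)

lemma gen_ideal_singleton: "g \<in> carrier R \<Longrightarrow> gen_ideal R [g] = {g \<otimes> a | a. a \<in> carrier R}"
  using gen_ideal_head[of "[]" g] by (auto simp del: gen_ideal.simps) (auto simp: gen_ideal.simps)

lemma lin_image_subset:
  "D \<subseteq> carrier R \<Longrightarrow> set ts \<subseteq> carrier R \<Longrightarrow> lin_image R D ts \<subseteq> carrier R"
  by (induction ts) auto

lemma lin_image_lin_comb:
  assumes "s \<in> lin_image R D ts" "D \<subseteq> carrier R" "set ts \<subseteq> carrier R"
  shows "\<exists>ds. length ds = length ts \<and> set ds \<subseteq> D \<and> s = lin_comb R (map (\<lambda>t. (t, 1)) ts) ds"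
  using assms
proof (induction ts arbitrary: s)
  case (Cons t ts)
  then obtain d s' where d: "d \<in> D" "s' \<in> lin_image R D ts" "s = t \<otimes> d \<oplus> s'" by auto
  obtain ds where ds: "length ds = length ts" "set ds \<subseteq> D" "s' = lin_comb R (map (\<lambda>t. (t, 1)) ts) ds"
    using Cons.IH[OF d(2)] Cons.prems by auto
  have "d \<in> carrier R" using d Cons.prems by auto
  then show ?case using d ds by (intro exI[of _ "d # ds"]) auto
qed simp

lemma independent_over_carrier: "independent_over R D ts \<Longrightarrow> set ts \<subseteq> carrier R"
  by (induction ts) auto

lemma codef_set_lin_image:
  assumes D: "self.codef_set (carrier R) D D" and "set ts \<subseteq> carrier R"
  shows "self.codef_set (carrier R) (lin_image R D ts) (lin_image R D ts)"
  using assms(2)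
proof (induction ts)
  case Nil
  have "self.codef (carrier R) (\<lambda>v. v 0 = \<zero>) (\<lambda>v. v 0 = \<zero>)"
    by (intro self.codef_eq self.coterm_intros)
  then show ?case by (rule self.codef_setI[rotated 2]) auto
next
  case (Cons t ts)
  let ?S = "lin_image R D ts"
  have IH: "self.codef_set (carrier R) ?S ?S" by (rule Cons.IH) (use Cons.prems in auto)
  have t: "t \<in> carrier R" using Cons.prems by auto
  have sub: "D \<subseteq> carrier R" "?S \<subseteq> carrier R" using D IH by (auto simp: self.codef_set_def)
  have "self.codef (carrier R) (\<lambda>v. v 1 \<in> D \<and> v 2 \<in> ?S \<and> v 0 = t \<otimes> v 1 \<oplus> v 2)
      (\<lambda>v. v 1 \<in> D \<and> v 2 \<in> ?S \<and> v 0 = id t \<otimes> v 1 \<oplus> v 2)"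
    by (intro self.codef_and self.codef_eq self.codef_mem[OF IH] self.codef_mem[OF D] self.coterm_intros t order_refl)
  from self.codef_ex[OF self.codef_ex[OF this, of 2], of 1]
  have c: "self.codef (carrier R) (\<lambda>v. \<exists>d\<in>carrier R. \<exists>s\<in>carrier R. d \<in> D \<and> s \<in> ?S \<and> v 0 = t \<otimes> d \<oplus> s)
      (\<lambda>v. \<exists>d\<in>carrier R. \<exists>s\<in>carrier R. d \<in> D \<and> s \<in> ?S \<and> v 0 = t \<otimes> d \<oplus> s)" by simp
  have T: "lin_image R D (t # ts) \<subseteq> carrier R" by (rule lin_image_subset[OF sub(1) Cons.prems])
  have e: "x \<in> lin_image R D (t # ts) \<longleftrightarrow> (\<exists>d\<in>carrier R. \<exists>s\<in>carrier R. d \<in> D \<and> s \<in> ?S \<and> x = t \<otimes> d \<oplus> s)" for x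
    unfolding lin_image.simps using sub by blast
  show ?case by (rule self.codef_setI[OF T T c]) (simp_all only: e)
qed

text \<open>Infinitely many \<open>d\<close> in \<open>D\<close> give translates of
  \<open>lin_image R D ts\<close> by \<open>t \<otimes> d\<close>, disjoint by independence, so each
  entry of the tuple adds one to the rank.\<close>

lemma morley_ge_independent_over:
  assumes D: "definable_subset R D" "infinite D" and "independent_over R D ts"
  shows "morley_ge_subset R (length ts) (lin_image R D ts)"
  using assms(3)
proof (induction ts)
  case (Cons t ts)
  have D': "self.codef_set (carrier R) D D" using D(1) by (simp add: definable_subset_iff_codef)
  have ts: "set ts \<subseteq> carrier R" "t \<in> carrier R" using Cons.prems independent_over_carrier by auto
  obtain d :: "nat \<Rightarrow> 'a" where d: "inj d" "range d \<subseteq> D" using infinite_countable_subset[OF D(2)] by blast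
  have dD: "d i \<in> D" for i using d(2) by auto
  have DR: "D \<subseteq> carrier R" using D(1) by (simp add: definable_subset_def)
  have IH: "morley_ge_subset R (length ts) (lin_image R D ts)" using Cons by simp
  show ?case unfolding length_Cons
  proof (rule self.morley_ge_subset_chain[OF _ _ order_refl _ _ _ IH])
    show "self.codef_set (carrier R) (lin_image R D ts) (lin_image R D ts)"
      by (rule codef_set_lin_image[OF D' ts(1)])
    show "self.codef_set (carrier R) (lin_image R D (t # ts)) (lin_image R D (t # ts))"
      by (rule codef_set_lin_image[OF D']) (use ts in simp)
    show "t \<otimes> d i \<in> carrier R" for i using ts dD[of i] DR by auto
    show "t \<otimes> d i \<oplus> x \<in> lin_image R D (t # ts)" if "x \<in> lin_image R D ts" for i x
      using that dD by auto
    show "t \<otimes> d i \<oplus> x \<noteq> t \<otimes> d j \<oplus> y"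
      if ij: "i \<noteq> j" and xy: "x \<in> lin_image R D ts" "y \<in> lin_image R D ts" for i j x y
    proof
      assume "t \<otimes> d i \<oplus> x = t \<otimes> d j \<oplus> y"
      then have "d i = d j" using Cons.prems dD[of i] dD[of j] xy by auto
      then show False using d(1) ij by (auto dest: injD)
    qed
  qed
qed simp

text \<open>Take an independent tuple of maximal length: adding \<open>r\<close> to it produces a collision, which codes \<open>r\<close>.\<close>

lemma exists_coding_tuple:
  assumes fin: "finite_morley_rank R" and D: "definable_subset R D" "infinite D"
  shows "\<exists>ts. set ts \<subseteq> carrier R \<and>
     (\<forall>r\<in>carrier R. \<exists>ds. length ds = 2 + 2 * length ts \<and> set ds \<subseteq> D \<and> codes R ts r ds)"
proof -
  have DR: "D \<subseteq> carrier R" using D(1) by (simp add: definable_subset_def)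
  obtain n where n: "\<And>S. S \<subseteq> carrier R \<Longrightarrow> \<not> morley_ge_subset R n S" using finite_morley_rankD[OF fin] by blast
  have suffix: "independent_over R D (us @ vs) \<Longrightarrow> independent_over R D vs" for us vs
    by (induction us) auto
  have bound: "length ts < n" if ts: "independent_over R D ts" for ts
  proof (rule ccontr)
    assume "\<not> length ts < n"
    let ?ts = "drop (length ts - n) ts"
    have i: "independent_over R D ?ts" using ts suffix[of "take (length ts - n) ts" ?ts] by simp
    then have "morley_ge_subset R n (lin_image R D ?ts)"
      using morley_ge_independent_over[OF D i] \<open>\<not> length ts < n\<close> by simp
    then show False using n[OF lin_image_subset[OF DR independent_over_carrier[OF i]]] by simp
  qed
  have "independent_over R D []" by simp
  from ex_has_greatest_nat[of "independent_over R D" "[]" length n, OF this]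
  obtain ts where ts: "independent_over R D ts" and max: "\<And>us. independent_over R D us \<Longrightarrow> length us \<le> length ts"
    using bound less_imp_le by blast
  have tsR: "set ts \<subseteq> carrier R" by (rule independent_over_carrier[OF ts])
  have "\<exists>ds. length ds = 2 + 2 * length ts \<and> set ds \<subseteq> D \<and> codes R ts r ds" if r: "r \<in> carrier R" for r
  proof -
    have "\<not> independent_over R D (r # ts)" using max[of "r # ts"] by auto
    then obtain d d' s s' where d: "d \<in> D" "d' \<in> D" "d \<noteq> d'" and s: "s \<in> lin_image R D ts" "s' \<in> lin_image R D ts"
      and e: "r \<otimes> d \<oplus> s = r \<otimes> d' \<oplus> s'" using r ts by auto
    obtain ds where ds: "length ds = length ts" "set ds \<subseteq> D" "s = lin_comb R (map (\<lambda>t. (t, 1)) ts) ds"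
      using lin_image_lin_comb[OF s(1) DR tsR] by auto
    obtain ds' where ds': "length ds' = length ts" "set ds' \<subseteq> D" "s' = lin_comb R (map (\<lambda>t. (t, 1)) ts) ds'"
      using lin_image_lin_comb[OF s(2) DR tsR] by auto
    have "codes R ts r (d # d' # ds @ ds')"
      using d e ds ds' by (simp add: codes_def numeral_2_eq_2)
    then show ?thesis using d ds ds' by (intro exI[of _ "d # d' # ds @ ds'"]) auto
  qed
  then show ?thesis using tsR by blast
qed

lemma codef_codes_comb:
  assumes "set ts \<subseteq> A" "A \<subseteq> carrier R" "fst ` set hs \<subseteq> A" "length js = (2 + 2 * length ts) * length hs"
  shows "self.codef A (\<lambda>v. codes_comb R ts hs (v i) (map v js)) (\<lambda>v. codes_comb R ts hs (v i) (map v js))"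
  using assms(3,4)
proof (induction hs arbitrary: i js)
  case Nil
  have "self.codef A (\<lambda>v. v i = \<zero>) (\<lambda>v. v i = \<zero>)" by (intro self.codef_eq self.coterm_intros)
  then show ?case unfolding codes_comb.simps .
next
  case (Cons h hs)
  let ?L = "2 + 2 * length ts"
  let ?ts = "map (\<lambda>t. (t, 1::nat)) ts"
  \<comment> \<open>Variables for the quantified \<open>r\<close> and \<open>y\<close>; being named
    rather than shifted, they must avoid \<open>i\<close> and all of \<open>js\<close>.\<close>
  obtain a where a: "a \<notin> set (i # js)" using ex_new_if_finite[of "set (i # js)"] by auto
  obtain b where b: "b \<notin> set (a # i # js)" using ex_new_if_finite[of "set (a # i # js)"] by auto
  have len: "length js \<ge> ?L" using Cons.prems(2) by simp
  have IH: "self.codef A (\<lambda>v. codes_comb R ts hs (v b) (map v (drop ?L js))) (\<lambda>v. codes_comb R ts hs (v b) (map v (drop ?L js)))"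
    by (rule Cons.IH) (use Cons.prems in auto)
  have h: "fst h \<in> A" using Cons.prems by auto
  have ts: "fst ` set ?ts \<subseteq> A" using assms(1) by auto
  have lc: "self.coterm A (\<lambda>v. lin_comb R ?ts (map v ks)) (\<lambda>v. lin_comb R ?ts (map v ks))" if "length ks = length ts" for ks
    using self.coterm_lin_comb[OF ts, of ks] that by simp
  let ?k0 = "take (length ts) (drop 2 js)" and ?k1 = "take (length ts) (drop (2 + length ts) js)"
  have codes: "codes R ts (v a) (map v js) \<longleftrightarrow> v (js ! 0) \<noteq> v (js ! 1) \<and>
      v a \<otimes> v (js ! 0) \<oplus> lin_comb R ?ts (map v ?k0) = v a \<otimes> v (js ! 1) \<oplus> lin_comb R ?ts (map v ?k1)" for v
  proof -
    have "0 < length js" "1 < length js" using len by auto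
    then show ?thesis by (simp add: codes_def take_map drop_map)
  qed
  have c: "self.codef A (\<lambda>v. codes R ts (v a) (map v js)) (\<lambda>v. codes R ts (v a) (map v js))"
    unfolding codes
    by (intro self.codef_and self.codef_not self.codef_eq self.coterm_add[OF _ lc] self.coterm_mult self.coterm_var)
      (use len in auto)
  have c': "self.codef A (\<lambda>v. v i = fst h \<otimes> v a [^] snd h \<oplus> v b) (\<lambda>v. v i = id (fst h) \<otimes> v a [^] snd h \<oplus> v b)"
    by (intro self.codef_eq self.coterm_intros h)
  have "self.codef A
      (\<lambda>v. v i = fst h \<otimes> v a [^] snd h \<oplus> v b \<and> codes R ts (v a) (map v js) \<and> codes_comb R ts hs (v b) (map v (drop ?L js)))
      (\<lambda>v. v i = id (fst h) \<otimes> v a [^] snd h \<oplus> v b \<and> codes R ts (v a) (map v js) \<and> codes_comb R ts hs (v b) (map v (drop ?L js)))"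
    by (intro self.codef_and c c' IH)
  note ex = self.codef_ex[OF self.codef_ex[OF this, of b], of a]
  have d: "a \<notin> set (drop ?L js)" "b \<notin> set (drop ?L js)" using a b by (auto dest: in_set_dropD)
  show ?case
    by (rule self.codef_cong[OF ex]) (use a b d in \<open>simp_all add: drop_map\<close>)
qed

text \<open>The assumption \<open>ann\<close> holds when \<open>g\<close> is annihilated by the maximal ideal.\<close>

lemma codes_comb_unique:
  assumes ts: "set ts \<subseteq> carrier R" and g: "g \<in> carrier R"
    and D: "D \<subseteq> gen_ideal R [g]"
    and ann: "\<And>h a r r'. h \<in> set hs \<Longrightarrow> a \<in> carrier R \<Longrightarrow> r \<in> carrier R \<Longrightarrow> r' \<in> carrier R \<Longrightarrow>
        g \<otimes> a \<noteq> \<zero> \<Longrightarrow> r \<otimes> (g \<otimes> a) = r' \<otimes> (g \<otimes> a) \<Longrightarrow> fst h \<otimes> r [^] snd h = fst h \<otimes> r' [^] snd h"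
    and "set ds \<subseteq> D" "length ds = (2 + 2 * length ts) * length hs"
    and "codes_comb R ts hs x ds" "codes_comb R ts hs x' ds"
  shows "x = x'"
  using assms(4-)
proof (induction hs arbitrary: x x' ds)
  case (Cons h hs)
  let ?L = "2 + 2 * length ts"
  let ?ts = "map (\<lambda>t. (t, 1::nat)) ts"
  obtain r y where r: "r \<in> carrier R" "y \<in> carrier R" "x = fst h \<otimes> r [^] snd h \<oplus> y" "codes R ts r ds"
    "codes_comb R ts hs y (drop ?L ds)" using Cons.prems(4) by auto
  obtain r' y' where r': "r' \<in> carrier R" "y' \<in> carrier R" "x' = fst h \<otimes> r' [^] snd h \<oplus> y'" "codes R ts r' ds"
    "codes_comb R ts hs y' (drop ?L ds)" using Cons.prems(5) by auto
  have y: "y = y'"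
  proof (rule Cons.IH[OF _ _ _ r(5) r'(5)])
    show "set (drop ?L ds) \<subseteq> D" using Cons.prems(2) set_drop_subset[of ?L ds] by blast
    show "length (drop ?L ds) = ?L * length hs" using Cons.prems(3) by simp
    show "fst k \<otimes> q [^] snd k = fst k \<otimes> q' [^] snd k"
      if "k \<in> set hs" "a \<in> carrier R" "q \<in> carrier R" "q' \<in> carrier R" "g \<otimes> a \<noteq> \<zero>" "q \<otimes> (g \<otimes> a) = q' \<otimes> (g \<otimes> a)"
      for k a q q'
      by (rule Cons.prems(1)[OF _ that(2-6)]) (use that(1) in simp)
  qed
  have len: "length ds \<ge> ?L" using Cons.prems(3) by simp
  define s where "s = lin_comb R ?ts (take (length ts) (drop 2 ds))"
  define s' where "s' = lin_comb R ?ts (take (length ts) (drop (2 + length ts) ds))"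
  have DR: "D \<subseteq> carrier R" using D gen_ideal_subset[of "[g]"] g by auto
  then have dsR: "set ds \<subseteq> carrier R" using Cons.prems(2) by blast
  have s: "s \<in> carrier R" "s' \<in> carrier R"
    unfolding s_def s'_def
    by (rule lin_comb_closed; use ts dsR len in \<open>force dest: in_set_takeD in_set_dropD\<close>)+
  have "0 < length ds" "1 < length ds" using len by auto
  then have d: "ds ! 0 \<in> D" "ds ! 1 \<in> D" using Cons.prems(2) nth_mem by blast+
  have "ds ! 0 \<noteq> ds ! 1" using r(4) by (simp add: codes_def)
  have "set [g] \<subseteq> carrier R" using g by simp
  then interpret I: ideal "gen_ideal R [g]" R by (rule ideal_gen_ideal)
  have c: "ds ! 0 \<in> carrier R" "ds ! 1 \<in> carrier R" by (rule subsetD[OF DR d(1)], rule subsetD[OF DR d(2)])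
  \<comment> \<open>The ideal is principal, so the difference takes the form
    \<open>g \<otimes> a\<close> to which \<open>ann\<close> applies.\<close>
  have "ds ! 0 \<ominus> ds ! 1 \<in> gen_ideal R [g]"
    unfolding a_minus_def by (rule I.a_closed[OF subsetD[OF D d(1)] I.a_inv_closed[OF subsetD[OF D d(2)]]])
  then obtain a where a: "a \<in> carrier R" "ds ! 0 \<ominus> ds ! 1 = g \<otimes> a"
    unfolding gen_ideal_singleton[OF g] by blast
  have ne: "g \<otimes> a \<noteq> \<zero>" using minus_eq_zero_iff[OF c] \<open>ds ! 0 \<noteq> ds ! 1\<close> a(2) by simp
  \<comment> \<open>The right-hand side is free of \<open>q\<close>: all elements coded by the same
    block have the same product with \<open>g \<otimes> a\<close>.\<close>
  have key: "q \<otimes> (g \<otimes> a) = s' \<ominus> s" if q: "q \<in> carrier R" "codes R ts q ds" for q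
  proof -
    have e: "q \<otimes> ds ! 0 \<oplus> s = q \<otimes> ds ! 1 \<oplus> s'" using q(2) unfolding codes_def s_def s'_def by simp
    have "q \<otimes> (ds ! 0 \<ominus> ds ! 1) = (q \<otimes> ds ! 0 \<oplus> s) \<ominus> s \<ominus> q \<otimes> ds ! 1"
      using q(1) c s by algebra
    also have "\<dots> = s' \<ominus> s" unfolding e using q(1) c s by algebra
    finally show ?thesis unfolding a(2) .
  qed
  have "fst h \<otimes> r [^] snd h = fst h \<otimes> r' [^] snd h"
  proof (rule Cons.prems(1)[OF _ a(1) r(1) r'(1) ne])
    show "r \<otimes> (g \<otimes> a) = r' \<otimes> (g \<otimes> a)" unfolding key[OF r(1,4)] key[OF r'(1,4)] ..
  qed simp
  then show ?case unfolding r(3) r'(3) y by simp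
qed simp

lemma codes_comb_exists:
  assumes hs: "fst ` set hs \<subseteq> carrier R" and D: "D \<subseteq> carrier R"
    and code: "\<And>r. r \<in> carrier R \<Longrightarrow> \<exists>ds. length ds = 2 + 2 * length ts \<and> set ds \<subseteq> D \<and> codes R ts r ds"
    and "length rs = length hs" "set rs \<subseteq> carrier R"
  shows "\<exists>ds. length ds = (2 + 2 * length ts) * length hs \<and> set ds \<subseteq> D \<and> codes_comb R ts hs (lin_comb R hs rs) ds"
  using assms(1,4,5)
proof (induction hs arbitrary: rs)
  case Nil
  then show ?case by (intro exI[of _ "[]"]) simp
next
  case (Cons h hs)
  obtain r rs' where rs: "rs = r # rs'" "length rs' = length hs" "r \<in> carrier R" "set rs' \<subseteq> carrier R"
    using Cons.prems by (cases rs) auto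
  obtain ds where ds: "length ds = (2 + 2 * length ts) * length hs" "set ds \<subseteq> D" "codes_comb R ts hs (lin_comb R hs rs') ds"
    using Cons.IH[of rs'] Cons.prems rs by auto
  obtain es where es: "length es = 2 + 2 * length ts" "set es \<subseteq> D" "codes R ts r es" using code[OF rs(3)] by auto
  have "lin_comb R hs rs' \<in> carrier R" using lin_comb_closed[of hs rs'] Cons.prems rs by auto
  \<comment> \<open>\<open>codes\<close> reads only the first \<open>2 + 2 * length ts\<close>
    entries, so the later blocks may follow.\<close>
  moreover have "codes R ts r (es @ ds)" using es by (auto simp: codes_def nth_append)
  ultimately have "codes_comb R ts (h # hs) (lin_comb R (h # hs) rs) (es @ ds)"
    using rs ds(3) es(1) by auto
  then show ?case using ds es by (intro exI[of _ "es @ ds"]) auto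
qed

end

text \<open>The points of \<open>subset_iset D\<close> are singletons \<open>{[x]}\<close>, so a set
  of points and the union that \<open>strongly_minimal\<close> takes to be definable are the same
  subset of \<open>D\<close>.\<close>

lemma (in cring) strongly_minimal_subset_iset:
  assumes D: "definable_subset R D" "infinite D"
    "\<And>Y. Y \<subseteq> D \<Longrightarrow> definable_subset R Y \<Longrightarrow> finite Y \<or> finite (D - Y)"
  shows "strongly_minimal R (subset_iset D)"
proof -
  interpret self: elementary_extension R R id by (rule elementary_extension_id)
  let ?s = "\<lambda>x::'a. {[x]}"
  have inj: "inj ?s" by (auto simp: inj_def)
  have "interpretable R (carrier R) (subset_iset D)"
    using self.codef_interpretable_subset_iset[of "carrier R" D D] D(1) by (simp add: definable_subset_iff_codef)
  moreover have "infinite (points (subset_iset D))"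
    unfolding points_subset_iset using D(2) finite_imageD inj inj_on_subset by blast
  moreover have "finite Y \<or> finite (points (subset_iset D) - Y)"
    if Y: "Y \<subseteq> points (subset_iset D)" "definable R (carrier R) (arity (subset_iset D)) (\<Union>Y)" for Y
  proof -
    obtain Z where Z: "Z \<subseteq> D" "Y = ?s ` Z" using Y(1) unfolding points_subset_iset by (auto simp: subset_image_iff)
    have "\<Union>Y = (\<lambda>x. [x]) ` Z" unfolding Z(2) by auto
    then have "definable_subset R Z"
      using Y(2) Z(1) D(1) by (auto simp: definable_subset_def subset_iset_def)
    then have "finite Z \<or> finite (D - Z)" using D(3) Z(1) by blast
    moreover have "points (subset_iset D) - Y = ?s ` (D - Z)"
      unfolding points_subset_iset Z(2) by auto
    ultimately show ?thesis unfolding Z(2) by auto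
  qed
  ultimately show ?thesis by (simp add: strongly_minimal_def)
qed

section \<open>Almost internality\<close>

text \<open>The clause of \<open>lifts_residues\<close> that is carried over to \<open>M\<close>,
  for the images of coefficient and generators.\<close>

definition coset_lifting :: "('a, 'm) ring_scheme \<Rightarrow> 'a \<times> nat \<Rightarrow> 'a list \<times> 'a \<Rightarrow> bool" where
  "coset_lifting M h w \<longleftrightarrow> (\<forall>x\<in>carrier M. \<forall>y\<in>carrier M. x \<ominus>\<^bsub>M\<^esub> y \<in> colon M (fst w) (snd w) \<longrightarrow>
     fst h \<otimes>\<^bsub>M\<^esub> x [^]\<^bsub>M\<^esub> snd h = fst h \<otimes>\<^bsub>M\<^esub> y [^]\<^bsub>M\<^esub> snd h)"

text \<open>Replacing an \<open>r\<close> by another member of its coset leaves its term unchanged.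
  This supplies the uniqueness condition of \<open>algebraic_over_universeI\<close>.\<close>

lemma lin_comb_coset:
  assumes "list_all2 (coset_lifting M) hs ws" "set rs \<subseteq> carrier M" "length rs = length ws"
    and "ys \<in> listset (map2 (\<lambda>w r. {[y] | y. y \<in> carrier M \<and> r \<ominus>\<^bsub>M\<^esub> y \<in> colon M (fst w) (snd w)}) ws rs)"
  shows "\<exists>rs'. ys = map (\<lambda>r. [r]) rs' \<and> set rs' \<subseteq> carrier M \<and> lin_comb M hs rs' = lin_comb M hs rs"
  using assms
proof (induction arbitrary: rs ys rule: list_all2_induct)
  case Nil
  then show ?case by auto
next
  case (Cons h hs w ws)
  obtain r rs1 where rs: "rs = r # rs1" "r \<in> carrier M" "set rs1 \<subseteq> carrier M" "length rs1 = length ws"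
    using Cons.prems by (cases rs) auto
  obtain y ys1 where ys: "ys = [y] # ys1" "y \<in> carrier M" "r \<ominus>\<^bsub>M\<^esub> y \<in> colon M (fst w) (snd w)"
    "ys1 \<in> listset (map2 (\<lambda>w r. {[y] | y. y \<in> carrier M \<and> r \<ominus>\<^bsub>M\<^esub> y \<in> colon M (fst w) (snd w)}) ws rs1)"
    using Cons.prems(3) rs(1) by (auto simp: set_Cons_def)
  obtain rs' where rs': "ys1 = map (\<lambda>r. [r]) rs'" "set rs' \<subseteq> carrier M" "lin_comb M hs rs' = lin_comb M hs rs1"
    using Cons.IH[OF rs(3,4) ys(4)] by auto
  have "fst h \<otimes>\<^bsub>M\<^esub> r [^]\<^bsub>M\<^esub> snd h = fst h \<otimes>\<^bsub>M\<^esub> y [^]\<^bsub>M\<^esub> snd h"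
    using Cons.hyps(1) rs(2) ys(2,3) by (simp add: coset_lifting_def)
  then show ?case using rs ys rs' by (intro exI[of _ "y # rs'"]) auto
qed

text \<open>The existence condition that goes with it: each \<open>r\<close> lies in its own coset,
  as an ideal contains \<open>\<zero>\<close>.\<close>

lemma (in cring) coset_representatives:
  assumes "\<And>w. w \<in> set ws \<Longrightarrow> ideal (colon R (fst w) (snd w)) R" "set rs \<subseteq> carrier R" "length rs = length ws"
  shows "map (\<lambda>r. [r]) rs \<in> listset (map2 (\<lambda>w r. {[y] | y. y \<in> carrier R \<and> r \<ominus> y \<in> colon R (fst w) (snd w)}) ws rs)"
  using assms
proof (induction ws arbitrary: rs)
  case Nil
  then show ?case by simp
next
  case (Cons w ws)
  obtain r rs1 where rs: "rs = r # rs1" "r \<in> carrier R" "set rs1 \<subseteq> carrier R" "length rs1 = length ws"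
    using Cons.prems by (cases rs) auto
  interpret I: ideal "colon R (fst w) (snd w)" R using Cons.prems(1) by simp
  have "r \<ominus> r \<in> colon R (fst w) (snd w)" using rs(2) I.zero_closed by (simp add: a_minus_def r_neg)
  moreover have "map (\<lambda>r. [r]) rs1 \<in> listset (map2 (\<lambda>w r. {[y] | y. y \<in> carrier R \<and> r \<ominus> y \<in> colon R (fst w) (snd w)}) ws rs1)"
    using Cons.IH[OF _ rs(3,4)] Cons.prems(1) by simp
  ultimately show ?case using rs(1,2) by (auto simp: set_Cons_def)
qed

lemma colon_Nil_iff: "x \<in> colon R [] g \<longleftrightarrow> x \<in> carrier R \<and> g \<otimes>\<^bsub>R\<^esub> x = \<zero>\<^bsub>R\<^esub>"
  by (simp add: colon_def)

lemma (in cring) strict_chain_singleton: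
  assumes g: "g \<in> carrier R" "maximalideal (colon R [] g) R"
  shows "strict_chain R [g]"
proof -
  interpret m: maximalideal "colon R [] g" R by fact
  have "\<one> \<notin> colon R [] g" using m.one_imp_carrier m.I_notcarr by blast
  then have "g \<noteq> \<zero>" unfolding colon_def by auto
  then show ?thesis using g(1) by simp
qed

text \<open>The second alternative covers the zero ring, which has no maximal ideals: there the
  parameter set is empty and still smaller than the carrier.\<close>

lemma finite_lesspoll_carrier:
  assumes "finite A" "infinite C \<or> A = {} \<and> C \<noteq> {}"
  shows "A \<prec> C"
proof (cases "infinite C")
  case True
  then show ?thesis using assms(1) finite_lesspoll_infinite by blast
next
  case False
  then have "A = {}" "C \<noteq> {}" using assms(2) by auto
  then show ?thesis by (auto simp: lesspoll_def lepoll_def eqpoll_def bij_betw_def)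
qed

context elementary_extension
begin

definition residue_params :: "('a \<times> nat) list \<Rightarrow> ('a list \<times> 'a) list \<Rightarrow> 'a set" where
  "residue_params hs ws = fst ` set hs \<union> (\<Union>w\<in>set ws. insert (snd w) (set (fst w)))"

lemma residue_params_carrier:
  "list_all2 (lifts_residues R) hs ws \<Longrightarrow> residue_params hs ws \<subseteq> carrier R"
  unfolding residue_params_def
  by (induction rule: list_all2_induct) (auto simp: lifts_residues_def)

lemma lifts_residues_transfer:
  assumes "lifts_residues R h w"
  shows "coset_lifting M (f (fst h), snd h) (map f (fst w), f (snd w))"
proof -
  let ?A = "insert (fst h) (insert (snd w) (set (fst w)))"
  have A: "?A \<subseteq> carrier R" using assms by (auto simp: lifts_residues_def)
  have m: "codef_set ?A (colon R (fst w) (snd w)) (colon M (map f (fst w)) (f (snd w)))"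
    by (rule codef_set_colon[OF _ _ A]) auto
  have c: "codef ?A
     (\<lambda>v. v 0 \<ominus>\<^bsub>R\<^esub> v 1 \<in> colon R (fst w) (snd w) \<longrightarrow> fst h \<otimes>\<^bsub>R\<^esub> v 0 [^]\<^bsub>R\<^esub> snd h = fst h \<otimes>\<^bsub>R\<^esub> v 1 [^]\<^bsub>R\<^esub> snd h)
     (\<lambda>v. v 0 \<ominus>\<^bsub>M\<^esub> v 1 \<in> colon M (map f (fst w)) (f (snd w)) \<longrightarrow>
        f (fst h) \<otimes>\<^bsub>M\<^esub> v 0 [^]\<^bsub>M\<^esub> snd h = f (fst h) \<otimes>\<^bsub>M\<^esub> v 1 [^]\<^bsub>M\<^esub> snd h)"
    by (intro codef_imp codef_eq codef_mem[OF m] coterm_intros A insertI1)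
  show ?thesis unfolding coset_lifting_def fst_conv snd_conv
  proof (intro ballI impI)
    fix x y assume xy: "x \<in> carrier M" "y \<in> carrier M" "x \<ominus>\<^bsub>M\<^esub> y \<in> colon M (map f (fst w)) (f (snd w))"
    let ?v = "\<lambda>i::nat. if i = 0 then x else y"
    have "?v 0 \<ominus>\<^bsub>M\<^esub> ?v 1 \<in> colon M (map f (fst w)) (f (snd w)) \<longrightarrow>
        f (fst h) \<otimes>\<^bsub>M\<^esub> ?v 0 [^]\<^bsub>M\<^esub> snd h = f (fst h) \<otimes>\<^bsub>M\<^esub> ?v 1 [^]\<^bsub>M\<^esub> snd h"
    proof (rule codef_transfer_all[OF c A])
      fix v :: "nat \<Rightarrow> 'a" assume "range v \<subseteq> carrier R"
      then have "v (0::nat) \<in> carrier R" "v 1 \<in> carrier R" by auto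
      then show "v 0 \<ominus>\<^bsub>R\<^esub> v 1 \<in> colon R (fst w) (snd w) \<longrightarrow> fst h \<otimes>\<^bsub>R\<^esub> v 0 [^]\<^bsub>R\<^esub> snd h = fst h \<otimes>\<^bsub>R\<^esub> v 1 [^]\<^bsub>R\<^esub> snd h"
        using assms unfolding lifts_residues_def by blast
    qed (use xy in auto)
    then show "f (fst h) \<otimes>\<^bsub>M\<^esub> x [^]\<^bsub>M\<^esub> snd h = f (fst h) \<otimes>\<^bsub>M\<^esub> y [^]\<^bsub>M\<^esub> snd h" using xy(3) by simp
  qed
qed

text \<open>Representability by \<open>hs\<close> is membership in a set defined by one formula over
  the coefficients, so its validity for all elements passes from \<open>R\<close> to
  \<open>M\<close>.\<close>

lemma lin_comb_transfer:
  assumes hs: "fst ` set hs \<subseteq> carrier R"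
    and x: "\<And>x. x \<in> carrier R \<Longrightarrow> \<exists>rs. length rs = length hs \<and> set rs \<subseteq> carrier R \<and> x = lin_comb R hs rs"
    and y: "y \<in> carrier M"
  shows "\<exists>rs. length rs = length hs \<and> set rs \<subseteq> carrier M \<and> y = lin_comb M (map_coeffs f hs) rs"
proof -
  have c: "codef (carrier R) (\<lambda>v. v 0 \<in> lin_span R hs) (\<lambda>v. v 0 \<in> lin_span M (map_coeffs f hs))"
    using codef_set_lin_span[OF hs order_refl] by (simp add: codef_set_def)
  have "y \<in> lin_span M (map_coeffs f hs)"
  proof (rule codef_transfer_all[OF c order_refl, of "\<lambda>_. y"])
    fix v :: "nat \<Rightarrow> 'a" assume "range v \<subseteq> carrier R"
    then have "v (0::nat) \<in> carrier R" by auto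
    then show "v 0 \<in> lin_span R hs" using x by (auto simp: lin_span_def)
  qed (use y in auto)
  then show ?thesis by (auto simp: lin_span_def)
qed

lemma interpretable_universe: "interpretable M B (universe M)"
proof -
  have "codef {} (\<lambda>v. v 0 \<in> carrier R) (\<lambda>v. v 0 \<in> carrier M)"
    by (rule codef_cong[OF codef_True]) auto
  then have "codef_set {} (carrier R) (carrier M)" by (simp add: codef_set_def)
  from codef_interpretable_subset_iset[OF this]
  have "interpretable M {} (universe M)" by (simp add: universe_eq)
  then show ?thesis unfolding interpretable_def using definable_mono by blast
qed

text \<open>The classes of the entries of \<open>rs\<close> in a representation of an element
  determine that element, whichever representatives are read. One set \<open>B\<close> serves for
  all elements: the images of the finitely many coefficients and generators.\<close>

theorem almost_internal_residue_family:
  assumes hw: "list_all2 (lifts_residues R) hs ws"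
    and x: "\<And>x. x \<in> carrier R \<Longrightarrow> \<exists>rs. length rs = length hs \<and> set rs \<subseteq> carrier R \<and> x = lin_comb R hs rs"
    and size: "infinite (carrier M) \<or> ws = []"
  shows "almost_internal M {} (extend_iset R M f ` residue_family R) (universe M)"
proof -
  let ?A = "residue_params hs ws"
  let ?B = "f ` ?A"
  have A: "?A \<subseteq> carrier R" by (rule residue_params_carrier[OF hw])
  have hs: "fst ` set hs \<subseteq> ?A" by (auto simp: residue_params_def)
  \<comment> \<open>Without residue classes there are no coefficients either, and an empty
    \<open>B\<close> is small even if \<open>M\<close> is finite.\<close>
  have "ws = [] \<Longrightarrow> ?A = {}" using hw by (auto simp: residue_params_def)
  then have small: "?B \<prec> carrier M"
    using size M.zero_closed by (intro finite_lesspoll_carrier) (auto simp: residue_params_def)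
  let ?ws = "map (\<lambda>w. (map f (fst w), f (snd w))) ws"
  let ?hs = "map_coeffs f hs"
  have hw': "list_all2 (coset_lifting M) ?hs ?ws"
    using hw unfolding map_coeffs_def list_all2_map1 list_all2_map2
    by (rule list_all2_mono) (rule lifts_residues_transfer)
  have w: "set (fst w) \<subseteq> ?A" "snd w \<in> ?A" "maximalideal (colon R (fst w) (snd w)) R" if w: "w \<in> set ws" for w
  proof -
    show "set (fst w) \<subseteq> ?A" "snd w \<in> ?A" using w by (auto simp: residue_params_def)
    obtain h where "lifts_residues R h w"
      using hw w by (metis in_set_conv_nth list_all2_conv_all_nth)
    then show "maximalideal (colon R (fst w) (snd w)) R" by (simp add: lifts_residues_def)
  qed
  have ideal: "ideal (colon M (fst w') (snd w')) M" if w': "w' \<in> set ?ws" for w'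
  proof -
    obtain u where u: "u \<in> set ws" "w' = (map f (fst u), f (snd u))" using w' by auto
    have "set (fst u) \<subseteq> carrier R" "snd u \<in> carrier R" using w(1,2)[OF u(1)] A by blast+
    then show ?thesis unfolding u(2) fst_conv snd_conv by (intro M.ideal_colon) auto
  qed
  have len: "length ws = length hs" using list_all2_lengthD[OF hw] by simp
  have "\<exists>es. (\<forall>e\<in>set es. \<exists>P\<in>extend_iset R M f ` residue_family R. interpretable M ?B P \<and> e \<in> points P) \<and>
      algebraic_over M ?B (universe M) es c" if cp: "c \<in> points (universe M)" for c
  proof -
    obtain y where y: "y \<in> carrier M" "c = {[y]}" using cp by (auto simp: universe_eq points_subset_iset)
    obtain rs where rs: "length rs = length hs" "set rs \<subseteq> carrier M" "y = lin_comb M ?hs rs"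
      using lin_comb_transfer[OF order_trans[OF hs A] x y(1)] by auto
    let ?cl = "\<lambda>w r. {[y] | y. y \<in> carrier M \<and> r \<ominus>\<^bsub>M\<^esub> y \<in> colon M (fst w) (snd w)}"
    \<comment> \<open>The \<open>i\<close>-th point is the class of the \<open>i\<close>-th entry of
      \<open>rs\<close> modulo the \<open>i\<close>-th ideal, written as a set of 1-tuples.\<close>
    let ?es = "map2 ?cl ?ws rs"
    have "\<exists>P\<in>extend_iset R M f ` residue_family R. interpretable M ?B P \<and> e \<in> points P" if e: "e \<in> set ?es" for e
    proof -
      obtain w' r where wr: "(w', r) \<in> set (zip ?ws rs)" "e = ?cl w' r" using e by auto
      then have "w' \<in> set ?ws" "r \<in> carrier M" using rs(2) by (auto dest: set_zip_leftD set_zip_rightD)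
      then obtain u where u: "u \<in> set ws" "w' = (map f (fst u), f (snd u))" by auto
      let ?m = "colon R (fst u) (snd u)" and ?m' = "colon M (fst w') (snd w')"
      have m: "codef_set ?A ?m ?m'" using codef_set_colon[OF w(1,2)[OF u(1)] A] u(2) by simp
      interpret m': ideal ?m' M using ideal[OF \<open>w' \<in> set ?ws\<close>] .
      have "residue_iset R ?m \<in> residue_family R" using w(3)[OF u(1)] by (simp add: residue_family_def)
      moreover have "extend_iset R M f (residue_iset R ?m) = residue_iset M ?m'"
        "interpretable M ?B (residue_iset M ?m')"
        using extend_residue_iset[OF m A] m'.is_ideal by auto
      moreover have "e \<in> points (residue_iset M ?m')"
      proof -
        have "eqrel (residue_iset M ?m') `` {[r]} \<in> base (residue_iset M ?m') // eqrel (residue_iset M ?m')"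
          using \<open>r \<in> carrier M\<close> by (intro quotientI) (simp add: residue_iset_def tuples_1[unfolded One_nat_def])
        then show ?thesis unfolding m'.ideal_eq_residue_class[OF \<open>r \<in> carrier M\<close>] points_def wr(2) .
      qed
      ultimately show ?thesis by (metis imageI)
    qed
    moreover have "algebraic_over M ?B (universe M) ?es {[y]}"
    proof (rule algebraic_over_universeI[OF _ A y(1)])
      show "codef ?A (\<lambda>v. v 0 = lin_comb R hs (map v [1..<Suc (length hs)]))
          (\<lambda>v. v 0 = lin_comb M ?hs (map v [1..<Suc (length hs)]))"
        by (intro codef_eq coterm_var coterm_lin_comb[OF hs]) (simp del: upt_Suc)
      show "length ?es = length hs" using rs(1) len by simp
      show "\<exists>rs'. ys = map (\<lambda>r. [r]) rs' \<and> set rs' \<subseteq> carrier M \<and> (\<forall>z\<in>carrier M. z = lin_comb M ?hs rs' \<longrightarrow> z = y)"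
        if ys: "ys \<in> listset ?es" for ys
        using lin_comb_coset[OF hw' rs(2) _ ys] rs(1,3) len by auto
      have "map (\<lambda>r. [r]) rs \<in> listset ?es"
        by (rule M.coset_representatives[OF ideal rs(2)]) (use rs(1) len in auto)
      then show "\<exists>rs'. map (\<lambda>r. [r]) rs' \<in> listset ?es \<and> y = lin_comb M ?hs rs'" using rs(3) by blast
    qed
    ultimately show ?thesis unfolding y(2) by blast
  qed
  moreover have "?B \<subseteq> carrier M" using A by auto
  ultimately show ?thesis unfolding almost_internal_def
    using small interpretable_universe by (intro conjI exI[of _ ?B]) auto
qed

text \<open>The residue field of a local ring is isomorphic to a minimal ideal \<open>g R\<close>; the strongly minimal set is
  found inside \<open>g M\<close>.\<close>

theorem almost_strongly_minimal_local:
  assumes fin: "finite_morley_rank M" and inf: "\<And>m. maximalideal m R \<Longrightarrow> infinite (carrier (R Quot m))"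
    and hw: "list_all2 (lifts_residues R) hs ws"
    and x: "\<And>x. x \<in> carrier R \<Longrightarrow> \<exists>rs. length rs = length hs \<and> set rs \<subseteq> carrier R \<and> x = lin_comb R hs rs"
    and g: "g \<in> carrier R" "maximalideal (colon R [] g) R"
    and loc: "\<And>m. maximalideal m R \<Longrightarrow> m = colon R [] g"
    and size: "infinite (carrier M)"
  shows "almost_strongly_minimal M {} (universe M)"
proof -
  \<comment> \<open>\<open>D\<close> and \<open>ts\<close> are found in \<open>M\<close> and need
    not come from \<open>R\<close>, so definability over them is expressed through the identity on
    \<open>M\<close>.\<close>
  interpret self: elementary_extension M M id by (rule M.elementary_extension_id)
  interpret m: maximalideal "colon R [] g" R by fact
  interpret m: primeideal "colon R [] g" R by (rule R.maximalideal_prime[OF g(2)])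
  let ?hs = "map_coeffs f hs"
  have hsR: "fst ` set hs \<subseteq> carrier R"
    using residue_params_carrier[OF hw] by (auto simp: residue_params_def)
  then have hsM: "fst ` set ?hs \<subseteq> carrier M" by auto
  have "strict_chain R [g]" by (rule R.strict_chain_singleton[OF g])
  from morley_ge_strict_chain[OF inf this]
  \<comment> \<open>A strict chain of length one gives rank at least 1, hence an infinite
    set.\<close>
  have "infinite (gen_ideal M [f g])" using morley_ge_subset_infinite[of M 0] by simp
  moreover have "definable_subset M (gen_ideal M [f g])"
    using codef_set_definable_subset[OF codef_set_gen_ideal[of "[g]" "carrier R"]] g(1) by simp
  ultimately obtain D where D: "D \<subseteq> gen_ideal M [f g]" "definable_subset M D" "infinite D"
    "\<And>Y. Y \<subseteq> D \<Longrightarrow> definable_subset M Y \<Longrightarrow> finite Y \<or> finite (D - Y)"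
    using M.exists_minimal_definable_subset[OF fin] by metis
  have DM: "D \<subseteq> carrier M" using D(2) by (simp add: definable_subset_def)
  obtain C where C: "finite C" "C \<subseteq> carrier M" "self.codef_set C D D" using M.definable_subset_codef[OF D(2)] by auto
  obtain ts where ts: "set ts \<subseteq> carrier M"
    "\<forall>r\<in>carrier M. \<exists>ds. length ds = 2 + 2 * length ts \<and> set ds \<subseteq> D \<and> codes M ts r ds"
    using M.exists_coding_tuple[OF fin D(2,3)] by auto
  \<comment> \<open>Three finite sets: the parameters of \<open>D\<close>, the coefficients of the
    coordinates and the coding tuple.\<close>
  let ?B = "C \<union> fst ` set ?hs \<union> set ts"
  have B: "?B \<subseteq> carrier M" using C(2) hsM ts(1) by blast
  have small: "?B \<prec> carrier M" using size C(1) by (intro finite_lesspoll_carrier) auto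
  have ann: "fst h \<otimes>\<^bsub>M\<^esub> r [^]\<^bsub>M\<^esub> snd h = fst h \<otimes>\<^bsub>M\<^esub> r' [^]\<^bsub>M\<^esub> snd h"
    if h: "h \<in> set ?hs" and r: "a \<in> carrier M" "r \<in> carrier M" "r' \<in> carrier M"
      and e: "f g \<otimes>\<^bsub>M\<^esub> a \<noteq> \<zero>\<^bsub>M\<^esub>" "r \<otimes>\<^bsub>M\<^esub> (f g \<otimes>\<^bsub>M\<^esub> a) = r' \<otimes>\<^bsub>M\<^esub> (f g \<otimes>\<^bsub>M\<^esub> a)" for h a r r'
  proof -
    obtain k where k: "k \<in> set hs" "h = (f (fst k), snd k)" using h by (auto simp: map_coeffs_def)
    obtain w where w: "lifts_residues R k w" using hw k(1) by (metis in_set_conv_nth list_all2_conv_all_nth)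
    have kR: "fst k \<in> carrier R" using hsR k(1) by auto
    \<comment> \<open>The claim is first-order in \<open>a\<close>, \<open>r\<close> and
      \<open>r'\<close>. It is proved in \<open>R\<close>, where the annihilator of \<open>g\<close>
      is prime, and then transferred.\<close>
    have c: "codef (carrier R)
      (\<lambda>v. \<not> g \<otimes>\<^bsub>R\<^esub> v 0 = \<zero>\<^bsub>R\<^esub> \<longrightarrow> v 1 \<otimes>\<^bsub>R\<^esub> (g \<otimes>\<^bsub>R\<^esub> v 0) = v 2 \<otimes>\<^bsub>R\<^esub> (g \<otimes>\<^bsub>R\<^esub> v 0) \<longrightarrow>
        fst k \<otimes>\<^bsub>R\<^esub> v 1 [^]\<^bsub>R\<^esub> snd k = fst k \<otimes>\<^bsub>R\<^esub> v 2 [^]\<^bsub>R\<^esub> snd k)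
      (\<lambda>v. \<not> f g \<otimes>\<^bsub>M\<^esub> v 0 = \<zero>\<^bsub>M\<^esub> \<longrightarrow> v 1 \<otimes>\<^bsub>M\<^esub> (f g \<otimes>\<^bsub>M\<^esub> v 0) = v 2 \<otimes>\<^bsub>M\<^esub> (f g \<otimes>\<^bsub>M\<^esub> v 0) \<longrightarrow>
        f (fst k) \<otimes>\<^bsub>M\<^esub> v 1 [^]\<^bsub>M\<^esub> snd k = f (fst k) \<otimes>\<^bsub>M\<^esub> v 2 [^]\<^bsub>M\<^esub> snd k)"
      by (intro codef_imp codef_not codef_eq coterm_intros g(1) kR)
    let ?v = "\<lambda>i::nat. if i = 0 then a else if i = 1 then r else r'"
    have "\<not> f g \<otimes>\<^bsub>M\<^esub> ?v 0 = \<zero>\<^bsub>M\<^esub> \<longrightarrow> ?v 1 \<otimes>\<^bsub>M\<^esub> (f g \<otimes>\<^bsub>M\<^esub> ?v 0) = ?v 2 \<otimes>\<^bsub>M\<^esub> (f g \<otimes>\<^bsub>M\<^esub> ?v 0) \<longrightarrow>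
        f (fst k) \<otimes>\<^bsub>M\<^esub> ?v 1 [^]\<^bsub>M\<^esub> snd k = f (fst k) \<otimes>\<^bsub>M\<^esub> ?v 2 [^]\<^bsub>M\<^esub> snd k"
    proof (rule codef_transfer_all[OF c order_refl], intro impI)
      fix v :: "nat \<Rightarrow> 'a" assume v: "range v \<subseteq> carrier R" and n: "\<not> g \<otimes>\<^bsub>R\<^esub> v (0::nat) = \<zero>\<^bsub>R\<^esub>"
        and e: "v 1 \<otimes>\<^bsub>R\<^esub> (g \<otimes>\<^bsub>R\<^esub> v 0) = v 2 \<otimes>\<^bsub>R\<^esub> (g \<otimes>\<^bsub>R\<^esub> v 0)"
      have vR: "v 0 \<in> carrier R" "v 1 \<in> carrier R" "v 2 \<in> carrier R" using v by auto
      have cl: "v 1 \<otimes>\<^bsub>R\<^esub> (g \<otimes>\<^bsub>R\<^esub> v 0) \<in> carrier R" "v 2 \<otimes>\<^bsub>R\<^esub> (g \<otimes>\<^bsub>R\<^esub> v 0) \<in> carrier R" using vR g(1) by auto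
      have "g \<otimes>\<^bsub>R\<^esub> (v 0 \<otimes>\<^bsub>R\<^esub> (v 1 \<ominus>\<^bsub>R\<^esub> v 2)) = v 1 \<otimes>\<^bsub>R\<^esub> (g \<otimes>\<^bsub>R\<^esub> v 0) \<ominus>\<^bsub>R\<^esub> v 2 \<otimes>\<^bsub>R\<^esub> (g \<otimes>\<^bsub>R\<^esub> v 0)"
        using vR g(1) by algebra
      also have "\<dots> = \<zero>\<^bsub>R\<^esub>" using e R.minus_eq_zero_iff[OF cl] by simp
      finally have "v 0 \<otimes>\<^bsub>R\<^esub> (v 1 \<ominus>\<^bsub>R\<^esub> v 2) \<in> colon R [] g"
        unfolding colon_Nil_iff using vR by (intro conjI R.m_closed R.minus_closed)
      then have "v 0 \<in> colon R [] g \<or> v 1 \<ominus>\<^bsub>R\<^esub> v 2 \<in> colon R [] g"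
        by (rule m.I_prime[OF vR(1) R.minus_closed[OF vR(2,3)]])
      moreover have "v 0 \<notin> colon R [] g" using n unfolding colon_Nil_iff by blast
      \<comment> \<open>Locality enters here: the ideal that governs this coordinate is the
        annihilator of \<open>g\<close>.\<close>
      moreover have "colon R (fst w) (snd w) = colon R [] g" using w loc unfolding lifts_residues_def by blast
      ultimately have "v 1 \<ominus>\<^bsub>R\<^esub> v 2 \<in> colon R (fst w) (snd w)" by blast
      then show "fst k \<otimes>\<^bsub>R\<^esub> v 1 [^]\<^bsub>R\<^esub> snd k = fst k \<otimes>\<^bsub>R\<^esub> v 2 [^]\<^bsub>R\<^esub> snd k"
        using w vR unfolding lifts_residues_def by blast
    qed (use r in auto)
    then show ?thesis using e k(2) by simp
  qed
  let ?n = "(2 + 2 * length ts) * length ?hs"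
  have iD: "interpretable M ?B (subset_iset D)"
    using self.codef_interpretable_subset_iset[OF self.codef_set_mono[OF C(3)] B] by (simp add: Un_assoc)
  have alg: "\<exists>es. (\<forall>e\<in>set es. e \<in> points (subset_iset D)) \<and> algebraic_over M ?B (universe M) es c"
    if cp: "c \<in> points (universe M)" for c
  proof -
    obtain y where y: "y \<in> carrier M" "c = {[y]}" using cp by (auto simp: universe_eq points_subset_iset)
    obtain rs where rs: "length rs = length ?hs" "set rs \<subseteq> carrier M" "y = lin_comb M ?hs rs"
      using lin_comb_transfer[OF hsR x y(1)] by auto
    obtain ds where ds: "length ds = ?n" "set ds \<subseteq> D" "codes_comb M ts ?hs y ds"
      using M.codes_comb_exists[OF hsM DM _ rs(1,2), of ts] ts(2) rs(3) by auto
    let ?es = "map (\<lambda>d. {[d]}) ds"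
    have ls: "ys \<in> listset ?es \<longleftrightarrow> ys = map (\<lambda>d. [d]) ds" for ys
      unfolding listset_iff list_all2_map2 by (auto simp: list_all2_conv_all_nth list_eq_iff_nth_eq)
    have "algebraic_over M (id ` ?B) (universe M) ?es {[y]}"
    proof (rule self.algebraic_over_universeI[OF _ B y(1)])
      show "self.codef ?B (\<lambda>v. codes_comb M ts ?hs (v 0) (map v [1..<Suc ?n])) (\<lambda>v. codes_comb M ts ?hs (v 0) (map v [1..<Suc ?n]))"
        by (rule M.codef_codes_comb[OF _ B]) (auto simp del: upt_Suc)
      show "length ?es = ?n" using ds(1) by simp
      show "\<exists>rs. ys = map (\<lambda>r. [r]) rs \<and> set rs \<subseteq> carrier M \<and> (\<forall>z\<in>carrier M. codes_comb M ts ?hs z rs \<longrightarrow> z = y)"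
        if "ys \<in> listset ?es" for ys
      proof (intro exI[of _ ds] conjI ballI impI)
        show "ys = map (\<lambda>r. [r]) ds" using that ls by simp
        show "set ds \<subseteq> carrier M" using ds(2) DM by blast
        show "z = y" if "codes_comb M ts ?hs z ds" for z
          using M.codes_comb_unique[OF ts(1) _ D(1) ann ds(2,1) that ds(3)] g(1) by simp
      qed
      show "\<exists>rs. map (\<lambda>r. [r]) rs \<in> listset ?es \<and> codes_comb M ts ?hs y rs" using ls ds(3) by blast
    qed
    then show ?thesis using ds(2) unfolding y(2) points_subset_iset by (intro exI[of _ ?es]) auto
  qed
  have "almost_internal M {} {subset_iset D} (universe M)"
    unfolding almost_internal_def
  proof (intro conjI exI[of _ ?B] ballI)
    fix c assume "c \<in> points (universe M)"
    from alg[OF this] obtain es where "\<forall>e\<in>set es. e \<in> points (subset_iset D)" "algebraic_over M ?B (universe M) es c"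
      by (elim exE conjE)
    then show "\<exists>es. (\<forall>e\<in>set es. \<exists>P\<in>{subset_iset D}. interpretable M ?B P \<and> e \<in> points P) \<and>
        algebraic_over M ?B (universe M) es c"
      using iD by (intro exI[of _ es]) simp
  qed (use small B in \<open>simp_all only: interpretable_universe empty_subsetI\<close>)
  then show ?thesis unfolding almost_strongly_minimal_def
    using M.strongly_minimal_subset_iset[OF D(2,3,4)] by blast
qed

end

text \<open>Series grow at the head, so the last entry generates the bottom term, whose colon ideal
  is taken over the zero ideal and is therefore the annihilator.\<close>

lemma composition_series_last:
  "composition_series R gs \<Longrightarrow> gs \<noteq> [] \<Longrightarrow> last gs \<in> carrier R \<and> maximalideal (colon R [] (last gs)) R"
proof (induction gs)
  case (Cons g gs)
  then show ?case by (cases gs) auto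
qed simp

theorem theorem6p12:
  fixes R :: "('a, 'm) ring_scheme" and M :: "('b, 'k) ring_scheme" and f :: "'a \<Rightarrow> 'b"
  assumes "cring R"
    and "cring M" and "saturated M" and "elementary_embedding R M f"
    and "finite_morley_rank M"
    and "positive_characteristic R"
    and "\<And>\<mm>. maximalideal \<mm> R \<Longrightarrow> infinite (carrier (R Quot \<mm>))"
  shows "almost_internal M {} (extend_iset R M f ` residue_family R) (universe M) \<and>
         (local_cring R \<longrightarrow> almost_strongly_minimal M {} (universe M))"
proof -
  interpret elementary_extension R M f
    using assms(1,2,4) by (simp add: elementary_extension_def elementary_extension_axioms_def)
  obtain gs hs ws where gs: "composition_series R gs" "gen_ideal R gs = carrier R"
    and hw: "list_all2 (lifts_residues R) hs ws"
    and x: "\<forall>x\<in>carrier R. \<exists>rs. length rs = length hs \<and> set rs \<subseteq> carrier R \<and> x = lin_comb R hs rs"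
    using exists_coordinates[OF assms(7,5,6)] by auto
  \<comment> \<open>An embedding into a finite \<open>M\<close> would make \<open>R\<close>, and
    with it every residue field, finite.\<close>
  have inf: "infinite (carrier M)" if m: "maximalideal m R" for m
  proof
    assume "finite (carrier M)"
    then have "finite (carrier R)" using f_inj f_closed by (meson image_subsetI inj_on_finite)
    moreover have "carrier (R Quot m) = (\<lambda>x. m +>\<^bsub>R\<^esub> x) ` carrier R" by (auto simp: FactRing_simps)
    ultimately show False using assms(7)[OF m] by simp
  qed
  have "infinite (carrier M) \<or> ws = []"
  proof (cases ws)
    case (Cons w ws')
    then obtain h where "lifts_residues R h w" using hw by (auto simp: list_all2_Cons2)
    then show ?thesis using inf by (auto simp: lifts_residues_def)
  qed simp
  then have "almost_internal M {} (extend_iset R M f ` residue_family R) (universe M)"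
    using almost_internal_residue_family[OF hw] x by blast
  moreover have "almost_strongly_minimal M {} (universe M)" if loc: "local_cring R"
  proof -
    obtain m where m: "maximalideal m R" "\<And>k. maximalideal k R \<Longrightarrow> k = m" using loc by (auto simp: local_cring_def)
    interpret m: maximalideal m R by (rule m(1))
    \<comment> \<open>An empty series generates only \<open>\<zero>\<close>, but the zero ring has
      no maximal ideal.\<close>
    have "gs \<noteq> []"
    proof
      assume "gs = []"
      then have "carrier R = {\<zero>\<^bsub>R\<^esub>}" using gs(2) by simp
      then have "carrier R \<subseteq> m" using m.zero_closed by simp
      then show False using m.I_notcarr m.a_subset by (metis subset_antisym)
    qed
    then have g: "last gs \<in> carrier R" "maximalideal (colon R [] (last gs)) R"
      using composition_series_last[OF gs(1)] by auto
    show ?thesis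
      by (rule almost_strongly_minimal_local[OF assms(5,7) hw _ g _ inf[OF m(1)]])
        (use x m(2)[OF g(2)] m(2) in \<open>simp_all\<close>)
  qed
  ultimately show ?thesis by blast
qed

end
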